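(* For all $n\ge 1$, the Zhu algebra $A(\mathcal{H}(n)^{O(n)})$ is a commutative algebra.
   Context: Everything is over $\mathbb{C}$. $\mathcal{H}(n)$ is the rank $n$ Heisenberg vertex algebra, generated by fields $\alpha^1,\dots,\alpha^n$ with OPE $\alpha^i(z)\alpha^j(w)\sim\delta_{i,j}(z-w)^{-2}$, graded by conformal weight via the Virasoro element $L=\frac12\sum_{i=1}^n:\alpha^i\alpha^i:$, so that each $\alpha^i$ has weight $1$. The complex orthogonal group $O(n)$ acts on $\mathcal{H}(n)$ by vertex algebra automorphisms, through its standard linear action on the span of the orthonormal vectors $\alpha^1,\dots,\alpha^n$; $\mathcal{H}(n)^{O(n)}$ is the subalgebra of invariants. For a weight-graded vertex algebra $\mathcal{W}=\bigoplus_m\mathcal{W}_m$, define for $a\in\mathcal{W}_m$, $b\in\mathcal{W}$: $a*b=\mathrm{Res}_z\big(a(z)\frac{(z+1)^m}{z}b\big)$ and $a\circ b=\mathrm{Res}_z\big(a(z)\frac{(z+1)^m}{z^2}b\big)$, extended linearly. Let $O(\mathcal{W})$ be the span of all $a\circ b$. The Zhu algebra is $A(\mathcal{W})=\mathcal{W}/O(\mathcal{W})$, which is a unital associative algebra under $*$. *)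

theory Defs
  imports Complex_Main "Jordan_Normal_Form.Matrix"
begin

text \<open>
  Vertex algebras over the complex numbers on a type of vectors. Fields are given by their modes:
  \<open>Y a k\<close> is the coefficient of \<open>z\<close> to the power \<open>-k-1\<close> in \<open>a(z)\<close>, so \<open>Y a k b\<close> is the
  \<open>k\<close>-th product of \<open>a\<close> and \<open>b\<close>. The translation operator is \<open>a \<mapsto> Y a (-2) vac\<close>; the axiom
  \<open>translation\<close> says that its commutator with \<open>a(z)\<close> is the derivative of \<open>a(z)\<close>.
  The axiom \<open>locality\<close> says that the \<open>N\<close>-th power of \<open>z-w\<close> annihilates the commutator of
  \<open>a(z)\<close> and \<open>b(w)\<close>, read off coefficientwise.
\<close>

locale vertex_algebra = vector_space scale
  for scale :: "complex \<Rightarrow> 'v::ab_group_add \<Rightarrow> 'v" +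
  fixes vac :: 'v
    and Y :: "'v \<Rightarrow> int \<Rightarrow> 'v \<Rightarrow> 'v"
  assumes Y_add_left: "Y (a + b) k c = Y a k c + Y b k c"
    and Y_scale_left: "Y (scale s a) k c = scale s (Y a k c)"
    and Y_add_right: "Y a k (b + c) = Y a k b + Y a k c"
    and Y_scale_right: "Y a k (scale s b) = scale s (Y a k b)"
    and truncation: "\<exists>N. \<forall>k\<ge>N. Y a k b = 0"
    and vacuum: "Y vac k b = (if k = -1 then b else 0)"
    and creation: "Y a (-1) vac = a" "k \<ge> 0 \<Longrightarrow> Y a k vac = 0"
    and translation:
      "Y (Y a k b) (-2) vac - Y a k (Y b (-2) vac) = scale (- of_int k) (Y a (k - 1) b)"
    and locality:
      "\<exists>N. \<forall>p q c. (\<Sum>j\<le>N. scale ((-1) ^ j * of_nat (N choose j))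
          (Y a (p + int N - int j) (Y b (q + int j) c)
           - Y b (q + int j) (Y a (p + int N - int j) c))) = 0"
begin

definition vertex_subalgebra :: "'v set \<Rightarrow> bool" where
  "vertex_subalgebra W \<longleftrightarrow> subspace W \<and> vac \<in> W \<and> (\<forall>a\<in>W. \<forall>b\<in>W. \<forall>k. Y a k b \<in> W)"

definition generated_by :: "'v set \<Rightarrow> bool" where
  "generated_by S \<longleftrightarrow> (\<forall>W. vertex_subalgebra W \<and> S \<subseteq> W \<longrightarrow> W = UNIV)"

definition va_automorphism :: "('v \<Rightarrow> 'v) \<Rightarrow> bool" where
  "va_automorphism \<phi> \<longleftrightarrow> Vector_Spaces.linear scale scale \<phi> \<and> bij \<phi> \<and> \<phi> vac = vac
     \<and> (\<forall>a k b. \<phi> (Y a k b) = Y (\<phi> a) k (\<phi> b))"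

definition weight_space :: "'v \<Rightarrow> nat \<Rightarrow> 'v set" where
  "weight_space L m = {v. Y L 1 v = scale (of_nat m) v}"

text \<open>
  In the following, \<open>G m\<close> is the weight \<open>m\<close> subspace of a weight-graded vertex algebra, so that
  every element is uniquely a finite sum of its components in the \<open>G m\<close>.
\<close>

definition component :: "(nat \<Rightarrow> 'v set) \<Rightarrow> 'v \<Rightarrow> nat \<Rightarrow> 'v" where
  "component G a = (THE c. finite {m. c m \<noteq> 0} \<and> (\<forall>m. c m \<in> G m) \<and> a = (\<Sum>m | c m \<noteq> 0. c m))"

text \<open>
  The residue of \<open>a(z) (z+1)^m z^(-s) b\<close>: by the binomial theorem the sum over \<open>j\<close> of
  \<open>m choose j\<close> times the residue of \<open>a(z) z^(j-s) b\<close>, and the latter is \<open>Y a (j-s) b\<close>.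
\<close>

definition zhu_residue :: "nat \<Rightarrow> nat \<Rightarrow> 'v \<Rightarrow> 'v \<Rightarrow> 'v" where
  "zhu_residue s m a b = (\<Sum>j\<le>m. scale (of_nat (m choose j)) (Y a (int j - int s) b))"

definition zhu_star :: "(nat \<Rightarrow> 'v set) \<Rightarrow> 'v \<Rightarrow> 'v \<Rightarrow> 'v" where
  "zhu_star G a b = (\<Sum>m | component G a m \<noteq> 0. zhu_residue 1 m (component G a m) b)"

definition zhu_circ :: "(nat \<Rightarrow> 'v set) \<Rightarrow> 'v \<Rightarrow> 'v \<Rightarrow> 'v" where
  "zhu_circ G a b = (\<Sum>m | component G a m \<noteq> 0. zhu_residue 2 m (component G a m) b)"

definition zhu_O :: "'v set \<Rightarrow> (nat \<Rightarrow> 'v set) \<Rightarrow> 'v set" where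
  "zhu_O W G = span {zhu_circ G a b | a b. a \<in> W \<and> b \<in> W}"

definition zhu_class :: "'v set \<Rightarrow> (nat \<Rightarrow> 'v set) \<Rightarrow> 'v \<Rightarrow> 'v set" where
  "zhu_class W G a = (\<lambda>x. a + x) ` zhu_O W G"

text \<open>
  The quotient of \<open>W\<close> by \<open>zhu_O W G\<close>. As for quotient rings in HOL-Algebra, a product of cosets is the
  union of the cosets of all products of representatives; it is a single coset exactly because
  the operation is well defined.
\<close>

definition zhu_algebra :: "'v set \<Rightarrow> (nat \<Rightarrow> 'v set) \<Rightarrow> (complex, 'v set) module" where
  "zhu_algebra W G =
    \<lparr>carrier = zhu_class W G ` W,
     mult = (\<lambda>A B. \<Union>a\<in>A. \<Union>b\<in>B. zhu_class W G (zhu_star G a b)),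
     one = zhu_class W G vac,
     zero = zhu_class W G 0,
     add = (\<lambda>A B. \<Union>a\<in>A. \<Union>b\<in>B. zhu_class W G (a + b)),
     smult = (\<lambda>s A. \<Union>a\<in>A. zhu_class W G (scale s a))\<rparr>"

end

definition complex_ring :: "complex ring" where
  "complex_ring = \<lparr>carrier = UNIV, mult = (*), one = 1, zero = 0, add = (+)\<rparr>"

definition complex_orthogonal_group :: "nat \<Rightarrow> complex mat set" where
  "complex_orthogonal_group n = {g \<in> carrier_mat n n. transpose_mat g * g = 1\<^sub>m n}"

text \<open>
  The rank \<open>n\<close> Heisenberg vertex algebra with its generators \<open>\<alpha> 0, \<dots>, \<alpha> (n-1)\<close>: a nonzero vertex
  algebra generated by fields with the Heisenberg OPE, whose singular part is encoded by the
  nonnegative products. These properties determine it up to a unique isomorphism preserving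
  the generators.
\<close>

locale heisenberg_vertex_algebra = vertex_algebra scale vac Y
  for scale :: "complex \<Rightarrow> 'v::ab_group_add \<Rightarrow> 'v" and vac Y +
  fixes n :: nat and \<alpha> :: "nat \<Rightarrow> 'v"
  assumes vac_nonzero: "vac \<noteq> 0"
    and heisenberg_ope: "i < n \<Longrightarrow> j < n \<Longrightarrow> k \<ge> 0 \<Longrightarrow>
      Y (\<alpha> i) k (\<alpha> j) = (if i = j \<and> k = 1 then vac else 0)"
    and generated: "generated_by (\<alpha> ` {..<n})"
begin

definition virasoro :: 'v where
  "virasoro = scale (1/2) (\<Sum>i<n. Y (\<alpha> i) (-1) (\<alpha> i))"

text \<open>
  The action of a matrix in the orthogonal group is the unique automorphism that is given by the
  matrix on the span of the generators.
\<close>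

definition orthogonal_action :: "complex mat \<Rightarrow> 'v \<Rightarrow> 'v" where
  "orthogonal_action g =
     (THE \<phi>. va_automorphism \<phi> \<and> (\<forall>j<n. \<phi> (\<alpha> j) = (\<Sum>i<n. scale (g $$ (i, j)) (\<alpha> i))))"

definition orthogonal_invariants :: "'v set" where
  "orthogonal_invariants = {v. \<forall>g\<in>complex_orthogonal_group n. orthogonal_action g v = v}"

definition invariants_grading :: "nat \<Rightarrow> 'v set" where
  "invariants_grading m = orthogonal_invariants \<inter> weight_space virasoro m"

definition zhu_algebra_of_invariants :: "(complex, 'v set) module" where
  "zhu_algebra_of_invariants = zhu_algebra orthogonal_invariants invariants_grading"

end

end

(*
  Commutators of quadratic elements stay quadratic, and the zero mode of their Zhu bracket is the
  commutator of their zero modes. It kills the one-particle vectors alpha^i_(-s) 1, on which the zero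
  modes of O(n)-invariant quadratics are scalars. Modulo the image of L(-1) + L(0), which lies in
  O(W), the invariant quadratics are spanned by elements whose eigenvalues on these vectors are
  polynomials in s of distinct degrees, so a quadratic that kills them is zero in the Zhu algebra.
  Hence the classes of the quadratic invariants commute with each other.

  They generate the Zhu algebra by the first fundamental theorem for O(n). In the Fock space,
  so(n)-invariance of f turns the so(n) Casimir operator into the identity
  sum Q(-k,-l) Q(k,l) f / (kl) = T f, where Q(k,l) = sum_i alpha^i_k alpha^i_l and T is built from the
  gl(n)-action on the upper indices. For a Hermitian form for which alpha_k and alpha_(-k) are adjoint,
  T is positive on vectors orthogonal to the vacuum that contain every index an even number of times,
  a parity that the reflections in O(n) enforce. So by finite dimensionality every invariant is in the
  image of T up to a multiple of the vacuum, and one inducts on the number of creation operators.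
*)
theory Submission
  imports Defs "HOL-Library.Groups_Big_Fun" "HOL-Library.Multiset"
    "HOL-Computational_Algebra.Formal_Power_Series" "Jordan_Normal_Form.Determinant"
begin

section \<open>Binomial sums\<close>

text \<open>The Casimir argument needs invariance under the Lie algebra so(n), whereas the
  invariants are defined by group elements. Instead of differentiating one-parameter subgroups, one
  complex rotation per coordinate plane is used: its eigenvalues are the powers 2^r, which determine
  r, so a vector fixed by it is killed by the infinitesimal rotation, whose eigenvalue is i times r.
  The form has to be Hermitian, not bilinear, because the argument rests on positivity. The parity
  supplied by the reflections excludes a genuine obstruction: an n by n determinant of creation
  operators applied to the vacuum is invariant under SO(n) and is killed by T. Zero modes of general
  elements of O(W) are only expected to vanish on lowest weight vectors, and most one-particle
  vectors are not of this kind. So the vanishing on one-particle vectors is carried along explicitly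
  for the relations that reduce the quadratics. Since locality is the axiom, the Borcherds identity
  behind all residue manipulations has to be proved as well.\<close>

definition sg :: "int \<Rightarrow> complex" where
  "sg k = (if even k then 1 else -1)"

lemma sg_simps [simp]: "sg 0 = 1" "sg (-1) = -1" "sg 1 = -1" "sg (- k) = sg k"
  by (auto simp: sg_def)

lemma sg_add: "sg (k + l) = sg k * sg l"
  by (auto simp: sg_def)

lemma sg_diff: "sg (k - l) = sg k * sg l"
  by (auto simp: sg_def)

lemma sg_of_nat: "sg (int j) = (-1) ^ j"
  by (auto simp: sg_def)

lemma sg_square [simp]: "sg k * sg k = 1" "sg k * (sg k * x) = x"
  by (auto simp: sg_def)

text \<open>Binomial coefficient with integer lower index, zero below 0, so that Pascal's rule and
  index shifts hold without case distinctions.\<close>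

definition ch :: "complex \<Rightarrow> int \<Rightarrow> complex" where
  "ch a k = (if k < 0 then 0 else a gchoose nat k)"

lemma ch_pascal: "ch (a + 1) k = ch a k + ch a (k - 1)"
proof -
  consider "k < 0" | "k = 0" | j where "k = int (Suc j)"
    by (metis int_cases not0_implies_Suc of_nat_0 negative_zless_0 linorder_neqE)
  then show ?thesis
    by cases (auto simp: ch_def gbinomial_Suc_Suc nat_add_distrib)
qed

lemma ch_of_nat [simp]: "ch a (int j) = a gchoose j"
  by (simp add: ch_def)

lemma ch_neg: "k < 0 \<Longrightarrow> ch a k = 0"
  by (simp add: ch_def)

lemma sum_Suc_choose:
  fixes t :: "nat \<Rightarrow> 'a::comm_semiring_1"
  shows "(\<Sum>l\<le>Suc p. of_nat (Suc p choose l) * t l)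
    = (\<Sum>l\<le>p. of_nat (p choose l) * t l) + (\<Sum>l\<le>p. of_nat (p choose l) * t (Suc l))"
proof -
  have "(\<Sum>l\<le>Suc p. of_nat (Suc p choose l) * t l) = t 0 + (\<Sum>l\<le>p. of_nat (Suc p choose Suc l) * t (Suc l))"
    by (subst sum.atMost_Suc_shift) simp
  also have "\<dots> = t 0 + (\<Sum>l\<le>p. of_nat (p choose Suc l) * t (Suc l)) + (\<Sum>l\<le>p. of_nat (p choose l) * t (Suc l))"
    by (simp add: sum.distrib ring_distribs ac_simps)
  also have "t 0 + (\<Sum>l\<le>p. of_nat (p choose Suc l) * t (Suc l)) = (\<Sum>l\<le>Suc p. of_nat (p choose l) * t l)"
    by (subst sum.atMost_Suc_shift) simp
  finally show ?thesis by (simp add: binomial_eq_0)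
qed

text \<open>Coefficient of x^k in (1+x)^a ((1+x) - x)^p = (1+x)^a, with the p-th power expanded; the
  induction uses Pascal's rule for \<open>ch\<close> in place of power series.\<close>

lemma sum_choose_ch:
  "(\<Sum>l\<le>p. (-1) ^ l * of_nat (p choose l) * ch (a + of_nat p - of_nat l) (k - int l)) = ch a k"
proof (induction p arbitrary: a k)
  case 0
  then show ?case by simp
next
  case (Suc p)
  let ?t = "\<lambda>l. (-1) ^ l * ch (a + of_nat (Suc p) - of_nat l) (k - int l)"
  have "(\<Sum>l\<le>Suc p. (-1) ^ l * of_nat (Suc p choose l) * ch (a + of_nat (Suc p) - of_nat l) (k - int l))
      = (\<Sum>l\<le>Suc p. of_nat (Suc p choose l) * ?t l)"
    by (intro sum.cong) auto
  also have "\<dots> = (\<Sum>l\<le>p. of_nat (p choose l) * ?t l) + (\<Sum>l\<le>p. of_nat (p choose l) * ?t (Suc l))"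
    by (rule sum_Suc_choose)
  also have "(\<Sum>l\<le>p. of_nat (p choose l) * ?t l)
      = (\<Sum>l\<le>p. (-1) ^ l * of_nat (p choose l) * ch ((a + 1) + of_nat p - of_nat l) (k - int l))"
    by (simp add: algebra_simps)
  also have "\<dots> = ch (a + 1) k" by (rule Suc.IH)
  also have "(\<Sum>l\<le>p. of_nat (p choose l) * ?t (Suc l))
      = - (\<Sum>l\<le>p. (-1) ^ l * of_nat (p choose l) * ch (a + of_nat p - of_nat l) ((k - 1) - int l))"
    by (simp add: sum_negf[symmetric] algebra_simps)
  also have "\<dots> = - ch a (k - 1)" by (subst Suc.IH) simp
  finally show ?case by (simp add: ch_pascal)
qed

text \<open>For fixed t, (j choose t) is a polynomial in j of degree t < N, so its N-th finite
  difference vanishes.\<close>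

lemma alternating_sum_choose_choose:
  assumes "t < N"
  shows "(\<Sum>j\<le>N. (-1) ^ j * of_nat (N choose j) * of_nat (j choose t)) = (0::complex)"
proof -
  have "(\<Sum>j\<le>N. (-1) ^ j * of_nat (N choose j) * of_nat (j choose t))
      = (\<Sum>j\<in>{t..N}. (-1) ^ j * of_nat (N choose j) * (of_nat (j choose t) :: complex))"
    by (rule sum.mono_neutral_right) (auto simp: binomial_eq_0)
  also have "\<dots> = (\<Sum>j\<in>{t..N}. (-1) ^ j * (of_nat (N choose t) * of_nat ((N - t) choose (j - t))))"
    by (rule sum.cong) (auto simp flip: of_nat_mult simp: mult.assoc choose_mult)
  also have "\<dots> = (\<Sum>i\<le>N - t. (-1) ^ (i + t) * (of_nat (N choose t) * of_nat ((N - t) choose i)))"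
    by (rule sum.reindex_bij_witness[where i="\<lambda>i. i + t" and j="\<lambda>j. j - t"]) (use assms in auto)
  also have "\<dots> = (-1) ^ t * of_nat (N choose t) * (\<Sum>i\<le>N - t. (-1) ^ i * of_nat ((N - t) choose i))"
    by (simp add: sum_distrib_left power_add mult_ac)
  also have "\<dots> = 0"
    using assms by (subst choose_alternating_sum) auto
  finally show ?thesis .
qed

text \<open>The same finite difference for the polynomial (j-1 choose t): the terms with 1 <= j <= t
  vanish, and the term j = 0, where (-1 choose t) = (-1)^t, is moved to the right side. Truncated
  subtraction spoils that term when t > 0, hence the restricted range and the induction on
  \<open>N\<close>.\<close>

lemma alternating_sum_choose_pred_choose:
  assumes "t < N"
  shows "(\<Sum>j\<in>{Suc t..N}. (-1) ^ j * of_nat (N choose j) * of_nat ((j - 1) choose t)) = (-1::complex) ^ Suc t"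
  using assms
proof (induction N)
  case 0
  then show ?case by simp
next
  case (Suc N)
  show ?case
  proof (cases "t = N")
    case True
    then show ?thesis by simp
  next
    case False
    then have t: "t < N" using Suc.prems by simp
    have "(\<Sum>j\<in>{Suc t..Suc N}. (-1) ^ j * of_nat (Suc N choose j) * of_nat ((j - 1) choose t))
        = (\<Sum>j\<in>{t..N}. (-1) ^ Suc j * of_nat (Suc N choose Suc j) * (of_nat (j choose t) :: complex))"
      by (subst sum.shift_bounds_cl_Suc_ivl) (simp del: binomial_Suc_Suc power_Suc)
    also have "\<dots> = (\<Sum>j\<in>{t..N}. (-1) ^ Suc j * of_nat (N choose Suc j) * of_nat (j choose t))
        - (\<Sum>j\<in>{t..N}. (-1) ^ j * of_nat (N choose j) * of_nat (j choose t))"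
      unfolding sum_subtractf[symmetric] by (intro sum.cong refl) (simp add: algebra_simps)
    also have "(\<Sum>j\<in>{t..N}. (-1) ^ j * of_nat (N choose j) * of_nat (j choose t))
        = (\<Sum>j\<le>N. (-1) ^ j * of_nat (N choose j) * (of_nat (j choose t) :: complex))"
      by (rule sum.mono_neutral_left) (auto simp: binomial_eq_0)
    also have "\<dots> = 0" by (rule alternating_sum_choose_choose[OF t])
    also have "(\<Sum>j\<in>{t..N}. (-1) ^ Suc j * of_nat (N choose Suc j) * of_nat (j choose t))
        = (\<Sum>j\<in>{Suc t..Suc N}. (-1) ^ j * of_nat (N choose j) * (of_nat ((j - 1) choose t) :: complex))"
      by (subst sum.shift_bounds_cl_Suc_ivl) (simp del: power_Suc)
    also have "\<dots> = (\<Sum>j\<in>{Suc t..N}. (-1) ^ j * of_nat (N choose j) * of_nat ((j - 1) choose t))"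
      by (rule sum.mono_neutral_right) (auto simp: not_less_eq_eq le_Suc_eq)
    also have "\<dots> = (-1) ^ Suc t" using Suc.IH t by simp
    finally show ?thesis by simp
  qed
qed

text \<open>These coefficients arise when locality is applied to the vacuum in skew symmetry. For t
  < 0 only j = 0 contributes, since for later j the lower index exceeds the upper one; for t >= 0
  the lower index is replaced by its complement t, and the previous alternating sum applies.\<close>

lemma sum_choose_ch_pred:
  assumes "t < int N"
  shows "(\<Sum>j\<le>N. (-1) ^ j * of_nat (N choose j) * ch (of_nat j - 1) (int j - 1 - t)) = sg (t + 1)"
proof (cases "t < 0")
  case True
  have "(\<Sum>j\<le>N. (-1) ^ j * of_nat (N choose j) * ch (of_nat j - 1) (int j - 1 - t))
      = (\<Sum>j\<in>{0}. (-1) ^ j * of_nat (N choose j) * ch (of_nat j - 1) (int j - 1 - t))"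
  proof (rule sum.mono_neutral_right)
    show "\<forall>j\<in>{..N} - {0}. (-1) ^ j * of_nat (N choose j) * ch (of_nat j - 1) (int j - 1 - t) = 0"
    proof
      fix j assume "j \<in> {..N} - {0}"
      then obtain i where j: "j = Suc i" by (cases j) auto
      have "nat (int i - t) > i" using True by simp
      then have "ch (of_nat i) (int i - t) = 0"
        using True by (simp add: ch_def flip: binomial_gbinomial)
      then show "(-1) ^ j * of_nat (N choose j) * ch (of_nat j - 1) (int j - 1 - t) = 0"
        by (simp add: j)
    qed
  qed auto
  also have "\<dots> = sg (t + 1)"
  proof -
    have "sg (t + 1) = (-1) ^ nat (- 1 - t)"
      using True sg_of_nat[of "nat (-1 - t)"] by (simp add: sg_diff sg_add)
    moreover have "(- 1 :: complex) gchoose k = (-1) ^ k" for k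
      using gbinomial_minus[of "1::complex" k] gbinomial_of_nat_symmetric[of k k, where 'a=complex] 
      by (simp flip: binomial_gbinomial)
    ultimately show ?thesis
      using True by (simp add: ch_def)
  qed
  finally show ?thesis .
next
  case False
  then obtain u where t: "t = int u" by (metis nonneg_int_cases not_less)
  have "(\<Sum>j\<le>N. (-1) ^ j * of_nat (N choose j) * ch (of_nat j - 1) (int j - 1 - t))
      = (\<Sum>j\<in>{Suc u..N}. (-1) ^ j * of_nat (N choose j) * ch (of_nat j - 1) (int j - 1 - t))"
    by (rule sum.mono_neutral_right) (auto simp: t ch_def)
  also have "\<dots> = (\<Sum>j\<in>{Suc u..N}. (-1) ^ j * of_nat (N choose j) * of_nat ((j - 1) choose u))"
  proof (rule sum.cong)
    fix j assume j: "j \<in> {Suc u..N}"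
    then obtain i where i: "j = Suc i" "u \<le> i" by (cases j) auto
    then have "ch (of_nat j - 1) (int j - 1 - t) = of_nat (i choose (i - u))"
      by (simp add: t ch_def nat_diff_distrib' flip: binomial_gbinomial)
    then show "(-1) ^ j * of_nat (N choose j) * ch (of_nat j - 1) (int j - 1 - t)
        = (-1) ^ j * of_nat (N choose j) * of_nat ((j - 1) choose u)"
      using i by (simp add: binomial_symmetric[of u i])
  qed auto
  also have "\<dots> = sg (t + 1)"
    using assms t alternating_sum_choose_pred_choose[of u N] by (simp add: sg_add sg_of_nat)
  finally show ?thesis .
qed

lemma gchoose_minus_one: "(- 1 :: complex) gchoose k = (-1) ^ k"
  using gbinomial_minus[of "1::complex" k] by (simp flip: binomial_gbinomial)

lemma gchoose_minus_two: "(- 2 :: complex) gchoose k = (-1) ^ k * of_nat (Suc k)"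
proof -
  have "of_nat (Suc k) gchoose k = (of_nat (Suc k) :: complex)"
    unfolding binomial_gbinomial[symmetric] by simp
  then show ?thesis
    using gbinomial_minus[of "2::complex" k] by (simp add: add.commute)
qed

lemma sum_rotate:
  "(\<Sum>p\<in>A. \<Sum>u\<in>B. \<Sum>k\<in>C. f p u k) = (\<Sum>k\<in>C. \<Sum>p\<in>A. \<Sum>u\<in>B. f p u k)"
proof -
  have "(\<Sum>p\<in>A. \<Sum>u\<in>B. \<Sum>k\<in>C. f p u k) = (\<Sum>p\<in>A. \<Sum>k\<in>C. \<Sum>u\<in>B. f p u k)"
    by (rule sum.cong[OF refl]) (rule sum.swap)
  also have "\<dots> = (\<Sum>k\<in>C. \<Sum>p\<in>A. \<Sum>u\<in>B. f p u k)"
    by (rule sum.swap)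
  finally show ?thesis .
qed

section \<open>The Borcherds identity\<close>

context vertex_algebra
begin

lemma Y_zero_left [simp]: "Y 0 k c = 0"
  using Y_scale_left[of 0 0] by simp

lemma Y_zero_right [simp]: "Y a k 0 = 0"
  using Y_scale_right[of a k 0 0] by simp

lemma Y_minus_left: "Y (- a) k c = - Y a k c"
  using Y_scale_left[of "-1" a] by simp

lemma Y_minus_right: "Y a k (- c) = - Y a k c"
  using Y_scale_right[of a k "-1" c] by simp

lemma Y_diff_left: "Y (a - b) k c = Y a k c - Y b k c"
  using Y_add_left[of a "- b"] by (simp add: Y_minus_left)

lemma Y_diff_right: "Y a k (b - c) = Y a k b - Y a k c"
  using Y_add_right[of a k b "- c"] by (simp add: Y_minus_right)

lemma Y_sum_left: "Y (sum f A) k c = (\<Sum>x\<in>A. Y (f x) k c)"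
  by (induction A rule: infinite_finite_induct) (auto simp: Y_add_left)

lemma Y_sum_right: "Y a k (sum f A) = (\<Sum>x\<in>A. Y a k (f x))"
  by (induction A rule: infinite_finite_induct) (auto simp: Y_add_right)

lemmas Y_linear = Y_add_left Y_add_right Y_diff_left Y_diff_right Y_scale_left Y_scale_right
  Y_sum_left Y_sum_right Y_minus_left Y_minus_right

lemma scale_of_nat_Suc_cancel: "scale (of_nat (Suc i)) x = scale (of_nat (Suc i)) y \<Longrightarrow> x = y"
  by (metis scale_left_imp_eq of_nat_eq_0_iff Suc_not_Zero)

text \<open>The weights N - s and s add up to N: the step common to both inductions that move a
  divided power of T past a mode.\<close>

lemma sum_scale_complement:
  "(\<Sum>s\<le>N. scale (g s * of_nat (N - s)) (x s)) + (\<Sum>s\<le>N. scale (of_nat s * g s) (x s))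
    = (\<Sum>s\<le>N. scale (of_nat N) (scale (g s) (x s)))"
proof -
  have "g s * of_nat (N - s) + of_nat s * g s = of_nat N * g s" if "s \<le> N" for s
    using that by (simp add: of_nat_diff algebra_simps)
  then show ?thesis
    unfolding sum.distrib[symmetric] by (intro sum.cong refl) (simp flip: scale_left_distrib)
qed

text \<open>These are the divided powers T^i / i! of the translation operator T, the coefficients of
  e^(zT); \<open>D (Suc 0)\<close> is T itself. Defining them by modes applied to the vacuum avoids
  division.\<close>

definition D :: "nat \<Rightarrow> 'v \<Rightarrow> 'v" where
  "D i v = Y v (- 1 - int i) vac"

lemma D_0 [simp]: "D 0 v = v"
  by (simp add: D_def creation)

lemma D_zero [simp]: "D i 0 = 0"
  by (simp add: D_def)

lemma D_linear: "D i (a + b) = D i a + D i b" "D i (scale s a) = scale s (D i a)"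
   "D i (a - b) = D i a - D i b" "D i (sum f A) = (\<Sum>x\<in>A. D i (f x))"
  by (simp_all add: D_def Y_linear)

lemma T_Y: "D (Suc 0) (Y a k b) = Y a k (D (Suc 0) b) - scale (of_int k) (Y a (k - 1) b)"
  using translation[of a k b] by (simp add: D_def algebra_simps)

lemma T_vac: "D (Suc 0) vac = 0"
  by (simp add: D_def vacuum)

lemma T_D: "D (Suc 0) (D i v) = scale (of_nat (Suc i)) (D (Suc i) v)"
  using T_Y[of v "- 1 - int i" vac] T_vac by (simp add: D_def[of i] D_def[of "Suc i"] algebra_simps)

text \<open>Together with \<open>T_D\<close> this says that T commutes with its divided powers; the
  induction cancels a factor i + 1, which is invertible in the complex numbers.\<close>

lemma D_T: "D i (D (Suc 0) v) = scale (of_nat (Suc i)) (D (Suc i) v)"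
proof (induction i)
  case 0
  then show ?case by simp
next
  case (Suc i)
  have "scale (of_nat (Suc i)) (D (Suc i) (D (Suc 0) v)) = D (Suc 0) (D i (D (Suc 0) v))"
    by (simp only: T_D)
  also have "\<dots> = scale (of_nat (Suc i)) (D (Suc 0) (D (Suc i) v))"
    by (simp only: Suc D_linear)
  also have "\<dots> = scale (of_nat (Suc i)) (scale (of_nat (Suc (Suc i))) (D (Suc (Suc i)) v))"
    by (simp only: T_D)
  finally show ?case
    by (rule scale_of_nat_Suc_cancel)
qed

text \<open>Iterates b_m T = T b_m + m b_(m-1); in generating functions, b(z) e^(wT) = e^(wT)
  b(z-w). The induction proves i + 1 times the claim and cancels the factor.\<close>

lemma Y_D: "Y b m (D i v) = (\<Sum>s\<le>i. scale (of_int m gchoose s) (D (i - s) (Y b (m - int s) v)))"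
proof (induction i arbitrary: m)
  case 0
  then show ?case by simp
next
  case (Suc i)
  let ?g = "\<lambda>s. (of_int m :: complex) gchoose s"
  let ?x = "\<lambda>s. D (Suc i - s) (Y b (m - int s) v)"
  have "scale (of_nat (Suc i)) (Y b m (D (Suc i) v)) = Y b m (D (Suc 0) (D i v))"
    by (simp only: T_D Y_linear)
  also have "\<dots> = D (Suc 0) (Y b m (D i v)) + scale (of_int m) (Y b (m - 1) (D i v))"
    by (simp add: T_Y)
  also have "D (Suc 0) (Y b m (D i v)) = (\<Sum>s\<le>i. scale (?g s * of_nat (Suc i - s)) (?x s))"
    by (subst Suc.IH) (simp add: D_linear T_D Suc_diff_le)
  also have "\<dots> = (\<Sum>s\<le>Suc i. scale (?g s * of_nat (Suc i - s)) (?x s))"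
    by simp
  also have "scale (of_int m) (Y b (m - 1) (D i v))
      = (\<Sum>s\<le>i. scale (of_nat (Suc s) * ?g (Suc s)) (?x (Suc s)))"
  proof -
    have e: "of_nat (Suc s) * ?g (Suc s) = of_int m * (of_int (m - 1) gchoose s)" for s
      by (simp only: gbinomial_absorption of_int_diff of_int_1)
    have m: "m - 1 - int s = m - int (Suc s)" for s by simp
    show ?thesis
      by (simp only: Suc.IH scale_sum_right scale_scale e m diff_Suc_Suc)
  qed
  also have "\<dots> = (\<Sum>s\<le>Suc i. scale (of_nat s * ?g s) (?x s))"
    by (subst sum.atMost_Suc_shift) simp
  also have "(\<Sum>s\<le>Suc i. scale (?g s * of_nat (Suc i - s)) (?x s)) + \<dots>
      = (\<Sum>s\<le>Suc i. scale (of_nat (Suc i)) (scale (?g s) (?x s)))"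
    by (rule sum_scale_complement)
  also have "\<dots> = scale (of_nat (Suc i)) (\<Sum>s\<le>Suc i. scale (?g s) (?x s))"
    by (simp only: scale_sum_right)
  finally show ?case
    by (rule scale_of_nat_Suc_cancel)
qed

text \<open>The opposite exchange, e^(wT) b(z) = b(z+w) e^(wT), whence the signs.\<close>

lemma D_Y: "D i (Y b m v) = (\<Sum>s\<le>i. scale ((-1) ^ s * (of_int m gchoose s)) (Y b (m - int s) (D (i - s) v)))"
proof (induction i arbitrary: m v)
  case 0
  then show ?case by simp
next
  case (Suc i)
  let ?g = "\<lambda>s. (-1) ^ s * ((of_int m :: complex) gchoose s)"
  let ?x = "\<lambda>s. Y b (m - int s) (D (Suc i - s) v)"
  have "scale (of_nat (Suc i)) (D (Suc i) (Y b m v)) = D i (D (Suc 0) (Y b m v))"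
    by (simp only: D_T)
  also have "\<dots> = D i (Y b m (D (Suc 0) v)) - scale (of_int m) (D i (Y b (m - 1) v))"
    by (simp only: T_Y D_linear)
  also have "D i (Y b m (D (Suc 0) v)) = (\<Sum>s\<le>i. scale (?g s * of_nat (Suc i - s)) (?x s))"
    by (subst Suc.IH) (simp add: D_T[simplified] D_T Y_linear Suc_diff_le)
  also have "\<dots> = (\<Sum>s\<le>Suc i. scale (?g s * of_nat (Suc i - s)) (?x s))"
    by simp
  also have "scale (of_int m) (D i (Y b (m - 1) v))
      = (\<Sum>s\<le>i. - scale (of_nat (Suc s) * ?g (Suc s)) (?x (Suc s)))"
  proof -
    have e: "of_int m * ((-1) ^ s * (of_int (m - 1) gchoose s)) = - (of_nat (Suc s) * ?g (Suc s))" for s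
    proof -
      have "of_nat (Suc s) * ?g (Suc s) = - ((-1) ^ s * (of_nat (Suc s) * (of_int m gchoose Suc s)))"
        by (simp only: power_Suc mult_minus_left mult_1_left mult_minus_right mult.left_commute)
      also have "\<dots> = - ((-1) ^ s * (of_int m * (of_int (m - 1) gchoose s)))"
        by (simp only: gbinomial_absorption of_int_diff of_int_1)
      finally show ?thesis by (simp only: mult.left_commute minus_minus)
    qed
    have m: "m - 1 - int s = m - int (Suc s)" for s by simp
    show ?thesis
      by (simp only: Suc.IH scale_sum_right scale_scale e m diff_Suc_Suc scale_minus_left)
  qed
  also have "\<dots> = - (\<Sum>s\<le>Suc i. scale (of_nat s * ?g s) (?x s))"
    by (subst sum.atMost_Suc_shift) (simp add: sum_negf)
  also have "(\<Sum>s\<le>Suc i. scale (?g s * of_nat (Suc i - s)) (?x s)) - \<dots>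
      = (\<Sum>s\<le>Suc i. scale (of_nat (Suc i)) (scale (?g s) (?x s)))"
    unfolding diff_minus_eq_add by (rule sum_scale_complement)
  also have "\<dots> = scale (of_nat (Suc i)) (\<Sum>s\<le>Suc i. scale (?g s) (?x s))"
    by (simp only: scale_sum_right)
  finally show ?case
    by (rule scale_of_nat_Suc_cancel)
qed

lemma scale_sum_Suc_choose:
  "(\<Sum>l\<le>Suc p. scale (of_nat (Suc p choose l)) (t l))
    = (\<Sum>l\<le>p. scale (of_nat (p choose l)) (t l)) + (\<Sum>l\<le>p. scale (of_nat (p choose l)) (t (Suc l)))"
proof -
  have "(\<Sum>l\<le>Suc p. scale (of_nat (Suc p choose l)) (t l))
      = t 0 + (\<Sum>l\<le>p. scale (of_nat (Suc p choose Suc l)) (t (Suc l)))"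
    by (subst sum.atMost_Suc_shift) simp
  also have "\<dots> = t 0 + (\<Sum>l\<le>p. scale (of_nat (p choose Suc l)) (t (Suc l)))
      + (\<Sum>l\<le>p. scale (of_nat (p choose l)) (t (Suc l)))"
    by (simp add: sum.distrib scale_left_distrib ac_simps)
  also have "t 0 + (\<Sum>l\<le>p. scale (of_nat (p choose Suc l)) (t (Suc l)))
      = (\<Sum>l\<le>Suc p. scale (of_nat (p choose l)) (t l))"
    by (subst sum.atMost_Suc_shift) simp
  finally show ?thesis by (simp add: binomial_eq_0)
qed

section \<open>Locality, skew symmetry and weak associativity\<close>

lemma locality_mono:
  assumes "\<And>p q c. (\<Sum>j\<le>N. scale ((-1) ^ j * of_nat (N choose j))
          (Y a (p + int N - int j) (Y b (q + int j) c)
           - Y b (q + int j) (Y a (p + int N - int j) c))) = 0"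
  shows "(\<Sum>j\<le>Suc N. scale ((-1) ^ j * of_nat (Suc N choose j))
          (Y a (p + int (Suc N) - int j) (Y b (q + int j) c)
           - Y b (q + int j) (Y a (p + int (Suc N) - int j) c))) = 0"
proof -
  let ?t = "\<lambda>p j. scale ((-1) ^ j) (Y a (p + int N - int j) (Y b (q + int j) c)
           - Y b (q + int j) (Y a (p + int N - int j) c))"
  let ?u = "\<lambda>j. scale ((-1) ^ j) (Y a (p + int N - int j) (Y b (q + 1 + int j) c)
           - Y b (q + 1 + int j) (Y a (p + int N - int j) c))"
  have "(\<Sum>j\<le>Suc N. scale ((-1) ^ j * of_nat (Suc N choose j))
          (Y a (p + int (Suc N) - int j) (Y b (q + int j) c)
           - Y b (q + int j) (Y a (p + int (Suc N) - int j) c)))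
      = (\<Sum>j\<le>Suc N. scale (of_nat (Suc N choose j)) (?t (p + 1) j))"
    by (rule sum.cong) (auto simp: algebra_simps)
  also have "\<dots> = (\<Sum>j\<le>N. scale (of_nat (N choose j)) (?t (p + 1) j))
      + (\<Sum>j\<le>N. scale (of_nat (N choose j)) (?t (p + 1) (Suc j)))"
    by (rule scale_sum_Suc_choose)
  also have "(\<Sum>j\<le>N. scale (of_nat (N choose j)) (?t (p + 1) j))
    = (\<Sum>j\<le>N. scale ((-1) ^ j * of_nat (N choose j)) (Y a (p + 1 + int N - int j) (Y b (q + int j) c)
           - Y b (q + int j) (Y a (p + 1 + int N - int j) c)))"
    by (simp add: mult.commute)
  also have "\<dots> = 0"
    by (rule assms)
  also have "(\<Sum>j\<le>N. scale (of_nat (N choose j)) (?t (p + 1) (Suc j)))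
      = - (\<Sum>j\<le>N. scale ((-1) ^ j * of_nat (N choose j)) (Y a (p + int N - int j) (Y b (q + 1 + int j) c)
           - Y b (q + 1 + int j) (Y a (p + int N - int j) c)))"
    unfolding sum_negf[symmetric] by (rule sum.cong) (auto simp: algebra_simps)
  also have "\<dots> = 0"
    using assms[of p "q + 1" c] by simp
  finally show ?thesis by simp
qed

lemma locality_ge:
  obtains N0 where "\<And>N p q c. N \<ge> N0 \<Longrightarrow> (\<Sum>j\<le>N. scale ((-1) ^ j * of_nat (N choose j))
          (Y a (p + int N - int j) (Y b (q + int j) c)
           - Y b (q + int j) (Y a (p + int N - int j) c))) = 0"
proof -
  obtain N0 where N0: "\<And>p q c. (\<Sum>j\<le>N0. scale ((-1) ^ j * of_nat (N0 choose j))
          (Y a (p + int N0 - int j) (Y b (q + int j) c)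
           - Y b (q + int j) (Y a (p + int N0 - int j) c))) = 0"
    using locality by meson
  show thesis
  proof (rule that)
    fix N p q c assume "N \<ge> N0"
    then show "(\<Sum>j\<le>N. scale ((-1) ^ j * of_nat (N choose j))
          (Y a (p + int N - int j) (Y b (q + int j) c)
           - Y b (q + int j) (Y a (p + int N - int j) c))) = 0"
    proof (induction N arbitrary: p q c rule: dec_induct)
      case base
      show ?case by (rule N0)
    next
      case (step N)
      show ?case by (rule locality_mono) (rule step.IH)
    qed
  qed
qed

lemma truncation_ge:
  obtains N where "\<And>k. k \<ge> int N \<Longrightarrow> Y a k b = 0"
proof -
  obtain N where N: "\<forall>k\<ge>N. Y a k b = 0" using truncation by blast
  show thesis
  proof (rule that[of "nat N"])
    fix k assume "k \<ge> int (nat N)"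
    then have "k \<ge> N" by linarith
    then show "Y a k b = 0" using N by simp
  qed
qed

lemma Y_vac_D: "k < 0 \<Longrightarrow> Y a k vac = D (nat (- 1 - k)) a"
  by (simp add: D_def)

text \<open>This is a(z)b = e^(zT) b(-z)a. Locality is applied to the vacuum with q = -1: in one
  half only j = 0 survives by the creation axiom; in the other a_(k-j) vac is a divided power of T
  on a, which is moved past b. Collecting coefficients leaves the sum in
  \<open>sum_choose_ch_pred\<close>.\<close>

lemma skew_symmetry:
  assumes "\<And>u. u \<ge> K \<Longrightarrow> Y b (k + int u) a = 0"
  shows "Y a k b = (\<Sum>u<K. scale (sg (k + int u + 1)) (D u (Y b (k + int u) a)))"
proof -
  obtain N1 where N1: "\<And>N p q c. N \<ge> N1 \<Longrightarrow> (\<Sum>j\<le>N. scale ((-1) ^ j * of_nat (N choose j))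
          (Y a (p + int N - int j) (Y b (q + int j) c)
           - Y b (q + int j) (Y a (p + int N - int j) c))) = 0"
    using locality_ge by blast
  \<comment> \<open>Besides reaching locality, \<open>N\<close> exceeds every k + u for which
    b_(k+u) a may be nonzero, as the coefficient identity holds only below \<open>N\<close>;
    \<open>M\<close> bounds the powers of T that occur.\<close>
  define N where "N = max N1 (nat (k + 1 + int K))"
  define M where "M = Suc N + nat (- k)"
  have N: "k + int K < int N" "N1 \<le> N" by (auto simp: N_def)
  have vanish: "Y b (k + int u) a = 0" if "k + int u \<ge> int N" for u
    using that N by (intro assms) auto
  have "(\<Sum>j\<le>N. scale ((-1) ^ j * of_nat (N choose j))
          (Y a (k - int j) (Y b (int j - 1) vac) - Y b (int j - 1) (Y a (k - int j) vac))) = 0"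
    using N1[OF N(2), of "k - int N" "-1" vac] by (simp add: algebra_simps)
  then have "(\<Sum>j\<le>N. scale ((-1) ^ j * of_nat (N choose j)) (Y a (k - int j) (Y b (int j - 1) vac)))
      = (\<Sum>j\<le>N. scale ((-1) ^ j * of_nat (N choose j)) (Y b (int j - 1) (Y a (k - int j) vac)))"
    by (simp add: scale_right_diff_distrib sum_subtractf)
  also have "(\<Sum>j\<le>N. scale ((-1) ^ j * of_nat (N choose j)) (Y a (k - int j) (Y b (int j - 1) vac)))
      = (\<Sum>j\<in>{0}. scale ((-1) ^ j * of_nat (N choose j)) (Y a (k - int j) (Y b (int j - 1) vac)))"
    by (rule sum.mono_neutral_right) (auto simp: creation)
  finally have "Y a k b = (\<Sum>j\<le>N. scale ((-1) ^ j * of_nat (N choose j)) (Y b (int j - 1) (Y a (k - int j) vac)))"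
    by (simp add: creation)
  also have "\<dots> = (\<Sum>j\<le>N. \<Sum>u<M. scale ((-1) ^ j * of_nat (N choose j) * ch (of_nat j - 1) (int j - 1 - (k + int u)))
      (D u (Y b (k + int u) a)))"
  proof (rule sum.cong)
    fix j assume j: "j \<in> {..N}"
    have "Y b (int j - 1) (Y a (k - int j) vac)
        = (\<Sum>u<M. scale (ch (of_nat j - 1) (int j - 1 - (k + int u))) (D u (Y b (k + int u) a)))"
    proof (cases "k - int j < 0")
      case True
      define i where "i = nat (int j - 1 - k)"
      have i: "int i = int j - 1 - k" using True by (simp add: i_def)
      have iM: "i < M" using j by (auto simp: i_def M_def)
      have "Y b (int j - 1) (Y a (k - int j) vac) = Y b (int j - 1) (D i a)"
      proof -
        have "- 1 - (k - int j) = int i" using i by simp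
        then show ?thesis using True by (simp only: Y_vac_D nat_int)
      qed
      also have "\<dots> = (\<Sum>s\<le>i. scale ((of_nat j - 1) gchoose s) (D (i - s) (Y b (int j - 1 - int s) a)))"
        by (subst Y_D) simp
      also have "\<dots> = (\<Sum>u\<le>i. scale (ch (of_nat j - 1) (int j - 1 - (k + int u))) (D u (Y b (k + int u) a)))"
      proof (rule sum.reindex_bij_witness[where i="\<lambda>s. i - s" and j="\<lambda>s. i - s"])
        fix s assume s: "s \<in> {..i}"
        have e1: "int j - 1 - (k + int (i - s)) = int s" using s i by (simp add: of_nat_diff)
        have e2: "k + int (i - s) = int j - 1 - int s" using s i by (simp add: of_nat_diff)
        show "scale (ch (of_nat j - 1) (int j - 1 - (k + int (i - s)))) (D (i - s) (Y b (k + int (i - s)) a))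
            = scale (of_nat j - 1 gchoose s) (D (i - s) (Y b (int j - 1 - int s) a))"
          unfolding e1 e2 by simp
      qed auto
      also have "\<dots> = (\<Sum>u<M. scale (ch (of_nat j - 1) (int j - 1 - (k + int u))) (D u (Y b (k + int u) a)))"
        by (rule sum.mono_neutral_left) (use i iM in \<open>auto simp: ch_neg\<close>)
      finally show ?thesis .
    next
      case False
      then show ?thesis by (simp add: creation ch_neg)
    qed
    then show "scale ((-1) ^ j * of_nat (N choose j)) (Y b (int j - 1) (Y a (k - int j) vac))
        = (\<Sum>u<M. scale ((-1) ^ j * of_nat (N choose j) * ch (of_nat j - 1) (int j - 1 - (k + int u)))
          (D u (Y b (k + int u) a)))"
      by (simp add: scale_sum_right)
  qed auto
  also have "\<dots> = (\<Sum>u<M. scale (\<Sum>j\<le>N. (-1) ^ j * of_nat (N choose j) * ch (of_nat j - 1) (int j - 1 - (k + int u)))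
      (D u (Y b (k + int u) a)))"
    by (subst sum.swap) (simp add: scale_sum_left)
  also have "\<dots> = (\<Sum>u<M. scale (sg (k + int u + 1)) (D u (Y b (k + int u) a)))"
  proof (rule sum.cong)
    fix u
    show "scale (\<Sum>j\<le>N. (-1) ^ j * of_nat (N choose j) * ch (of_nat j - 1) (int j - 1 - (k + int u)))
      (D u (Y b (k + int u) a)) = scale (sg (k + int u + 1)) (D u (Y b (k + int u) a))"
      using vanish[of u] sum_choose_ch_pred[of "k + int u" N] by (cases "k + int u < int N") auto
  qed auto
  also have "\<dots> = (\<Sum>u\<in>{..<K} \<inter> {..<M}. scale (sg (k + int u + 1)) (D u (Y b (k + int u) a)))"
  proof (rule sum.mono_neutral_right)
    show "\<forall>u\<in>{..<M} - {..<K} \<inter> {..<M}. scale (sg (k + int u + 1)) (D u (Y b (k + int u) a)) = 0"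
    proof
      fix u assume "u \<in> {..<M} - {..<K} \<inter> {..<M}"
      then have "K \<le> u" by auto
      from assms[OF this] show "scale (sg (k + int u + 1)) (D u (Y b (k + int u) a)) = 0" by simp
    qed
  qed auto
  also have "\<dots> = (\<Sum>u<K. scale (sg (k + int u + 1)) (D u (Y b (k + int u) a)))"
  proof (rule sum.mono_neutral_left)
    show "\<forall>u\<in>{..<K} - {..<K} \<inter> {..<M}. scale (sg (k + int u + 1)) (D u (Y b (k + int u) a)) = 0"
    proof
      fix u assume "u \<in> {..<K} - {..<K} \<inter> {..<M}"
      then have "k + int u \<ge> int N" by (auto simp: M_def)
      from vanish[OF this] show "scale (sg (k + int u + 1)) (D u (Y b (k + int u) a)) = 0" by simp
    qed
  qed auto
  finally show ?thesis .
qed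

lemma uniform_truncation:
  assumes "finite A"
  obtains N where "\<And>x k. x \<in> A \<Longrightarrow> k \<ge> int N \<Longrightarrow> Y (f x) k (g x) = 0"
  using assms
proof (induction A arbitrary: thesis rule: finite_induct)
  case empty
  then show ?case by simp
next
  case (insert x A)
  obtain N where N: "\<And>x k. x \<in> A \<Longrightarrow> k \<ge> int N \<Longrightarrow> Y (f x) k (g x) = 0"
    using insert.IH by metis
  obtain M where M: "\<And>k. k \<ge> int M \<Longrightarrow> Y (f x) k (g x) = 0"
    using truncation_ge by blast
  show ?case
    by (rule insert.prems[of "max N M"]) (use N M in auto)
qed

text \<open>Skew symmetry turns (a_(r+j) b)_n c into products c_m (a_(r+j) b), locality of a and c
  exchanges these two, and a second use of skew symmetry turns c_m b back into b_m c. The binomial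
  sum over j is the one that locality needs.\<close>

lemma weak_associativity:
  assumes loc: "\<And>P Q d. (\<Sum>j\<le>p. scale ((-1) ^ j * of_nat (p choose j))
          (Y a (P + int p - int j) (Y c (Q + int j) d)
           - Y c (Q + int j) (Y a (P + int p - int j) d))) = 0"
    and K: "\<And>i. i \<ge> K \<Longrightarrow> Y b (q + int i) c = 0"
  shows "(\<Sum>j\<le>p. scale (of_nat (p choose j)) (Y (Y a (r + int j) b) (int p + q - int j) c))
    = (\<Sum>i<K. scale ((-1) ^ i * (of_int r gchoose i)) (Y a (int p + r - int i) (Y b (q + int i) c)))"
proof -
  obtain N1 where N1: "\<And>j k. j \<in> {..p} \<Longrightarrow> k \<ge> int N1 \<Longrightarrow> Y c k (Y a (r + int j) b) = 0"
    using uniform_truncation[of "{..p}" "\<lambda>_. c" "\<lambda>j. Y a (r + int j) b"] by blast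
  obtain N2 where N2: "\<And>k. k \<ge> int N2 \<Longrightarrow> Y c k b = 0"
    using truncation_ge by blast
  define U where "U = K + N1 + N2 + nat (- q)"
  have U1: "Y c (int p + q - int j + int u) (Y a (r + int j) b) = 0" if "j \<le> p" "u \<ge> U" for j u
    by (rule N1) (use that in \<open>auto simp: U_def\<close>)
  have U2: "Y c k b = 0" if "k \<ge> q + int U" for k
  proof (rule N2)
    have "int U \<ge> int N2 - q" by (simp add: U_def)
    then show "k \<ge> int N2" using that by linarith
  qed
  have U3: "Y b (q + int i) c = 0" if "i \<ge> U" for i
    by (rule K) (use that in \<open>auto simp: U_def\<close>)
  let ?C = "\<lambda>j. of_nat (p choose j) :: complex"
  let ?X = "\<lambda>j s v. scale (?C j * ((-1) ^ s * (of_int (r + int j) gchoose s)) * sg (int p + q - int j + int s + int v + 1))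
    (Y a (r + int j - int s) (D v (Y c (int p + q - int j + int s + int v) b)))"
  \<comment> \<open>Locality of a and c on the vector b, read backwards in j so that its signs
    become (-1)^(p-j).\<close>
  have swap: "(\<Sum>j\<le>p. scale (?C j * (-1) ^ (p - j)) (Y c (int p + q - int j + int u) (Y a (r + int j) b)))
     = (\<Sum>j\<le>p. scale (?C j * (-1) ^ (p - j)) (Y a (r + int j) (Y c (int p + q - int j + int u) b)))" for u
  proof -
    have "(\<Sum>j\<le>p. scale ((-1) ^ j * ?C j)
          (Y a (r + int p - int j) (Y c (q + int u + int j) b)
           - Y c (q + int u + int j) (Y a (r + int p - int j) b))) = 0"
      by (rule loc)
    also have "(\<Sum>j\<le>p. scale ((-1) ^ j * ?C j)
          (Y a (r + int p - int j) (Y c (q + int u + int j) b)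
           - Y c (q + int u + int j) (Y a (r + int p - int j) b)))
        = (\<Sum>j\<le>p. scale (?C j * (-1) ^ (p - j))
          (Y a (r + int j) (Y c (int p + q - int j + int u) b) - Y c (int p + q - int j + int u) (Y a (r + int j) b)))"
      by (rule sum.reindex_bij_witness[where i="\<lambda>j. p - j" and j="\<lambda>j. p - j"])
        (auto simp: of_nat_diff binomial_symmetric[of _ p, symmetric] algebra_simps)
    finally show ?thesis
      by (simp add: scale_right_diff_distrib sum_subtractf)
  qed
  have "(\<Sum>j\<le>p. scale (?C j) (Y (Y a (r + int j) b) (int p + q - int j) c))
      = (\<Sum>j\<le>p. \<Sum>u<U. scale (sg (q + int u + 1))
          (D u (scale (?C j * (-1) ^ (p - j)) (Y c (int p + q - int j + int u) (Y a (r + int j) b)))))"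
  proof (rule sum.cong)
    fix j assume j: "j \<in> {..p}"
    have sign: "sg (int p + q - int j + int u + 1) = sg (q + int u + 1) * (-1) ^ (p - j)" for u
      using j sg_of_nat[of "p - j"] by (simp add: of_nat_diff sg_add sg_diff)
    have "Y (Y a (r + int j) b) (int p + q - int j) c
      = (\<Sum>u<U. scale (sg (int p + q - int j + int u + 1)) (D u (Y c (int p + q - int j + int u) (Y a (r + int j) b))))"
      by (rule skew_symmetry) (use j U1 in auto)
    then show "scale (?C j) (Y (Y a (r + int j) b) (int p + q - int j) c)
      = (\<Sum>u<U. scale (sg (q + int u + 1))
          (D u (scale (?C j * (-1) ^ (p - j)) (Y c (int p + q - int j + int u) (Y a (r + int j) b)))))"
      unfolding sign by (simp add: D_linear scale_sum_right mult_ac)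
  qed auto
  also have "\<dots> = (\<Sum>u<U. scale (sg (q + int u + 1))
          (D u (\<Sum>j\<le>p. scale (?C j * (-1) ^ (p - j)) (Y c (int p + q - int j + int u) (Y a (r + int j) b)))))"
    by (subst sum.swap) (simp add: D_linear scale_sum_right)
  also have "\<dots> = (\<Sum>j\<le>p. \<Sum>u<U. scale (sg (q + int u + 1))
          (D u (scale (?C j * (-1) ^ (p - j)) (Y a (r + int j) (Y c (int p + q - int j + int u) b)))))"
    unfolding swap by (subst sum.swap) (simp add: D_linear scale_sum_right)
  also have "\<dots> = (\<Sum>j\<le>p. \<Sum>u<U. \<Sum>s\<le>u. ?X j s (u - s))"
  proof (intro sum.cong refl)
    fix j u assume j: "j \<in> {..p}"
    have sign: "sg (q + int u + 1) * (-1) ^ (p - j) = sg (int p + q - int j + int u + 1)"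
      using j sg_of_nat[of "p - j"] by (simp add: of_nat_diff sg_add sg_diff)
    have e: "int p + q - int j + int s + int (u - s) = int p + q - int j + int u" if "s \<le> u" for s
      using that by simp
    have "scale (sg (q + int u + 1))
          (D u (scale (?C j * (-1) ^ (p - j)) (Y a (r + int j) (Y c (int p + q - int j + int u) b))))
       = scale (?C j * (sg (q + int u + 1) * (-1) ^ (p - j))) (D u (Y a (r + int j) (Y c (int p + q - int j + int u) b)))"
      by (simp add: D_linear mult_ac)
    also have "\<dots> = (\<Sum>s\<le>u. scale (?C j * ((-1) ^ s * (of_int (r + int j) gchoose s)) * sg (int p + q - int j + int u + 1))
        (Y a (r + int j - int s) (D (u - s) (Y c (int p + q - int j + int u) b))))"
      unfolding sign D_Y by (simp add: scale_sum_right mult_ac)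
    also have "\<dots> = (\<Sum>s\<le>u. ?X j s (u - s))"
      by (intro sum.cong refl) (simp only: e atMost_iff)
    finally show "scale (sg (q + int u + 1))
          (D u (scale (?C j * (-1) ^ (p - j)) (Y a (r + int j) (Y c (int p + q - int j + int u) b))))
        = (\<Sum>s\<le>u. ?X j s (u - s))" .
  qed
  \<comment> \<open>The triangle s + v < U may be completed to a square, since c_m b vanishes in the
    added part.\<close>
  also have "\<dots> = (\<Sum>j\<le>p. \<Sum>s<U. \<Sum>v<U. ?X j s v)"
  proof (rule sum.cong[OF refl])
    fix j assume j: "j \<in> {..p}"
    have "(\<Sum>u<U. \<Sum>s\<le>u. ?X j s (u - s)) = (\<Sum>(s, v)\<in>{(s, v). s + v < U}. ?X j s v)"
      by (rule sum.triangle_reindex[symmetric])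
    also have "\<dots> = (\<Sum>(s, v)\<in>{..<U} \<times> {..<U}. ?X j s v)"
    proof (rule sum.mono_neutral_left)
      show "\<forall>i\<in>{..<U} \<times> {..<U} - {(s, v). s + v < U}. (case i of (s, v) \<Rightarrow> ?X j s v) = 0"
      proof
        fix x assume x: "x \<in> {..<U} \<times> {..<U} - {(s, v). s + v < U}"
        obtain s v where sv: "x = (s, v)" by (cases x)
        have "Y c (int p + q - int j + int s + int v) b = 0"
          using j x sv by (intro U2) auto
        then show "(case x of (s, v) \<Rightarrow> ?X j s v) = 0" by (simp add: sv)
      qed
    qed auto
    also have "\<dots> = (\<Sum>s<U. \<Sum>v<U. ?X j s v)"
      by (rule sum.cartesian_product[symmetric])
    finally show "(\<Sum>u<U. \<Sum>s\<le>u. ?X j s (u - s)) = (\<Sum>s<U. \<Sum>v<U. ?X j s v)" .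
  qed
  \<comment> \<open>The inner sum over v is skew symmetry for b and c, read from right to
    left.\<close>
  also have "\<dots> = (\<Sum>j\<le>p. \<Sum>s<U. scale (?C j * ((-1) ^ s * (of_int (r + int j) gchoose s)))
      (Y a (r + int j - int s) (Y b (int p + q - int j + int s) c)))"
  proof (intro sum.cong refl)
    fix j s assume j: "j \<in> {..p}"
    have "Y b (int p + q - int j + int s) c = (\<Sum>v<U. scale (sg (int p + q - int j + int s + int v + 1))
        (D v (Y c (int p + q - int j + int s + int v) b)))"
      by (rule skew_symmetry) (use j U2 in auto)
    then show "(\<Sum>v<U. ?X j s v) = scale (?C j * ((-1) ^ s * (of_int (r + int j) gchoose s)))
      (Y a (r + int j - int s) (Y b (int p + q - int j + int s) c))"
      by (simp add: Y_linear scale_sum_right)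
  qed
  also have "\<dots> = (\<Sum>j\<le>p. \<Sum>i<U + p. scale (?C j * (sg (int i - int (p - j)) * ch (of_int (r + int j)) (int i - int (p - j))))
      (Y a (int p + r - int i) (Y b (q + int i) c)))"
  proof (rule sum.cong[OF refl])
    fix j assume j: "j \<in> {..p}"
    let ?Z = "\<lambda>i. scale (?C j * (sg (int i - int (p - j)) * ch (of_int (r + int j)) (int i - int (p - j))))
      (Y a (int p + r - int i) (Y b (q + int i) c))"
    have "(\<Sum>s<U. scale (?C j * ((-1) ^ s * (of_int (r + int j) gchoose s)))
        (Y a (r + int j - int s) (Y b (int p + q - int j + int s) c))) = (\<Sum>s<U. ?Z (s + (p - j)))"
    proof (intro sum.cong refl)
      fix s
      have e: "int (s + (p - j)) - int (p - j) = int s" "int p + r - int (s + (p - j)) = r + int j - int s"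
        "q + int (s + (p - j)) = int p + q - int j + int s"
        using j by (auto simp: of_nat_diff)
      show "scale (?C j * ((-1) ^ s * (of_int (r + int j) gchoose s)))
        (Y a (r + int j - int s) (Y b (int p + q - int j + int s) c)) = ?Z (s + (p - j))"
        unfolding e sg_of_nat ch_of_nat ..
    qed
    also have "\<dots> = (\<Sum>i\<in>{p - j..<U + (p - j)}. ?Z i)"
      using sum.shift_bounds_nat_ivl[of ?Z 0 "p - j" U, symmetric] by (simp only: atLeast0LessThan add_0)
    also have "\<dots> = (\<Sum>i<U + p. ?Z i)"
      by (rule sum.mono_neutral_left) (auto simp: ch_neg U3)
    finally show "(\<Sum>s<U. scale (?C j * ((-1) ^ s * (of_int (r + int j) gchoose s)))
        (Y a (r + int j - int s) (Y b (int p + q - int j + int s) c))) = (\<Sum>i<U + p. ?Z i)" .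
  qed
  also have "\<dots> = (\<Sum>i<U + p. scale (\<Sum>j\<le>p. ?C j * (sg (int i - int (p - j)) * ch (of_int (r + int j)) (int i - int (p - j))))
      (Y a (int p + r - int i) (Y b (q + int i) c)))"
    by (subst sum.swap) (simp only: scale_sum_left)
  \<comment> \<open>The substitution l = p - j brings the coefficient into the form of
    \<open>sum_choose_ch\<close>.\<close>
  also have "\<dots> = (\<Sum>i<U + p. scale ((-1) ^ i * (of_int r gchoose i)) (Y a (int p + r - int i) (Y b (q + int i) c)))"
  proof (intro sum.cong refl arg_cong2[of _ _ _ _ scale])
    fix i
    have "(\<Sum>j\<le>p. ?C j * (sg (int i - int (p - j)) * ch (of_int (r + int j)) (int i - int (p - j))))
        = (\<Sum>l\<le>p. (-1) ^ i * ((-1) ^ l * of_nat (p choose l) * ch (of_int r + of_nat p - of_nat l) (int i - int l)))"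
    proof (rule sum.reindex_bij_witness[where i="\<lambda>j. p - j" and j="\<lambda>j. p - j"])
      fix j assume "j \<in> {..p}"
      then have "of_int r + of_nat p - of_nat (p - j) = (of_int (r + int j) :: complex)"
        and "p choose (p - j) = p choose j"
        by (auto simp: of_nat_diff binomial_symmetric[of j p])
      then show "(-1) ^ i * ((-1) ^ (p - j) * of_nat (p choose (p - j)) *
          ch (of_int r + of_nat p - of_nat (p - j)) (int i - int (p - j)))
        = ?C j * (sg (int i - int (p - j)) * ch (of_int (r + int j)) (int i - int (p - j)))"
        by (simp only: sg_diff sg_of_nat mult_ac)
    qed auto
    also have "\<dots> = (-1) ^ i * (of_int r gchoose i)"
      unfolding sum_distrib_left[symmetric] sum_choose_ch by simp
    finally show "(\<Sum>j\<le>p. ?C j * (sg (int i - int (p - j)) * ch (of_int (r + int j)) (int i - int (p - j))))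
        = (-1) ^ i * (of_int r gchoose i)" .
  qed
  also have "\<dots> = (\<Sum>i<K. scale ((-1) ^ i * (of_int r gchoose i)) (Y a (int p + r - int i) (Y b (q + int i) c)))"
    by (rule sum.mono_neutral_right) (auto simp: U_def K)
  finally show ?thesis .
qed

end

text \<open>Upwards from the plane p = P the recursion applies directly. Downwards, once level p is
  zero, it propagates the zeros of level p - 1 from the slice r = N to all r, in both directions;
  hence two planes of zeros are needed.\<close>

lemma zero_of_pascal_recursion:
  fixes J :: "int \<Rightarrow> int \<Rightarrow> int \<Rightarrow> 'a::ab_group_add"
  assumes rec: "\<And>p q r. J (p + 1) q r = J p (q + 1) r + J p q (r + 1)"
    and P: "\<And>q r. J P q r = 0" and N: "\<And>p q. J p q N = 0"
  shows "J p q r = 0"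
proof -
  have "\<forall>q r. J p q r = 0"
  proof (induction p rule: int_induct[where k = P])
    case base
    then show ?case using P by simp
  next
    case (step1 p)
    then show ?case by (simp add: rec)
  next
    case (step2 p)
    have "\<forall>q. J (p - 1) q r = 0" for r
    proof (induction r rule: int_induct[where k = N])
      case base
      then show ?case using N by simp
    next
      case (step1 r)
      show ?case
      proof
        fix q
        show "J (p - 1) q (r + 1) = 0"
          using rec[of "p - 1" q r] step2 step1 by simp
      qed
    next
      case (step2 r)
      show ?case
      proof
        fix q
        show "J (p - 1) q (r - 1) = 0"
          using rec[of "p - 1" "q - 1" "r - 1"] \<open>\<forall>q r. J p q r = 0\<close> step2 by simp
      qed
    qed
    then show ?case by blast
  qed
  then show ?thesis by blast
qed

section \<open>The three sums of the Borcherds identity and their Pascal recursion\<close>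

lemma Sum_any_lessThan:
  "(\<And>j. j \<ge> K \<Longrightarrow> f j = 0) \<Longrightarrow> Sum_any f = sum f {..<K::nat}"
  by (rule Sum_any.expand_superset) (auto simp: not_less intro: leI)

context vertex_algebra
begin

lemma Sum_any_pascal:
  assumes "\<And>j. j \<ge> K \<Longrightarrow> g j = 0"
  shows "Sum_any (\<lambda>j. scale (a + 1 gchoose j) (g j))
    = Sum_any (\<lambda>j. scale (a gchoose j) (g j)) + Sum_any (\<lambda>j. scale (a gchoose j) (g (Suc j)))"
proof -
  have "Sum_any (\<lambda>j. scale (a + 1 gchoose j) (g j)) = (\<Sum>j<Suc K. scale (a + 1 gchoose j) (g j))"
    by (rule Sum_any_lessThan) (use assms in auto)
  also have "\<dots> = g 0 + (\<Sum>j<K. scale (a gchoose Suc j) (g (Suc j))) + (\<Sum>j<K. scale (a gchoose j) (g (Suc j)))"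
    unfolding sum.lessThan_Suc_shift gbinomial_Suc_Suc scale_left_distrib sum.distrib by (simp add: ac_simps)
  also have "g 0 + (\<Sum>j<K. scale (a gchoose Suc j) (g (Suc j))) = (\<Sum>j<Suc K. scale (a gchoose j) (g j))"
    unfolding sum.lessThan_Suc_shift by simp
  also have "\<dots> = Sum_any (\<lambda>j. scale (a gchoose j) (g j))"
    by (rule Sum_any_lessThan[symmetric]) (use assms in auto)
  also have "(\<Sum>j<K. scale (a gchoose j) (g (Suc j))) = Sum_any (\<lambda>j. scale (a gchoose j) (g (Suc j)))"
    by (rule Sum_any_lessThan[symmetric]) (use assms in auto)
  finally show ?thesis .
qed

lemma Sum_any_minus: "Sum_any (\<lambda>j. - f j) = - (Sum_any f :: 'v)"
  by (simp add: Sum_any.expand_set sum_negf)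

text \<open>Truncation bounds change with p, q and r, so fixed ranges would interfere with the
  recursion; \<open>Sum_any\<close> avoids them. The two halves of the right side are kept apart
  because each satisfies the recursion on its own.\<close>

definition borcherds_lhs where
  "borcherds_lhs a b c p q r = Sum_any (\<lambda>j. scale (of_int p gchoose j) (Y (Y a (r + int j) b) (p + q - int j) c))"

definition borcherds_rhs1 where
  "borcherds_rhs1 a b c p q r = Sum_any (\<lambda>j. scale (of_int r gchoose j)
    (scale ((-1) ^ j) (Y a (p + r - int j) (Y b (q + int j) c))))"

definition borcherds_rhs2 where
  "borcherds_rhs2 a b c p q r = Sum_any (\<lambda>j. scale (of_int r gchoose j)
    (scale ((-1) ^ j * sg r) (Y b (q + r - int j) (Y a (p + int j) c))))"

lemma mode_bound:
  obtains K where "\<And>j. j \<ge> K \<Longrightarrow> Y a (k + int j) b = 0"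
proof -
  obtain N where N: "\<And>k. k \<ge> int N \<Longrightarrow> Y a k b = 0" using truncation_ge by blast
  show thesis by (rule that[of "N + nat (- k)"]) (rule N, simp)
qed

lemma borcherds_lhs_rec:
  "borcherds_lhs a b c (p + 1) q r = borcherds_lhs a b c p (q + 1) r + borcherds_lhs a b c p q (r + 1)"
proof -
  obtain K where K: "\<And>j. j \<ge> K \<Longrightarrow> Y a (r + int j) b = 0" using mode_bound by blast
  have "borcherds_lhs a b c (p + 1) q r
      = Sum_any (\<lambda>j. scale (of_int p + 1 gchoose j) (Y (Y a (r + int j) b) (p + 1 + q - int j) c))"
    by (simp add: borcherds_lhs_def)
  also have "\<dots> = Sum_any (\<lambda>j. scale (of_int p gchoose j) (Y (Y a (r + int j) b) (p + 1 + q - int j) c))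
      + Sum_any (\<lambda>j. scale (of_int p gchoose j) (Y (Y a (r + int (Suc j)) b) (p + 1 + q - int (Suc j)) c))"
    by (rule Sum_any_pascal[where K=K]) (use K in auto)
  finally show ?thesis
    by (simp add: borcherds_lhs_def algebra_simps)
qed

lemma borcherds_rhs1_rec:
  "borcherds_rhs1 a b c (p + 1) q r = borcherds_rhs1 a b c p (q + 1) r + borcherds_rhs1 a b c p q (r + 1)"
proof -
  obtain K where K: "\<And>j. j \<ge> K \<Longrightarrow> Y b (q + int j) c = 0" using mode_bound by blast
  have "borcherds_rhs1 a b c p q (r + 1)
      = Sum_any (\<lambda>j. scale (of_int r + 1 gchoose j) (scale ((-1) ^ j) (Y a (p + (r + 1) - int j) (Y b (q + int j) c))))"
    by (simp add: borcherds_rhs1_def)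
  also have "\<dots> = Sum_any (\<lambda>j. scale (of_int r gchoose j) (scale ((-1) ^ j) (Y a (p + (r + 1) - int j) (Y b (q + int j) c))))
      + Sum_any (\<lambda>j. scale (of_int r gchoose j)
          (scale ((-1) ^ Suc j) (Y a (p + (r + 1) - int (Suc j)) (Y b (q + int (Suc j)) c))))"
    by (rule Sum_any_pascal[where K=K]) (use K in auto)
  also have "\<dots> = borcherds_rhs1 a b c (p + 1) q r - borcherds_rhs1 a b c p (q + 1) r"
    by (simp add: borcherds_rhs1_def Sum_any_minus algebra_simps)
  finally show ?thesis by simp
qed

lemma borcherds_rhs2_rec:
  "borcherds_rhs2 a b c (p + 1) q r = borcherds_rhs2 a b c p (q + 1) r + borcherds_rhs2 a b c p q (r + 1)"
proof -
  obtain K where K: "\<And>j. j \<ge> K \<Longrightarrow> Y a (p + int j) c = 0" using mode_bound by blast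
  have "borcherds_rhs2 a b c p q (r + 1)
      = Sum_any (\<lambda>j. scale (of_int r + 1 gchoose j)
          (scale ((-1) ^ j * sg (r + 1)) (Y b (q + (r + 1) - int j) (Y a (p + int j) c))))"
    by (simp add: borcherds_rhs2_def)
  also have "\<dots> = Sum_any (\<lambda>j. scale (of_int r gchoose j)
          (scale ((-1) ^ j * sg (r + 1)) (Y b (q + (r + 1) - int j) (Y a (p + int j) c))))
      + Sum_any (\<lambda>j. scale (of_int r gchoose j)
          (scale ((-1) ^ Suc j * sg (r + 1)) (Y b (q + (r + 1) - int (Suc j)) (Y a (p + int (Suc j)) c))))"
    by (rule Sum_any_pascal[where K=K]) (use K in auto)
  also have "\<dots> = borcherds_rhs2 a b c (p + 1) q r - borcherds_rhs2 a b c p (q + 1) r"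
    by (simp add: borcherds_rhs2_def Sum_any_minus sg_add algebra_simps)
  finally show ?thesis by simp
qed

text \<open>
  Locality of \<open>a\<close> and \<open>b\<close> is the identity for large \<open>r\<close>, and weak associativity is the identity for
  large \<open>p\<close>. Both sides satisfy the same Pascal recursion, which propagates it to all \<open>p\<close>, \<open>q\<close>, \<open>r\<close>.
\<close>

theorem borcherds_identity:
  assumes "\<And>j. j \<ge> K \<Longrightarrow> Y a (r + int j) b = 0" "\<And>j. j \<ge> K \<Longrightarrow> Y b (q + int j) c = 0"
    "\<And>j. j \<ge> K \<Longrightarrow> Y a (p + int j) c = 0"
  shows "(\<Sum>j<K. scale (of_int p gchoose j) (Y (Y a (r + int j) b) (p + q - int j) c))
    = (\<Sum>j<K. scale ((-1) ^ j * (of_int r gchoose j))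
        (Y a (p + r - int j) (Y b (q + int j) c) - scale (sg r) (Y b (q + r - int j) (Y a (p + int j) c))))"
proof -
  let ?J = "\<lambda>p q r. borcherds_lhs a b c p q r - (borcherds_rhs1 a b c p q r - borcherds_rhs2 a b c p q r)"
  obtain N1 where N1: "\<And>N p q d. N \<ge> N1 \<Longrightarrow> (\<Sum>j\<le>N. scale ((-1) ^ j * of_nat (N choose j))
          (Y a (p + int N - int j) (Y b (q + int j) d) - Y b (q + int j) (Y a (p + int N - int j) d))) = 0"
    using locality_ge by blast
  obtain N2 where N2: "\<And>k. k \<ge> int N2 \<Longrightarrow> Y a k b = 0" using truncation_ge by blast
  obtain P1 where P1: "\<And>N p q d. N \<ge> P1 \<Longrightarrow> (\<Sum>j\<le>N. scale ((-1) ^ j * of_nat (N choose j))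
          (Y a (p + int N - int j) (Y c (q + int j) d) - Y c (q + int j) (Y a (p + int N - int j) d))) = 0"
    using locality_ge by blast
  obtain P2 where P2: "\<And>k. k \<ge> int P2 \<Longrightarrow> Y a k c = 0" using truncation_ge by blast
  define N where "N = N1 + N2"
  define P where "P = P1 + P2"
  have JN: "?J p q (int N) = 0" for p q
  proof -
    have "borcherds_lhs a b c p q (int N) = 0"
      by (simp add: borcherds_lhs_def N2 N_def)
    moreover have "borcherds_rhs1 a b c p q (int N)
        = (\<Sum>j\<le>N. scale ((-1) ^ j * of_nat (N choose j)) (Y a (p + int N - int j) (Y b (q + int j) c)))"
      unfolding borcherds_rhs1_def
      by (subst Sum_any_lessThan[where K="Suc N"])
        (auto simp: binomial_eq_0 lessThan_Suc_atMost mult.commute simp flip: binomial_gbinomial)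
    moreover have "borcherds_rhs2 a b c p q (int N)
        = (\<Sum>j\<le>N. scale ((-1) ^ j * of_nat (N choose j)) (Y b (q + int j) (Y a (p + int N - int j) c)))"
    proof -
      have "borcherds_rhs2 a b c p q (int N) = (\<Sum>j\<le>N. scale ((-1) ^ j * (-1) ^ N * of_nat (N choose j))
          (Y b (q + int N - int j) (Y a (p + int j) c)))"
        unfolding borcherds_rhs2_def
        by (subst Sum_any_lessThan[where K="Suc N"])
          (auto simp: binomial_eq_0 lessThan_Suc_atMost mult.commute sg_of_nat simp flip: binomial_gbinomial)
      also have "\<dots> = (\<Sum>j\<le>N. scale ((-1) ^ j * of_nat (N choose j)) (Y b (q + int j) (Y a (p + int N - int j) c)))"
      proof (rule sum.reindex_bij_witness[where i="\<lambda>j. N - j" and j="\<lambda>j. N - j"])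
        fix j assume j: "j \<in> {..N}"
        have "(-1::complex) ^ (N - j) = (-1) ^ j * (-1) ^ N"
          using j by (auto simp: minus_one_power_iff)
        then show "scale ((-1) ^ (N - j) * of_nat (N choose (N - j))) (Y b (q + int (N - j)) (Y a (p + int N - int (N - j)) c))
            = scale ((-1) ^ j * (-1) ^ N * of_nat (N choose j)) (Y b (q + int N - int j) (Y a (p + int j) c))"
          using j by (simp add: of_nat_diff binomial_symmetric[symmetric] algebra_simps)
      qed auto
      finally show ?thesis .
    qed
    ultimately show ?thesis
      using N1[of N p q c] by (simp add: N_def scale_right_diff_distrib sum_subtractf)
  qed
  have JP: "?J (int P) q r = 0" for q r
  proof -
    obtain K where K: "\<And>j. j \<ge> K \<Longrightarrow> Y b (q + int j) c = 0" using mode_bound by blast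
    have "borcherds_rhs2 a b c (int P) q r = 0"
      by (simp add: borcherds_rhs2_def P2 P_def)
    moreover have "borcherds_rhs1 a b c (int P) q r
        = (\<Sum>j<K. scale ((-1) ^ j * (of_int r gchoose j)) (Y a (int P + r - int j) (Y b (q + int j) c)))"
      unfolding borcherds_rhs1_def
      by (subst Sum_any_lessThan[where K=K]) (auto simp: K mult.commute)
    moreover have "borcherds_lhs a b c (int P) q r
        = (\<Sum>j\<le>P. scale (of_nat (P choose j)) (Y (Y a (r + int j) b) (int P + q - int j) c))"
      unfolding borcherds_lhs_def
      by (subst Sum_any_lessThan[where K="Suc P"])
        (auto simp: binomial_eq_0 lessThan_Suc_atMost simp flip: binomial_gbinomial)
    ultimately show ?thesis
      using weak_associativity[of P a c, OF P1 K, where r=r] by (simp add: P_def)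
  qed
  have "?J p q r = 0"
    by (rule zero_of_pascal_recursion[where J="?J" and P="int P" and N="int N"])
      (use JN JP in \<open>simp_all only: borcherds_lhs_rec borcherds_rhs1_rec borcherds_rhs2_rec\<close>, simp add: algebra_simps)
  moreover have "borcherds_lhs a b c p q r
      = (\<Sum>j<K. scale (of_int p gchoose j) (Y (Y a (r + int j) b) (p + q - int j) c))"
    unfolding borcherds_lhs_def by (rule Sum_any_lessThan) (simp add: assms)
  moreover have "borcherds_rhs1 a b c p q r
      = (\<Sum>j<K. scale (of_int r gchoose j) (scale ((-1) ^ j) (Y a (p + r - int j) (Y b (q + int j) c))))"
    unfolding borcherds_rhs1_def by (rule Sum_any_lessThan) (simp add: assms)
  moreover have "borcherds_rhs2 a b c p q r
      = (\<Sum>j<K. scale (of_int r gchoose j) (scale ((-1) ^ j * sg r) (Y b (q + r - int j) (Y a (p + int j) c))))"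
    unfolding borcherds_rhs2_def by (rule Sum_any_lessThan) (simp add: assms)
  ultimately show ?thesis
    by (simp add: scale_right_diff_distrib sum_subtractf mult_ac)
qed

text \<open>The case r = 0 of the Borcherds identity, where (0 choose j) leaves only j = 0 on the
  right.\<close>

lemma commutator_formula:
  assumes "\<And>j. j \<ge> K \<Longrightarrow> Y a (int j) b = 0"
  shows "Y a p (Y b q c) - Y b q (Y a p c) = (\<Sum>j<K. scale (of_int p gchoose j) (Y (Y a (int j) b) (p + q - int j) c))"
proof -
  obtain K1 where K1: "\<And>j. j \<ge> K1 \<Longrightarrow> Y b (q + int j) c = 0" using mode_bound by blast
  obtain K2 where K2: "\<And>j. j \<ge> K2 \<Longrightarrow> Y a (p + int j) c = 0" using mode_bound by blast
  define M where "M = Suc (K + K1 + K2)"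
  have "(\<Sum>j<M. scale (of_int p gchoose j) (Y (Y a (0 + int j) b) (p + q - int j) c))
    = (\<Sum>j<M. scale ((-1) ^ j * (of_int 0 gchoose j))
        (Y a (p + 0 - int j) (Y b (q + int j) c) - scale (sg 0) (Y b (q + 0 - int j) (Y a (p + int j) c))))"
    by (rule borcherds_identity) (use assms K1 K2 in \<open>auto simp: M_def\<close>)
  also have "\<dots> = (\<Sum>j\<in>{0}. scale ((-1) ^ j * (of_int 0 gchoose j))
        (Y a (p + 0 - int j) (Y b (q + int j) c) - scale (sg 0) (Y b (q + 0 - int j) (Y a (p + int j) c))))"
    by (rule sum.mono_neutral_right) (auto simp: M_def gbinomial_0_left)
  also have "\<dots> = Y a p (Y b q c) - Y b q (Y a p c)" by simp
  also have "(\<Sum>j<M. scale (of_int p gchoose j) (Y (Y a (0 + int j) b) (p + q - int j) c))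
      = (\<Sum>j<K. scale (of_int p gchoose j) (Y (Y a (int j) b) (p + q - int j) c))"
    by (rule sum.mono_neutral_cong_right) (auto simp: M_def assms)
  finally show ?thesis by simp
qed

text \<open>The case p = 0 of the Borcherds identity, where (0 choose j) collapses the left
  side.\<close>

lemma associator_formula:
  assumes "\<And>j. j \<ge> K \<Longrightarrow> Y b (q + int j) c = 0" "\<And>j. j \<ge> K \<Longrightarrow> Y a (int j) c = 0"
  shows "Y (Y a r b) q c = (\<Sum>j<K. scale ((-1) ^ j * (of_int r gchoose j))
        (Y a (r - int j) (Y b (q + int j) c) - scale (sg r) (Y b (q + r - int j) (Y a (int j) c))))"
proof -
  obtain K1 where K1: "\<And>j. j \<ge> K1 \<Longrightarrow> Y a (r + int j) b = 0" using mode_bound by blast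
  define M where "M = Suc (K + K1)"
  have "(\<Sum>j<M. scale (of_int 0 gchoose j) (Y (Y a (r + int j) b) (0 + q - int j) c))
    = (\<Sum>j<M. scale ((-1) ^ j * (of_int r gchoose j))
        (Y a (0 + r - int j) (Y b (q + int j) c) - scale (sg r) (Y b (q + r - int j) (Y a (0 + int j) c))))"
    by (rule borcherds_identity) (use assms K1 in \<open>auto simp: M_def\<close>)
  also have "(\<Sum>j<M. scale (of_int 0 gchoose j) (Y (Y a (r + int j) b) (0 + q - int j) c))
      = (\<Sum>j\<in>{0}. scale (of_int 0 gchoose j) (Y (Y a (r + int j) b) (0 + q - int j) c))"
    by (rule sum.mono_neutral_right) (auto simp: M_def gbinomial_0_left)
  also have "\<dots> = Y (Y a r b) q c" by simp
  also have "(\<Sum>j<M. scale ((-1) ^ j * (of_int r gchoose j))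
        (Y a (0 + r - int j) (Y b (q + int j) c) - scale (sg r) (Y b (q + r - int j) (Y a (0 + int j) c))))
      = (\<Sum>j<K. scale ((-1) ^ j * (of_int r gchoose j))
        (Y a (r - int j) (Y b (q + int j) c) - scale (sg r) (Y b (q + r - int j) (Y a (int j) c))))"
    by (rule sum.mono_neutral_cong_right) (auto simp: M_def assms)
  finally show ?thesis .
qed

lemma associator_bound:
  obtains K where "\<And>j. j \<ge> K \<Longrightarrow> Y b (q + int j) c = 0" "\<And>j. j \<ge> K \<Longrightarrow> Y a (int j) c = 0"
proof -
  obtain K1 where K1: "\<And>j. j \<ge> K1 \<Longrightarrow> Y b (q + int j) c = 0" using mode_bound by blast
  obtain K2 where K2: "\<And>j. j \<ge> K2 \<Longrightarrow> Y a (0 + int j) c = 0" using mode_bound by blast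
  show thesis by (rule that[of "max K1 K2"]) (use K1 K2 in auto)
qed

lemma commutator_bound:
  obtains K where "\<And>j. j \<ge> K \<Longrightarrow> Y a (int j) b = 0"
  using mode_bound[of a 0 b] by auto

text \<open>The translation axiom only controls commutators with T. For the modes of Ta the
  associator formula is applied to Ta = a_(-2) vac. Modes of the vacuum are 0 except at index -1, so
  at most one j contributes, from the first or the second half according to the sign of q.\<close>

lemma Y_T: "Y (D (Suc 0) a) q c = - scale (of_int q) (Y a (q - 1) c)"
proof -
  obtain K where K: "\<And>j. j \<ge> K \<Longrightarrow> Y vac (q + int j) c = 0" "\<And>j. j \<ge> K \<Longrightarrow> Y a (int j) c = 0"
    using associator_bound by blast
  define M where "M = K + nat (- q) + nat q + 2"
  have vanish: "Y vac (q + int j) c = 0" "Y a (int j) c = 0" if "j \<ge> M" for j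
    using that K by (auto simp: M_def)
  let ?t = "\<lambda>j. scale (of_nat (Suc j))
        (Y a (- 2 - int j) (Y vac (q + int j) c) - Y vac (q - 2 - int j) (Y a (int j) c))"
  have "Y (D (Suc 0) a) q c = (\<Sum>j<M. scale ((-1) ^ j * (of_int (- 2) gchoose j))
        (Y a (- 2 - int j) (Y vac (q + int j) c) - scale (sg (- 2)) (Y vac (q + (- 2) - int j) (Y a (int j) c))))"
    unfolding D_def by (simp, rule associator_formula[where r="-2", simplified]) (use vanish in auto)
  also have "\<dots> = (\<Sum>j<M. ?t j)"
    by (intro sum.cong refl) (simp add: gchoose_minus_two sg_def)
  also have "\<dots> = - scale (of_int q) (Y a (q - 1) c)"
  proof (cases "q < 0")
    case True
    define i where "i = nat (- 1 - q)"
    have q: "q = - 1 - int i" using True by (simp add: i_def)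
    have "(\<Sum>j<M. ?t j) = (\<Sum>j\<in>{i}. ?t j)"
      by (rule sum.mono_neutral_right) (auto simp: M_def q vacuum)
    also have "\<dots> = - scale (of_int q) (Y a (q - 1) c)"
      by (simp add: q vacuum flip: scale_minus_left)
    finally show ?thesis .
  next
    case False
    show ?thesis
    proof (cases "q = 0")
      case True
      then show ?thesis by (auto intro!: sum.neutral simp: vacuum)
    next
      case q0: False
      define i where "i = nat (q - 1)"
      have q: "q = 1 + int i" using False q0 by (simp add: i_def)
      have "(\<Sum>j<M. ?t j) = (\<Sum>j\<in>{i}. ?t j)"
        by (rule sum.mono_neutral_right) (auto simp: M_def q vacuum)
      also have "\<dots> = - scale (of_int q) (Y a (q - 1) c)"
        by (simp add: q vacuum scale_right_diff_distrib)
      finally show ?thesis .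
    qed
  qed
  finally show ?thesis .
qed

lemma Y_D_mode: "Y (D l a) s c = scale ((-1) ^ l * (of_int s gchoose l)) (Y a (s - int l) c)"
proof (induction l arbitrary: s)
  case 0
  then show ?case by simp
next
  case (Suc l)
  have coeff: "of_int s * ((-1) ^ l * (of_int (s - 1) gchoose l))
      = - (of_nat (Suc l) * ((-1) ^ Suc l * (of_int s gchoose Suc l)) :: complex)"
  proof -
    have "of_int s * ((-1) ^ l * (of_int (s - 1) gchoose l)) = (-1) ^ l * (of_int s * ((of_int s - 1) gchoose l) :: complex)"
      by simp
    also have "\<dots> = (-1) ^ l * (of_nat (Suc l) * (of_int s gchoose Suc l))"
      by (simp only: gbinomial_absorption)
    finally show ?thesis by simp
  qed
  have "scale (of_nat (Suc l)) (Y (D (Suc l) a) s c) = Y (D (Suc 0) (D l a)) s c"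
    by (simp only: T_D Y_linear)
  also have "\<dots> = - scale (of_int s) (Y (D l a) (s - 1) c)"
    by (rule Y_T)
  also have "\<dots> = scale (- (of_int s * ((-1) ^ l * (of_int (s - 1) gchoose l)))) (Y a (s - int (Suc l)) c)"
    unfolding Suc.IH by (simp add: algebra_simps)
  also have "\<dots> = scale (of_nat (Suc l)) (scale ((-1) ^ Suc l * (of_int s gchoose Suc l)) (Y a (s - int (Suc l)) c))"
    unfolding coeff by (simp only: minus_minus scale_scale)
  finally show ?case by (rule scale_of_nat_Suc_cancel)
qed

end

section \<open>The Zhu algebra\<close>

context vertex_algebra
begin

text \<open>\<open>zres e t a b\<close> is the residue of \<open>(1+z)\<^sup>e z\<^sup>t a(z) b\<close>.\<close>

definition zres :: "nat \<Rightarrow> int \<Rightarrow> 'v \<Rightarrow> 'v \<Rightarrow> 'v" where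
  "zres e t a b = (\<Sum>j\<le>e. scale (of_nat (e choose j)) (Y a (t + int j) b))"

section \<open>Calculus of residues weighted by powers of 1 + z\<close>

lemma zhu_residue_eq: "zhu_residue s m a b = zres m (- int s) a b"
  unfolding zhu_residue_def zres_def by (simp add: add.commute)

lemma zres_linear: "zres e t (a + a') b = zres e t a b + zres e t a' b"
  "zres e t (a - a') b = zres e t a b - zres e t a' b"
  "zres e t (scale s a) b = scale s (zres e t a b)"
  "zres e t a (b + b') = zres e t a b + zres e t a b'"
  "zres e t a (b - b') = zres e t a b - zres e t a b'"
  "zres e t a (scale s b) = scale s (zres e t a b)"
  "zres e t a (sum f A) = (\<Sum>x\<in>A. zres e t a (f x))"
  "zres e t (sum f A) b = (\<Sum>x\<in>A. zres e t (f x) b)"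
       apply (simp_all add: zres_def Y_linear scale_right_distrib scale_right_diff_distrib sum.distrib
      sum_subtractf scale_sum_right mult.commute)
  by (rule sum.swap)+

lemma zres_zero [simp]: "zres e t 0 b = 0" "zres e t a 0 = 0"
  by (simp_all add: zres_def)

lemma zres_0 [simp]: "zres 0 t a b = Y a t b"
  by (simp add: zres_def)

lemma zres_Suc: "zres (Suc e) t a b = zres e t a b + zres e (t + 1) a b"
  unfolding zres_def scale_sum_Suc_choose by (simp add: algebra_simps)

lemma zres_convolve: "(\<Sum>p\<le>m. scale (of_nat (m choose p)) (zres e (t + int p) a b)) = zres (m + e) t a b"
proof (induction m arbitrary: t)
  case 0
  then show ?case by simp
next
  case (Suc m)
  show ?case
    using Suc.IH[of t] Suc.IH[of "t + 1"] unfolding scale_sum_Suc_choose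
    by (simp add: zres_Suc algebra_simps)
qed

lemma sum_choose_choose:
  "(\<Sum>p\<le>m. scale (of_nat (m choose p) * of_nat (p choose j)) (f (int p - int j)))
    = scale (of_nat (m choose j)) (\<Sum>p\<le>m - j. scale (of_nat ((m - j) choose p)) (f (int p)))"
proof (cases "j \<le> m")
  case True
  have "(\<Sum>p\<le>m. scale (of_nat (m choose p) * of_nat (p choose j)) (f (int p - int j)))
      = (\<Sum>p\<in>{j..m}. scale (of_nat (m choose p) * of_nat (p choose j)) (f (int p - int j)))"
    by (rule sum.mono_neutral_right) (auto simp: binomial_eq_0)
  also have "\<dots> = (\<Sum>p\<le>m - j. scale (of_nat (m choose j) * of_nat ((m - j) choose p)) (f (int p)))"
  proof (rule sum.reindex_bij_witness[where i="\<lambda>p. p + j" and j="\<lambda>p. p - j"])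
    fix p assume p: "p \<in> {j..m}"
    then show "scale (of_nat (m choose j) * of_nat ((m - j) choose (p - j))) (f (int (p - j)))
      = scale (of_nat (m choose p) * of_nat (p choose j)) (f (int p - int j))"
      by (simp add: of_nat_diff choose_mult flip: of_nat_mult)
  qed (use True in auto)
  finally show ?thesis by (simp add: scale_sum_right)
next
  case False
  then show ?thesis by (auto intro!: sum.neutral simp: binomial_eq_0)
qed

lemma zres_choose_choose:
  "(\<Sum>p\<le>m. scale (of_nat (m choose p) * of_nat (p choose j)) (zres e (t + int p - int j) a b))
    = scale (of_nat (m choose j)) (zres (m - j + e) t a b)"
  using sum_choose_choose[of m j "\<lambda>p. zres e (t + p) a b"] by (simp add: zres_convolve algebra_simps)

lemma zres_zres: "zres m s a (zres e t b c)
  = (\<Sum>p\<le>m. \<Sum>u\<le>e. scale (of_nat (m choose p) * of_nat (e choose u)) (Y a (s + int p) (Y b (t + int u) c)))"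
  by (simp add: zres_def Y_linear scale_sum_right)

text \<open>The Borcherds identity summed against (1+z)^m (1+w)^e w^t. On the left z = w + x, and
  (1+w+x)^m is the sum of (m choose j) x^j (1+w)^(m-j), which explains the falling exponents.
  \<open>K > 0\<close> lets the term i = 0 be split off.\<close>

lemma zres_associator:
  obtains K where "(\<Sum>j\<le>m. scale (of_nat (m choose j)) (zres (m - j + e) t (Y a (r + int j) b) c))
    = (\<Sum>i<K. scale ((-1) ^ i * (of_int r gchoose i))
        (zres m (r - int i) a (zres e (t + int i) b c) - scale (sg r) (zres e (t + r - int i) b (zres m (int i) a c))))"
    "K > 0"
proof -
  obtain K1 where K1: "\<And>j. j \<ge> K1 \<Longrightarrow> Y a (r + int j) b = 0" using mode_bound by blast
  obtain K2 where K2: "\<And>j. j \<ge> K2 \<Longrightarrow> Y b (t + int j) c = 0" "\<And>j. j \<ge> K2 \<Longrightarrow> Y a (int j) c = 0"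
    using associator_bound by blast
  define K where "K = Suc (K1 + K2 + m)"
  let ?C = "\<lambda>p u. of_nat (m choose p) * of_nat (e choose u) :: complex"
  have b: "(\<Sum>j<K. scale (of_nat (p choose j)) (Y (Y a (r + int j) b) (int p + (t + int u) - int j) c))
    = (\<Sum>j<K. scale ((-1) ^ j * (of_int r gchoose j))
        (Y a (int p + r - int j) (Y b ((t + int u) + int j) c)
          - scale (sg r) (Y b ((t + int u) + r - int j) (Y a (int p + int j) c))))" for p u
  proof -
    have "Y b (t + int u + int j) c = 0" "Y a (int p + int j) c = 0" if "j \<ge> K" for j
      using K2(1)[of "u + j"] K2(2)[of "p + j"] that by (auto simp: K_def algebra_simps)
    then show ?thesis
      using borcherds_identity[of K a r b "t + int u" c "int p"] K1
      by (auto simp: K_def simp flip: binomial_gbinomial)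
  qed
  have "(\<Sum>j\<le>m. scale (of_nat (m choose j)) (zres (m - j + e) t (Y a (r + int j) b) c))
      = (\<Sum>j<K. scale (of_nat (m choose j)) (zres (m - j + e) t (Y a (r + int j) b) c))"
    by (rule sum.mono_neutral_left) (auto simp: K_def binomial_eq_0)
  also have "\<dots> = (\<Sum>j<K. \<Sum>p\<le>m. \<Sum>u\<le>e. scale (?C p u) (scale (of_nat (p choose j))
      (Y (Y a (r + int j) b) (int p + (t + int u) - int j) c)))"
    unfolding zres_choose_choose[symmetric]
    by (simp add: zres_def scale_sum_right algebra_simps)
  also have "\<dots> = (\<Sum>p\<le>m. \<Sum>u\<le>e. scale (?C p u) (\<Sum>j<K. scale (of_nat (p choose j))
      (Y (Y a (r + int j) b) (int p + (t + int u) - int j) c)))"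
    unfolding scale_sum_right
    by (subst sum.swap, rule sum.cong[OF refl], subst sum.swap, rule refl)
  also have "\<dots> = (\<Sum>p\<le>m. \<Sum>u\<le>e. \<Sum>j<K. scale ((-1) ^ j * (of_int r gchoose j))
        (scale (?C p u) (Y a (r - int j + int p) (Y b ((t + int j) + int u) c))
          - scale (sg r) (scale (?C p u) (Y b ((t + r - int j) + int u) (Y a (int j + int p) c)))))"
    unfolding b by (simp add: scale_sum_right algebra_simps)
  also have "\<dots> = (\<Sum>j<K. \<Sum>p\<le>m. \<Sum>u\<le>e. scale ((-1) ^ j * (of_int r gchoose j))
        (scale (?C p u) (Y a (r - int j + int p) (Y b ((t + int j) + int u) c))
          - scale (sg r) (scale (?C p u) (Y b ((t + r - int j) + int u) (Y a (int j + int p) c)))))"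
    by (rule sum_rotate)
  also have "\<dots> = (\<Sum>i<K. scale ((-1) ^ i * (of_int r gchoose i))
        (zres m (r - int i) a (zres e (t + int i) b c) - scale (sg r) (zres e (t + r - int i) b (zres m (int i) a c))))"
  proof (rule sum.cong[OF refl])
    fix j
    have s: "(\<Sum>u\<le>e. \<Sum>p\<le>m. scale (of_nat (e choose u) * of_nat (m choose p)) (Y b (t + r - int j + int u) (Y a (int j + int p) c)))
      = (\<Sum>p\<le>m. \<Sum>u\<le>e. scale (?C p u) (Y b (t + r - int j + int u) (Y a (int j + int p) c)))"
      by (subst sum.swap) (simp add: mult.commute)
    show "(\<Sum>p\<le>m. \<Sum>u\<le>e. scale ((-1) ^ j * (of_int r gchoose j))
        (scale (?C p u) (Y a (r - int j + int p) (Y b ((t + int j) + int u) c))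
          - scale (sg r) (scale (?C p u) (Y b ((t + r - int j) + int u) (Y a (int j + int p) c)))))
      = scale ((-1) ^ j * (of_int r gchoose j))
        (zres m (r - int j) a (zres e (t + int j) b c) - scale (sg r) (zres e (t + r - int j) b (zres m (int j) a c)))"
      unfolding zres_zres s
      by (simp only: scale_sum_right sum_subtractf scale_right_diff_distrib)
  qed
  finally show thesis by (rule that) (simp add: K_def)
qed

text \<open>Here z^s (1+z)^m is expanded at z = w; its k-th Taylor coefficient is the sum over j of
  (m choose j) (s choose k-j) w^(s-k+j) (1+w)^(m-j).\<close>

lemma zres_commutator:
  assumes "\<And>k. k \<ge> K \<Longrightarrow> Y a (int k) b = 0"
  shows "zres m s a (zres e t b c) - zres e t b (zres m s a c)
    = (\<Sum>k<K. \<Sum>j\<le>k. scale (of_nat (m choose j) * (of_int s gchoose (k - j)))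
        (zres (m - j + e) (s + t - int (k - j)) (Y a (int k) b) c))"
proof -
  let ?C = "\<lambda>p u. of_nat (m choose p) * of_nat (e choose u) :: complex"
  have "zres e t b (zres m s a c)
    = (\<Sum>p\<le>m. \<Sum>u\<le>e. scale (?C p u) (Y b (t + int u) (Y a (s + int p) c)))"
    unfolding zres_zres by (subst sum.swap) (simp add: mult.commute)
  then have "zres m s a (zres e t b c) - zres e t b (zres m s a c)
     = (\<Sum>p\<le>m. \<Sum>u\<le>e. scale (?C p u)
        (Y a (s + int p) (Y b (t + int u) c) - Y b (t + int u) (Y a (s + int p) c)))"
    by (simp only: zres_zres sum_subtractf scale_right_diff_distrib)
  also have "\<dots> = (\<Sum>p\<le>m. \<Sum>u\<le>e. scale (?C p u) (\<Sum>k<K. scale (of_int (s + int p) gchoose k)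
        (Y (Y a (int k) b) (s + int p + (t + int u) - int k) c)))"
    by (simp only: commutator_formula[OF assms])
  also have "\<dots> = (\<Sum>k<K. \<Sum>p\<le>m. \<Sum>u\<le>e. scale (?C p u * (of_int (s + int p) gchoose k))
        (Y (Y a (int k) b) (s + int p + (t + int u) - int k) c))"
    unfolding scale_sum_right scale_scale
    by (rule sum_rotate)
  also have "\<dots> = (\<Sum>k<K. \<Sum>p\<le>m. scale (of_nat (m choose p) * (of_int (s + int p) gchoose k))
        (zres e (s + t + int p - int k) (Y a (int k) b) c))"
    by (simp add: zres_def scale_sum_right mult_ac algebra_simps)
  also have "\<dots> = (\<Sum>k<K. \<Sum>j\<le>k. scale (of_nat (m choose j) * (of_int s gchoose (k - j)))
        (zres (m - j + e) (s + t - int (k - j)) (Y a (int k) b) c))"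
  proof (rule sum.cong[OF refl])
    fix k
    have V: "of_int (s + int p) gchoose k = (\<Sum>j\<le>k. of_nat (p choose j) * ((of_int s :: complex) gchoose (k - j)))" for p
      using gbinomial_Vandermonde[of "of_nat p :: complex" "of_int s" k]
      by (simp add: atLeast0AtMost binomial_gbinomial add.commute)
    have e: "s + t - int (k - j) + int p - int j = s + t + int p - int k" if "j \<le> k" for j p
      using that by simp
    have "(\<Sum>p\<le>m. scale (of_nat (m choose p) * (of_int (s + int p) gchoose k)) (zres e (s + t + int p - int k) (Y a (int k) b) c))
      = (\<Sum>j\<le>k. scale (of_int s gchoose (k - j)) (\<Sum>p\<le>m. scale (of_nat (m choose p) * of_nat (p choose j))
          (zres e ((s + t - int (k - j)) + int p - int j) (Y a (int k) b) c)))"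
      unfolding V sum_distrib_left scale_sum_left scale_sum_right
      by (subst sum.swap) (intro sum.cong refl, simp only: e atMost_iff mult_ac scale_scale)
    then show "(\<Sum>p\<le>m. scale (of_nat (m choose p) * (of_int (s + int p) gchoose k)) (zres e (s + t + int p - int k) (Y a (int k) b) c))
      = (\<Sum>j\<le>k. scale (of_nat (m choose j) * (of_int s gchoose (k - j)))
        (zres (m - j + e) (s + t - int (k - j)) (Y a (int k) b) c))"
      unfolding zres_choose_choose by (simp add: mult.commute)
  qed
  finally show ?thesis .
qed

text \<open>Integration by parts: the residue of a derivative is zero, and the derivative of
  (1+z)^(e+1) z^t gives the two terms.\<close>

lemma zres_T: "zres (Suc e) t (D (Suc 0) a) b
  = - scale (of_nat (Suc e)) (zres e t a b) - scale (of_int t) (zres (Suc e) (t - 1) a b)"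
proof -
  have "zres (Suc e) t (D (Suc 0) a) b
      = (\<Sum>j\<le>Suc e. - scale (of_nat j * of_nat (Suc e choose j)) (Y a (t - 1 + int j) b)
          - scale (of_int t * of_nat (Suc e choose j)) (Y a (t - 1 + int j) b))"
    unfolding zres_def Y_T
    by (intro sum.cong refl) (simp add: algebra_simps flip: scale_left_distrib scale_minus_left)
  also have "\<dots> = - (\<Sum>j\<le>Suc e. scale (of_nat (j * (Suc e choose j))) (Y a (t - 1 + int j) b))
      - scale (of_int t) (zres (Suc e) (t - 1) a b)"
    by (simp only: sum_subtractf sum_negf zres_def scale_sum_right scale_scale of_nat_mult)
  also have "(\<Sum>j\<le>Suc e. scale (of_nat (j * (Suc e choose j))) (Y a (t - 1 + int j) b))
      = (\<Sum>j\<le>e. scale (of_nat (Suc j * (Suc e choose Suc j))) (Y a (t - 1 + int (Suc j)) b))"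
    unfolding sum.atMost_Suc_shift[of _ e] by simp
  also have "\<dots> = scale (of_nat (Suc e)) (zres e t a b)"
    unfolding Suc_times_binomial zres_def scale_sum_right by (simp only: of_nat_mult scale_scale) simp
  finally show ?thesis .
qed

end

text \<open>What Zhu's construction needs to know about the invariants, so that it can be carried
  out abstractly. Weights are natural numbers while mode indices are integers, hence the equation
  for \<open>int h\<close> and a separate axiom that products of negative weight vanish.\<close>

locale graded_subalgebra = vertex_algebra scale vac Y
  for scale :: "complex \<Rightarrow> 'v::ab_group_add \<Rightarrow> 'v" and vac Y +
  fixes W :: "'v set" and G :: "nat \<Rightarrow> 'v set"
  assumes W: "vertex_subalgebra W"
    and G_subspace: "subspace (G m)"
    and G_W: "a \<in> G m \<Longrightarrow> a \<in> W"
    and vac_G: "vac \<in> G 0"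
    and Y_G: "a \<in> G m \<Longrightarrow> b \<in> G l \<Longrightarrow> int h = int m + int l - k - 1 \<Longrightarrow> Y a k b \<in> G h"
    and Y_G_neg: "a \<in> G m \<Longrightarrow> b \<in> G l \<Longrightarrow> int m + int l - k - 1 < 0 \<Longrightarrow> Y a k b = 0"
    and W_decomp: "a \<in> W \<Longrightarrow> \<exists>A c. finite A \<and> (\<forall>m\<in>A. c m \<in> G m) \<and> a = sum c A"
    and G_indep: "finite A \<Longrightarrow> (\<And>m. m \<in> A \<Longrightarrow> c m \<in> G m) \<Longrightarrow> sum c A = 0 \<Longrightarrow> m \<in> A \<Longrightarrow> c m = 0"
begin

section \<open>Homogeneous components\<close>

lemma W_subspace: "subspace W" and vac_W: "vac \<in> W" and Y_W: "a \<in> W \<Longrightarrow> b \<in> W \<Longrightarrow> Y a k b \<in> W"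
  using W by (auto simp: vertex_subalgebra_def)

lemmas W_closed = subspace_0[OF W_subspace] subspace_add[OF W_subspace] subspace_diff[OF W_subspace]
  subspace_scale[OF W_subspace] subspace_neg[OF W_subspace] subspace_sum[OF W_subspace] vac_W Y_W

lemma zres_W: "a \<in> W \<Longrightarrow> b \<in> W \<Longrightarrow> zres e t a b \<in> W"
  unfolding zres_def by (intro W_closed)

text \<open>\<open>component\<close> is a definite description; independence of the weight spaces
  shows that any decomposition at hand is the one it denotes.\<close>

lemma component_eqI:
  assumes "finite A" "\<And>m. m \<notin> A \<Longrightarrow> c m = 0" "\<And>m. c m \<in> G m" "a = sum c A"
  shows "component G a = c"
  unfolding component_def
proof (rule the_equality)
  have sub: "{m. c m \<noteq> 0} \<subseteq> A" using assms(2) by auto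
  then have fin: "finite {m. c m \<noteq> 0}" using assms(1) finite_subset by blast
  have "sum c A = (\<Sum>m | c m \<noteq> 0. c m)"
    by (rule sum.mono_neutral_right) (use assms(1) sub in auto)
  then show "finite {m. c m \<noteq> 0} \<and> (\<forall>m. c m \<in> G m) \<and> a = (\<Sum>m | c m \<noteq> 0. c m)"
    using assms(3,4) fin by simp
  fix c' assume c': "finite {m. c' m \<noteq> 0} \<and> (\<forall>m. c' m \<in> G m) \<and> a = (\<Sum>m | c' m \<noteq> 0. c' m)"
  let ?B = "A \<union> {m. c' m \<noteq> 0}"
  have B: "finite ?B" using assms(1) c' by simp
  have "a = sum c' ?B"
    using c' by (simp, intro sum.mono_neutral_left) (use B in auto)
  moreover have "a = sum c ?B"
    unfolding assms(4) by (rule sum.mono_neutral_left) (use B assms(2) in auto)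
  ultimately have zero: "(\<Sum>m\<in>?B. c' m - c m) = 0"
    by (simp add: sum_subtractf)
  have "c' m - c m = 0" if "m \<in> ?B" for m
    by (rule G_indep[where c="\<lambda>m. c' m - c m", OF B _ zero that]) (use that c' assms(3) G_subspace in \<open>auto intro: subspace_diff\<close>)
  then have "c' m = c m" for m
    using assms(2)[of m] by (cases "m \<in> ?B") auto
  then show "c' = c" by blast
qed

lemma component_homogeneous: "a \<in> G m \<Longrightarrow> component G a = (\<lambda>k. if k = m then a else 0)"
  by (rule component_eqI[where A="{m}"]) (auto intro: subspace_0[OF G_subspace])

lemma component_decomp:
  assumes "a \<in> W"
  shows "finite {m. component G a m \<noteq> 0}" "component G a m \<in> G m" "a = (\<Sum>m | component G a m \<noteq> 0. component G a m)"
proof -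
  obtain A c where A: "finite A" "\<And>m. m \<in> A \<Longrightarrow> c m \<in> G m" "a = sum c A"
    using W_decomp[OF assms] by blast
  define d where "d = (\<lambda>m. if m \<in> A then c m else 0)"
  have eq: "component G a = d"
    by (rule component_eqI[OF A(1)]) (use A in \<open>auto simp: d_def subspace_0[OF G_subspace] intro!: sum.cong\<close>)
  have sub: "{m. d m \<noteq> 0} \<subseteq> A" by (auto simp: d_def)
  then show "finite {m. component G a m \<noteq> 0}" using A(1) eq finite_subset by simp
  show "component G a m \<in> G m" using A(2) by (simp add: eq d_def subspace_0[OF G_subspace])
  have "a = sum d A" using A by (simp add: d_def)
  also have "\<dots> = (\<Sum>m | d m \<noteq> 0. d m)"
    by (rule sum.mono_neutral_right) (use A(1) sub in auto)
  finally show "a = (\<Sum>m | component G a m \<noteq> 0. component G a m)"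
    unfolding eq .
qed

lemma component_add:
  assumes "a \<in> W" "b \<in> W"
  shows "component G (a + b) = (\<lambda>m. component G a m + component G b m)"
proof -
  let ?A = "{m. component G a m \<noteq> 0}" and ?B = "{m. component G b m \<noteq> 0}"
  have fin: "finite (?A \<union> ?B)" using component_decomp assms by simp
  have "sum (component G a) ?A = sum (component G a) (?A \<union> ?B)"
    by (rule sum.mono_neutral_left) (use fin in auto)
  moreover have "sum (component G b) ?B = sum (component G b) (?A \<union> ?B)"
    by (rule sum.mono_neutral_left) (use fin in auto)
  ultimately have "a + b = sum (component G a) (?A \<union> ?B) + sum (component G b) (?A \<union> ?B)"
    using component_decomp(3)[OF assms(1)] component_decomp(3)[OF assms(2)] by simp
  also have "\<dots> = (\<Sum>m\<in>?A \<union> ?B. component G a m + component G b m)"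
    by (rule sum.distrib[symmetric])
  finally show ?thesis
    by (intro component_eqI[OF fin]) (use assms in \<open>auto intro: component_decomp subspace_add[OF G_subspace]\<close>)
qed

lemma component_scale:
  assumes "a \<in> W"
  shows "component G (scale s a) = (\<lambda>m. scale s (component G a m))"
proof (rule component_eqI)
  show "finite {m. component G a m \<noteq> 0}" using assms component_decomp by simp
  show "scale s a = (\<Sum>m | component G a m \<noteq> 0. scale s (component G a m))"
    using component_decomp(3)[OF assms] by (simp flip: scale_sum_right)
qed (use assms in \<open>auto intro: component_decomp subspace_scale[OF G_subspace]\<close>)

lemma W_induct [consumes 1, case_names homogeneous add]:
  assumes "a \<in> W" "\<And>m x. x \<in> G m \<Longrightarrow> P x" "\<And>x y. x \<in> W \<Longrightarrow> y \<in> W \<Longrightarrow> P x \<Longrightarrow> P y \<Longrightarrow> P (x + y)"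
  shows "P a"
proof -
  obtain A c where A: "finite A" "\<forall>m\<in>A. c m \<in> G m" "a = sum c A"
    using W_decomp[OF assms(1)] by blast
  from A(1,2) have "P (sum c A)"
  proof (induction A rule: finite_induct)
    case empty
    show ?case using assms(2)[OF subspace_0[OF G_subspace]] by simp
  next
    case (insert m A)
    then have "c m \<in> W" "sum c A \<in> W" "P (c m)"
      by (auto intro: G_W W_closed assms(2))
    then show ?case
      using insert assms(3) by simp
  qed
  then show ?thesis using A by simp
qed

lemma sum_component_superset:
  assumes "\<And>m. F m 0 = 0" "finite A" "{m. component G a m \<noteq> 0} \<subseteq> A"
  shows "(\<Sum>m | component G a m \<noteq> 0. F m (component G a m)) = (\<Sum>m\<in>A. F m (component G a m))"
  by (rule sum.mono_neutral_left) (use assms in auto)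

lemma sum_component_homogeneous:
  assumes "\<And>m. F m 0 = 0" "a \<in> G m"
  shows "(\<Sum>k | component G a k \<noteq> 0. F k (component G a k)) = F m a"
  by (subst sum_component_superset[where A="{m}"])
    (use assms in \<open>auto simp: component_homogeneous split: if_splits\<close>)

text \<open>Stated for an arbitrary family of additive maps because both the star product and the
  zero mode operator have this shape.\<close>

lemma sum_component_add:
  fixes F :: "nat \<Rightarrow> 'v \<Rightarrow> 'v"
  assumes F: "\<And>m x y. F m (x + y) = F m x + F m y" and "a \<in> W" "b \<in> W"
  shows "(\<Sum>m | component G (a + b) m \<noteq> 0. F m (component G (a + b) m))
    = (\<Sum>m | component G a m \<noteq> 0. F m (component G a m)) + (\<Sum>m | component G b m \<noteq> 0. F m (component G b m))"
proof -
  let ?A = "{m. component G a m \<noteq> 0} \<union> {m. component G b m \<noteq> 0}"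
  have F0: "F m 0 = 0" for m using F[of m 0 0] by simp
  have fin: "finite ?A" using component_decomp assms by simp
  have "(\<Sum>m | component G (a + b) m \<noteq> 0. F m (component G (a + b) m)) = (\<Sum>m\<in>?A. F m (component G (a + b) m))"
    by (rule sum_component_superset[where F=F, OF F0 fin]) (auto simp: component_add assms)
  then show ?thesis
    unfolding component_add[OF assms(2,3)] F sum.distrib
    by (subst (1 2) sum_component_superset[where F=F, OF F0 fin]) auto
qed

lemma sum_component_scale:
  fixes F :: "nat \<Rightarrow> 'v \<Rightarrow> 'v"
  assumes F: "\<And>m s x. F m (scale s x) = scale s (F m x)" and "a \<in> W"
  shows "(\<Sum>m | component G (scale s a) m \<noteq> 0. F m (component G (scale s a) m))
    = scale s (\<Sum>m | component G a m \<noteq> 0. F m (component G a m))"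
proof -
  have F0: "F m 0 = 0" for m using F[of m 0 0] by simp
  have "(\<Sum>m | component G (scale s a) m \<noteq> 0. F m (component G (scale s a) m))
      = (\<Sum>m | component G a m \<noteq> 0. F m (component G (scale s a) m))"
    by (rule sum_component_superset[where F=F, OF F0]) (use component_decomp assms in \<open>auto simp: component_scale\<close>)
  then show ?thesis
    unfolding component_scale[OF assms(2)] F scale_sum_right .
qed

lemma zhu_star_homogeneous: "a \<in> G m \<Longrightarrow> zhu_star G a b = zres m (-1) a b"
  unfolding zhu_star_def zhu_residue_eq by (subst sum_component_homogeneous) auto

lemma zhu_star_add_left:
  "a \<in> W \<Longrightarrow> a' \<in> W \<Longrightarrow> zhu_star G (a + a') b = zhu_star G a b + zhu_star G a' b"
  unfolding zhu_star_def zhu_residue_eq by (rule sum_component_add) (simp_all add: zres_linear)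

lemma zhu_star_scale_left: "a \<in> W \<Longrightarrow> zhu_star G (scale s a) b = scale s (zhu_star G a b)"
  unfolding zhu_star_def zhu_residue_eq by (rule sum_component_scale) (simp_all add: zres_linear)

lemma zhu_star_diff_left:
  assumes "a \<in> W" "a' \<in> W"
  shows "zhu_star G (a - a') b = zhu_star G a b - zhu_star G a' b"
  using zhu_star_add_left[of a "scale (-1) a'" b] zhu_star_scale_left[of a' "-1" b] assms
  by (simp add: W_closed)

lemma zhu_star_zero_left [simp]: "zhu_star G 0 b = 0"
  using zhu_star_scale_left[of vac 0 b] vac_W by simp

lemma zhu_star_sum_left:
  "(\<And>x. x \<in> A \<Longrightarrow> f x \<in> W) \<Longrightarrow> zhu_star G (sum f A) b = (\<Sum>x\<in>A. zhu_star G (f x) b)"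
  by (induction A rule: infinite_finite_induct) (auto simp: zhu_star_add_left W_closed)

lemma zhu_star_right:
  "zhu_star G a (b + b') = zhu_star G a b + zhu_star G a b'"
  "zhu_star G a (b - b') = zhu_star G a b - zhu_star G a b'"
  "zhu_star G a (scale s b) = scale s (zhu_star G a b)"
  by (simp_all add: zhu_star_def zhu_residue_eq zres_linear sum.distrib sum_subtractf scale_sum_right)

lemma zhu_star_zero_right [simp]: "zhu_star G a 0 = 0"
  using zhu_star_right(3)[of a 0 0] by simp

lemma zhu_star_W: "a \<in> W \<Longrightarrow> b \<in> W \<Longrightarrow> zhu_star G a b \<in> W"
  unfolding zhu_star_def zhu_residue_eq
  by (intro W_closed zres_W) (use component_decomp G_W in blast)

section \<open>The subspace O(W) and Zhu's product modulo it\<close>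

abbreviation OW :: "'v set" where "OW \<equiv> zhu_O W G"

lemma O_subspace: "subspace OW"
  by (simp add: zhu_O_def)

lemmas O_closed = subspace_0[OF O_subspace] subspace_add[OF O_subspace] subspace_diff[OF O_subspace]
  subspace_scale[OF O_subspace] subspace_neg[OF O_subspace] subspace_sum[OF O_subspace]

lemma zhu_circ_homogeneous: "a \<in> G m \<Longrightarrow> zhu_circ G a b = zres m (-2) a b"
  unfolding zhu_circ_def zhu_residue_eq by (subst sum_component_homogeneous) auto

lemma zres_O: "a \<in> G m \<Longrightarrow> b \<in> W \<Longrightarrow> zres m (-2) a b \<in> OW"
  unfolding zhu_O_def zhu_circ_homogeneous[symmetric] by (intro span_base) (auto intro: G_W)

lemma O_subset:
  assumes "subspace S" "\<And>m a b. a \<in> G m \<Longrightarrow> b \<in> W \<Longrightarrow> zres m (-2) a b \<in> S"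
  shows "OW \<subseteq> S"
  unfolding zhu_O_def
proof (rule span_minimal[OF _ assms(1)])
  show "{zhu_circ G a b |a b. a \<in> W \<and> b \<in> W} \<subseteq> S"
    unfolding zhu_circ_def zhu_residue_eq
    by (auto intro!: subspace_sum[OF assms(1)] assms(2) intro: component_decomp)
qed

lemma O_W: "x \<in> OW \<Longrightarrow> x \<in> W"
  using O_subset[OF W_subspace] zres_W G_W by blast

lemma T_G: "a \<in> G m \<Longrightarrow> D (Suc 0) a \<in> G (Suc m)"
  unfolding D_def by (rule Y_G[OF _ vac_G]) auto

text \<open>Integration by parts with Ta, which has weight m + 1, expresses s + 2 times the residue
  with the next higher pole through residues already known to lie in O(W).\<close>

lemma zres_O_pole: "a \<in> G m \<Longrightarrow> b \<in> W \<Longrightarrow> zres m (- 2 - int s) a b \<in> OW"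
proof (induction s arbitrary: a m)
  case 0
  then show ?case using zres_O by simp
next
  case (Suc s)
  have 1: "zres (Suc m) (- 2 - int s) (D (Suc 0) a) b \<in> OW"
    by (rule Suc.IH) (use Suc.prems T_G in auto)
  have 2: "zres m (- 2 - int s) a b \<in> OW"
    by (rule Suc.IH) (use Suc.prems in auto)
  let ?x = "zres m (- 2 - int (Suc s)) a b"
  have "zres (Suc m) (- 2 - int s - 1) a b = ?x + zres m (- 2 - int s) a b"
  proof -
    have "- 2 - int s - 1 = - 2 - int (Suc s)" "- 2 - int (Suc s) + 1 = - 2 - int s" by auto
    then show ?thesis by (simp only: zres_Suc)
  qed
  with zres_T[of m "- 2 - int s" a b]
  have "scale (of_nat (s + 2)) ?x = zres (Suc m) (- 2 - int s) (D (Suc 0) a) b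
      + scale (of_nat (Suc m)) (zres m (- 2 - int s) a b) - scale (of_nat (s + 2)) (zres m (- 2 - int s) a b)"
    by (simp add: algebra_simps)
  also have "\<dots> \<in> OW" using 1 2 by (intro O_closed)
  finally have "scale (inverse (of_nat (s + 2))) (scale (of_nat (s + 2)) ?x) \<in> OW"
    by (rule O_closed)
  moreover have "(of_nat (s + 2) :: complex) \<noteq> 0"
    unfolding of_nat_eq_0_iff by simp
  ultimately show ?case by (simp del: of_nat_add)
qed

text \<open>Each additional factor 1 + z lowers the pole order by at most one, so r <= s leaves only
  poles of order at least 2.\<close>

lemma zres_O_general: "a \<in> G m \<Longrightarrow> b \<in> W \<Longrightarrow> r \<le> s \<Longrightarrow> zres (m + r) (- 2 - int s) a b \<in> OW"
proof (induction r arbitrary: s)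
  case 0
  then show ?case using zres_O_pole by simp
next
  case (Suc r)
  then obtain s' where s: "s = Suc s'" "r \<le> s'" by (cases s) auto
  have "zres (m + r) (- 2 - int s) a b + zres (m + r) (- 2 - int s') a b \<in> OW"
    using Suc s by (intro O_closed Suc.IH) auto
  then show ?case by (simp add: zres_Suc s)
qed

text \<open>The residue on the left is not homogeneous: each of its terms has its own weight
  \<open>h j\<close>, hence its own exponent in the outer product.\<close>

lemma zhu_star_zres:
  assumes "\<And>j. j \<le> m \<Longrightarrow> Y a (t + int j) b \<in> G (h j)"
  shows "zhu_star G (zres m t a b) c = (\<Sum>j\<le>m. scale (of_nat (m choose j)) (zres (h j) (-1) (Y a (t + int j) b) c))"
proof -
  have "zhu_star G (zres m t a b) c = (\<Sum>j\<le>m. zhu_star G (scale (of_nat (m choose j)) (Y a (t + int j) b)) c)"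
    unfolding zres_def by (rule zhu_star_sum_left) (use assms in \<open>auto intro: W_closed G_W\<close>)
  also have "\<dots> = (\<Sum>j\<le>m. scale (of_nat (m choose j)) (zres (h j) (-1) (Y a (t + int j) b) c))"
    by (intro sum.cong refl)
      (simp only: zhu_star_scale_left[OF G_W[OF assms]] zhu_star_homogeneous[OF assms] atMost_iff)
  finally show ?thesis .
qed

text \<open>With r = t = -1 the associator formula has (a * b) * c on its left. On the right the
  term i = 0 of the first sum is a * (b * c), and every other term has a pole of order at least 2 at
  the outer factor.\<close>

lemma zhu_star_assoc_homogeneous:
  assumes "a \<in> G m" "b \<in> G l" "c \<in> W"
  shows "zhu_star G (zhu_star G a b) c - zhu_star G a (zhu_star G b c) \<in> OW"
proof -
  have h: "Y a (-1 + int j) b \<in> G (m - j + l)" if "j \<le> m" for j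
    by (rule Y_G[OF assms(1,2)]) (use that in \<open>auto simp: of_nat_diff\<close>)
  have "zhu_star G (zhu_star G a b) c = (\<Sum>j\<le>m. scale (of_nat (m choose j)) (zres (m - j + l) (-1) (Y a (-1 + int j) b) c))"
    unfolding zhu_star_homogeneous[OF assms(1)] by (rule zhu_star_zres) (rule h)
  also obtain K where K: "\<dots> = (\<Sum>i<K. scale ((-1) ^ i * (of_int (-1) gchoose i))
        (zres m (-1 - int i) a (zres l (-1 + int i) b c) - scale (sg (-1)) (zres l (-1 + (-1) - int i) b (zres m (int i) a c))))"
      "K > 0"
    by (rule zres_associator)
  note K(1)
  also have "(\<Sum>i<K. scale ((-1) ^ i * (of_int (-1) gchoose i))
        (zres m (-1 - int i) a (zres l (-1 + int i) b c) - scale (sg (-1)) (zres l (-1 + (-1) - int i) b (zres m (int i) a c))))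
      = (\<Sum>i<K. zres m (-1 - int i) a (zres l (-1 + int i) b c) + zres l (-2 - int i) b (zres m (int i) a c))"
    by (intro sum.cong refl) (simp add: gchoose_minus_one flip: power_mult_distrib)
  also have "\<dots> = (\<Sum>i<K. zres m (-1 - int i) a (zres l (-1 + int i) b c))
      + (\<Sum>i<K. zres l (-2 - int i) b (zres m (int i) a c))"
    by (rule sum.distrib)
  also have "(\<Sum>i<K. zres m (-1 - int i) a (zres l (-1 + int i) b c))
      = zres m (-1) a (zres l (-1) b c) + (\<Sum>i<K - 1. zres m (-2 - int i) a (zres l (int i) b c))"
  proof -
    obtain K' where K': "K = Suc K'" using K(2) by (cases K) auto
    have "-1 - int (Suc i) = -2 - int i" "-1 + int (Suc i) = int i" for i by auto
    then show ?thesis unfolding K' sum.lessThan_Suc_shift by simp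
  qed
  finally have "zhu_star G (zhu_star G a b) c - zhu_star G a (zhu_star G b c)
      = (\<Sum>i<K - 1. zres m (-2 - int i) a (zres l (int i) b c)) + (\<Sum>i<K. zres l (-2 - int i) b (zres m (int i) a c))"
    by (simp add: zhu_star_homogeneous[OF assms(1)] zhu_star_homogeneous[OF assms(2)])
  also have "\<dots> \<in> OW"
    using assms by (intro O_closed zres_O_pole zres_W) (auto intro: G_W)
  finally show ?thesis .
qed

text \<open>The computation for associativity with r = -2. The products now have total weight larger
  by one, so b carries the exponent l + 1, and its pole of order at least 3 absorbs the
  surplus.\<close>

lemma zhu_star_O_left:
  assumes "x \<in> OW" "c \<in> W"
  shows "zhu_star G x c \<in> OW"
proof -
  let ?S = "{x \<in> W. zhu_star G x c \<in> OW}"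
  have "subspace ?S"
    by (rule subspaceI) (auto simp: zhu_star_add_left zhu_star_scale_left W_closed O_closed)
  then have "OW \<subseteq> ?S"
  proof (rule O_subset)
    fix m a b assume a: "a \<in> G m" and b: "b \<in> W"
    from b have "zhu_star G (zres m (-2) a b) c \<in> OW"
    proof (induction b rule: W_induct)
      case (homogeneous l b)
      have h: "Y a (-2 + int j) b \<in> G (m - j + Suc l)" if "j \<le> m" for j
        by (rule Y_G[OF a homogeneous]) (use that in \<open>auto simp: of_nat_diff\<close>)
      have "zhu_star G (zres m (-2) a b) c
          = (\<Sum>j\<le>m. scale (of_nat (m choose j)) (zres (m - j + Suc l) (-1) (Y a (-2 + int j) b) c))"
        by (rule zhu_star_zres) (rule h)
      also obtain K where K: "\<dots> = (\<Sum>i<K. scale ((-1) ^ i * (of_int (-2) gchoose i))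
        (zres m (-2 - int i) a (zres (Suc l) (-1 + int i) b c)
          - scale (sg (-2)) (zres (Suc l) (-1 + (-2) - int i) b (zres m (int i) a c))))"
        by (rule zres_associator)
      note K
      also have "\<dots> \<in> OW"
      proof (intro O_closed)
        fix i
        show "zres m (-2 - int i) a (zres (Suc l) (-1 + int i) b c) \<in> OW"
          using a homogeneous assms by (intro zres_O_pole zres_W) (auto intro: G_W)
        have "zres (l + 1) (-2 - int (Suc i)) b (zres m (int i) a c) \<in> OW"
          using a homogeneous assms by (intro zres_O_general zres_W) (auto intro: G_W)
        moreover have "- 2 - int (Suc i) = -1 + (-2) - int i" by simp
        ultimately show "zres (Suc l) (-1 + (-2) - int i) b (zres m (int i) a c) \<in> OW"
          by (simp only: Suc_eq_plus1)
      qed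
      finally show ?case .
    next
      case (add b b')
      then show ?case using a
        by (auto simp: zres_linear zhu_star_add_left zres_W G_W O_closed)
    qed
    then show "zres m (-2) a b \<in> ?S"
      using a b by (auto intro: zres_W G_W)
  qed
  then show ?thesis using assms by blast
qed

text \<open>Multiplying the circle product of b and c by a gives the circle product of b with a * c
  plus commutator terms. There a_k b has weight m + l - k - 1, which is 1 + k - j less than the
  exponent m - j + l, and the pole of order 3 + k - j compensates exactly.\<close>

lemma zhu_star_O_right:
  assumes "a \<in> W" "x \<in> OW"
  shows "zhu_star G a x \<in> OW"
  using assms(1)
proof (induction a rule: W_induct)
  case (homogeneous m a)
  let ?S = "{x. zhu_star G a x \<in> OW}"
  have "subspace ?S"
    by (rule subspaceI) (auto simp: zhu_star_right O_closed)
  then have "OW \<subseteq> ?S"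
  proof (rule O_subset)
    fix l b c assume b: "b \<in> G l" and c: "c \<in> W"
    obtain K where K: "\<And>k. k \<ge> K \<Longrightarrow> Y a (int k) b = 0" using commutator_bound by blast
    have "zhu_star G a (zres l (-2) b c) = zres l (-2) b (zres m (-1) a c)
      + (\<Sum>k<K. \<Sum>j\<le>k. scale (of_nat (m choose j) * (of_int (-1) gchoose (k - j)))
        (zres (m - j + l) (-1 + (-2) - int (k - j)) (Y a (int k) b) c))"
      using zres_commutator[OF K, where m=m and s="-1" and e=l and t="-2" and c=c]
      unfolding zhu_star_homogeneous[OF homogeneous] by (simp add: algebra_simps)
    also have "\<dots> \<in> OW"
    proof (intro O_closed(2,6) zres_O zres_W)
      fix k j :: nat assume j: "j \<in> {..k}"
      show "scale (of_nat (m choose j) * (of_int (-1) gchoose (k - j)))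
        (zres (m - j + l) (-1 + (-2) - int (k - j)) (Y a (int k) b) c) \<in> OW"
      proof (cases "j \<le> m \<and> int m + int l - int k - 1 \<ge> 0")
        case True
        have "Y a (int k) b \<in> G (m + l - k - 1)"
          by (rule Y_G[OF homogeneous b]) (use True in linarith)
        then have "zres ((m + l - k - 1) + Suc (k - j)) (- 2 - int (Suc (k - j))) (Y a (int k) b) c \<in> OW"
          using c by (intro zres_O_general) auto
        moreover have "(m + l - k - 1) + Suc (k - j) = m - j + l" using True j by auto
        moreover have "- 2 - int (Suc (k - j)) = -1 + (-2) - int (k - j)" by simp
        ultimately show ?thesis by (metis O_closed(4))
      next
        case False
        then show ?thesis
          using Y_G_neg[OF homogeneous b, of "int k"] by (auto simp: O_closed binomial_eq_0)
      qed
    qed (use b c homogeneous in \<open>auto intro: G_W\<close>)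
    finally show "zres l (-2) b c \<in> ?S" by simp
  qed
  then show ?case using assms(2) by blast
next
  case (add a b)
  then show ?case by (simp add: zhu_star_add_left O_closed)
qed

lemma zhu_star_assoc:
  assumes "a \<in> W" "b \<in> W" "c \<in> W"
  shows "zhu_star G (zhu_star G a b) c - zhu_star G a (zhu_star G b c) \<in> OW"
  using assms(1)
proof (induction a rule: W_induct)
  case (homogeneous m a)
  from assms(2) show ?case
  proof (induction b rule: W_induct)
    case (homogeneous l b)
    then show ?case using zhu_star_assoc_homogeneous \<open>a \<in> G m\<close> assms by blast
  next
    case (add x y)
    have e: "zhu_star G (zhu_star G a (x + y)) c - zhu_star G a (zhu_star G (x + y) c)
      = (zhu_star G (zhu_star G a x) c - zhu_star G a (zhu_star G x c))
        + (zhu_star G (zhu_star G a y) c - zhu_star G a (zhu_star G y c))"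
      using add homogeneous by (simp add: zhu_star_add_left zhu_star_right zhu_star_W G_W)
    show ?case unfolding e using add by (intro O_closed(2))
  qed
next
  case (add x y)
  have e: "zhu_star G (zhu_star G (x + y) b) c - zhu_star G (x + y) (zhu_star G b c)
      = (zhu_star G (zhu_star G x b) c - zhu_star G x (zhu_star G b c))
        + (zhu_star G (zhu_star G y b) c - zhu_star G y (zhu_star G b c))"
    using add assms by (simp add: zhu_star_add_left zhu_star_right zhu_star_W)
  show ?case unfolding e using add by (intro O_closed(2))
qed

lemma zres_vac: "zres l (-1) b vac = b"
proof -
  have "zres l (-1) b vac = (\<Sum>j\<in>{0}. scale (of_nat (l choose j)) (Y b (-1 + int j) vac))"
    unfolding zres_def by (rule sum.mono_neutral_right) (auto simp: creation)
  then show ?thesis by (simp add: creation)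
qed

lemma zhu_star_vac_right: "a \<in> W \<Longrightarrow> zhu_star G a vac = a"
  using component_decomp(3)[of a] by (simp add: zhu_star_def zhu_residue_eq zres_vac)

lemma zhu_star_vac_left: "zhu_star G vac a = a"
  by (simp add: zhu_star_homogeneous[OF vac_G] vacuum)

text \<open>Up to the common factor (1+z)^h, passing from i to i + 1 adds (1+z)^i z^(-2-i), whose
  residue lies in O(W). So powers of (1+z)/z do not change the class.\<close>

lemma zres_pole_vac_cong:
  assumes "x \<in> G h"
  shows "zres (h + i) (- 1 - int i) x vac - x \<in> OW"
proof (induction i)
  case 0
  then show ?case by (simp add: zres_vac O_closed)
next
  case (Suc i)
  have "zres (h + i) (- 2 - int i) x vac \<in> OW"
    by (rule zres_O_general) (use assms vac_W in auto)
  moreover have "- 1 - int (Suc i) = - 2 - int i" "- 2 - int i + 1 = - 1 - int i" by auto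
  ultimately show ?case
    using O_closed(2)[OF _ Suc] by (simp only: zres_Suc add_Suc_right add_diff_eq)
qed

text \<open>Both products are obtained by letting the residues of \<open>a(z)\<close> and \<open>b(z)\<close> act on the vacuum.\<close>

lemma zhu_commutator:
  assumes "a \<in> G m" "b \<in> G l" and K: "\<And>k. k \<ge> K \<Longrightarrow> Y a (int k) b = 0"
  shows "zhu_star G a b - zhu_star G b a - (\<Sum>k<K. scale (of_nat m - 1 gchoose k) (Y a (int k) b)) \<in> OW"
proof -
  \<comment> \<open>Coefficient of x^k in (1+x)^m (1+x)^(-1).\<close>
  have coeff: "(of_nat m - 1 gchoose k) = (\<Sum>j::nat\<le>k. of_nat (m choose j) * ((of_int (-1) :: complex) gchoose (k - j)))" for k :: nat
  proof -
    have s: "(-1::complex) ^ (k - j) = (-1) ^ k * (-1) ^ j" if "j \<le> k" for j :: nat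
      using that by (auto simp: minus_one_power_iff)
    have "(\<Sum>j\<le>k. of_nat (m choose j) * ((of_int (-1) :: complex) gchoose (k - j)))
      = (-1) ^ k * (\<Sum>j\<le>k. (of_nat m gchoose j) * (-1) ^ j)"
      unfolding sum_distrib_left
      by (intro sum.cong refl) (simp add: gchoose_minus_one s binomial_gbinomial)
    then show ?thesis
      unfolding gbinomial_sum_lower_neg by (simp flip: mult.assoc power_mult_distrib)
  qed
  have "zhu_star G a b - zhu_star G b a = zres m (-1) a (zres l (-1) b vac) - zres l (-1) b (zres m (-1) a vac)"
    by (simp only: zres_vac zhu_star_homogeneous[OF assms(1)] zhu_star_homogeneous[OF assms(2)])
  also have "\<dots> = (\<Sum>k<K. \<Sum>j\<le>k. scale (of_nat (m choose j) * (of_int (-1) gchoose (k - j)))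
        (zres (m - j + l) (-1 + (-1) - int (k - j)) (Y a (int k) b) vac))"
    by (rule zres_commutator) (rule K)
  finally have "zhu_star G a b - zhu_star G b a - (\<Sum>k<K. scale (of_nat m - 1 gchoose k) (Y a (int k) b))
      = (\<Sum>k<K. \<Sum>j\<le>k. scale (of_nat (m choose j) * (of_int (-1) gchoose (k - j)))
        (zres (m - j + l) (-1 + (-1) - int (k - j)) (Y a (int k) b) vac - Y a (int k) b))"
    by (simp only: coeff scale_sum_left scale_right_diff_distrib sum_subtractf)
  also have "\<dots> \<in> OW"
  proof (intro O_closed(6))
    fix k j :: nat assume j: "j \<in> {..k}"
    show "scale (of_nat (m choose j) * (of_int (-1) gchoose (k - j)))
        (zres (m - j + l) (-1 + (-1) - int (k - j)) (Y a (int k) b) vac - Y a (int k) b) \<in> OW"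
    proof (cases "j \<le> m \<and> int m + int l - int k - 1 \<ge> 0")
      case True
      have "Y a (int k) b \<in> G (m + l - k - 1)"
        by (rule Y_G[OF assms(1,2)]) (use True in linarith)
      from zres_pole_vac_cong[OF this, of "Suc (k - j)"]
      have "zres ((m + l - k - 1) + Suc (k - j)) (- 1 - int (Suc (k - j))) (Y a (int k) b) vac - Y a (int k) b \<in> OW" .
      moreover have "(m + l - k - 1) + Suc (k - j) = m - j + l" using True j by auto
      moreover have "- 1 - int (Suc (k - j)) = -1 + (-1) - int (k - j)" by simp
      ultimately show ?thesis by (metis O_closed(4))
    next
      case False
      then show ?thesis
        using Y_G_neg[OF assms(1,2), of "int k"] by (auto simp: O_closed binomial_eq_0)
    qed
  qed
  finally show ?thesis .
qed

lemma zhu_star_cong: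
  assumes "a \<in> W" "a' \<in> W" "b \<in> W" "b' \<in> W" "a - a' \<in> OW" "b - b' \<in> OW"
  shows "zhu_star G a b - zhu_star G a' b' \<in> OW"
proof -
  have "zhu_star G (a - a') b + zhu_star G a' (b - b') \<in> OW"
    using assms by (intro O_closed(2) zhu_star_O_left zhu_star_O_right)
  then show ?thesis using assms by (simp add: zhu_star_diff_left zhu_star_right)
qed

text \<open>Commutant argument modulo O(W): \<open>C x\<close> is a subspace closed under the
  product that contains \<open>vac\<close> and O(W). So the commutant of a generator is all of W; by
  symmetry the generators then lie in the commutant of every a, which is again all of W. The
  hypothesis \<open>gen\<close> only asks for closure under left multiplication by generators, the
  form that an induction on the degree can deliver.\<close>

lemma zhu_commute_of_generators:
  assumes S: "S \<subseteq> W"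
    and gen: "\<And>V. subspace V \<Longrightarrow> vac \<in> V \<Longrightarrow> OW \<subseteq> V \<Longrightarrow> (\<And>s v. s \<in> S \<Longrightarrow> v \<in> V \<Longrightarrow> v \<in> W \<Longrightarrow> zhu_star G s v \<in> V) \<Longrightarrow> W \<subseteq> V"
    and comm: "\<And>s t. s \<in> S \<Longrightarrow> t \<in> S \<Longrightarrow> zhu_star G s t - zhu_star G t s \<in> OW"
    and "a \<in> W" "b \<in> W"
  shows "zhu_star G a b - zhu_star G b a \<in> OW"
proof -
  define C where "C x = {v \<in> W. zhu_star G x v - zhu_star G v x \<in> OW}" for x
  have C_sub: "subspace (C x)" if "x \<in> W" for x
  proof (rule subspaceI)
    show "0 \<in> C x"
      using zhu_star_right(3)[of x 0 0] that by (simp add: C_def W_closed O_closed)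
    fix u v assume uv: "u \<in> C x" "v \<in> C x"
    have "zhu_star G x (u + v) - zhu_star G (u + v) x
        = (zhu_star G x u - zhu_star G u x) + (zhu_star G x v - zhu_star G v x)"
      using uv by (simp add: C_def zhu_star_add_left zhu_star_right)
    then show "u + v \<in> C x"
      using uv by (simp add: C_def W_closed O_closed)
  next
    fix s u assume u: "u \<in> C x"
    have "zhu_star G x (scale s u) - zhu_star G (scale s u) x = scale s (zhu_star G x u - zhu_star G u x)"
      using u by (simp add: C_def zhu_star_scale_left zhu_star_right scale_right_diff_distrib)
    then show "scale s u \<in> C x"
      using u by (simp add: C_def W_closed O_closed)
  qed
  have C_mult: "zhu_star G u v \<in> C x" if "u \<in> C x" "v \<in> C x" "x \<in> W" for x u v
  proof -
    let ?s = "zhu_star G"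
    have W': "u \<in> W" "v \<in> W" using that by (auto simp: C_def)
    \<comment> \<open>Telescope from x(uv) to (uv)x through (xu)v, (ux)v, u(xv) and u(vx);
      neighbours differ by an associator or by a commutator with x.\<close>
    have "?s x (?s u v) - ?s (?s u v) x = - (?s (?s x u) v - ?s x (?s u v)) + (?s (?s x u) v - ?s (?s u x) v)
        + (?s (?s u x) v - ?s u (?s x v)) + (?s u (?s x v) - ?s u (?s v x)) - (?s (?s u v) x - ?s u (?s v x))"
      by simp
    also have "\<dots> \<in> OW"
    proof (rule O_closed(3)[OF O_closed(2)[OF O_closed(2)[OF O_closed(2)[OF O_closed(5)]]]])
      show "?s (?s x u) v - ?s (?s u x) v \<in> OW" "?s u (?s x v) - ?s u (?s v x) \<in> OW"
        using that W' by (auto intro!: zhu_star_cong simp: C_def zhu_star_W O_closed)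
    qed (use that W' in \<open>auto intro: zhu_star_assoc\<close>)
    finally show ?thesis using W' by (simp add: C_def zhu_star_W)
  qed
  have C_O: "OW \<subseteq> C x" if "x \<in> W" for x
    using that by (auto simp: C_def O_W O_closed zhu_star_O_left zhu_star_O_right)
  have C_vac: "vac \<in> C x" if "x \<in> W" for x
    using that by (simp add: C_def vac_W zhu_star_vac_left zhu_star_vac_right O_closed)
  have C_sym: "u \<in> C x \<Longrightarrow> x \<in> W \<Longrightarrow> x \<in> C u" for u x
    using subspace_neg[OF O_subspace, of "zhu_star G x u - zhu_star G u x"] by (auto simp: C_def)
  have SC: "W \<subseteq> C s" if s: "s \<in> S" for s
  proof (rule gen)
    have W': "s \<in> W" using s S by blast
    show "subspace (C s)" "vac \<in> C s" "OW \<subseteq> C s" using W' C_sub C_vac C_O by auto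
    fix t v assume t: "t \<in> S" "v \<in> C s"
    have "t \<in> C s" using comm[OF s t(1)] t(1) S by (auto simp: C_def)
    then show "zhu_star G t v \<in> C s" using C_mult t W' by blast
  qed
  have "W \<subseteq> C a" if a: "a \<in> W" for a
  proof (rule gen)
    show "subspace (C a)" "vac \<in> C a" "OW \<subseteq> C a" using a C_sub C_vac C_O by auto
    fix t v assume t: "t \<in> S" "v \<in> C a"
    have "t \<in> C a" using SC[OF t(1)] a C_sym S t(1) by blast
    then show "zhu_star G t v \<in> C a" using C_mult t a by blast
  qed
  then show ?thesis using assms(4,5) by (auto simp: C_def)
qed

section \<open>The quotient as an algebra\<close>

lemma zhu_class_eq_iff: "zhu_class W G a = zhu_class W G b \<longleftrightarrow> a - b \<in> OW"
proof
  assume "zhu_class W G a = zhu_class W G b"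
  moreover have "a \<in> zhu_class W G a"
    unfolding zhu_class_def by (rule image_eqI[of _ _ 0]) (auto simp: O_closed)
  ultimately obtain x where "x \<in> OW" "a = b + x" by (auto simp: zhu_class_def)
  then show "a - b \<in> OW" by simp
next
  assume ab: "a - b \<in> OW"
  show "zhu_class W G a = zhu_class W G b"
  proof (intro equalityI subsetI)
    fix x assume "x \<in> zhu_class W G a"
    then obtain y where "y \<in> OW" "x = a + y" by (auto simp: zhu_class_def)
    then show "x \<in> zhu_class W G b"
      unfolding zhu_class_def by (intro image_eqI[of _ _ "(a - b) + y"]) (auto simp: O_closed ab)
  next
    fix x assume "x \<in> zhu_class W G b"
    then obtain y where "y \<in> OW" "x = b + y" by (auto simp: zhu_class_def)
    then show "x \<in> zhu_class W G a"
      unfolding zhu_class_def by (intro image_eqI[of _ _ "y - (a - b)"]) (auto simp: O_closed ab)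
  qed
qed

lemma zhu_class_memD: "x \<in> zhu_class W G a \<Longrightarrow> a \<in> W \<Longrightarrow> x \<in> W \<and> x - a \<in> OW"
  unfolding zhu_class_def by (auto simp: W_closed O_W)

lemma zhu_class_self: "a \<in> zhu_class W G a"
  unfolding zhu_class_def by (rule image_eqI[of _ _ 0]) (auto simp: O_closed)

lemma zhu_algebra_simps:
  "carrier (zhu_algebra W G) = zhu_class W G ` W"
  "one (zhu_algebra W G) = zhu_class W G vac"
  "zero (zhu_algebra W G) = zhu_class W G 0"
  by (simp_all add: zhu_algebra_def)

lemma UN2_constant:
  "a \<in> A \<Longrightarrow> b \<in> B \<Longrightarrow> (\<And>x y. x \<in> A \<Longrightarrow> y \<in> B \<Longrightarrow> f x y = c) \<Longrightarrow> (\<Union>x\<in>A. \<Union>y\<in>B. f x y) = c"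
  by blast

lemma zhu_algebra_mult:
  assumes "a \<in> W" "b \<in> W"
  shows "mult (zhu_algebra W G) (zhu_class W G a) (zhu_class W G b) = zhu_class W G (zhu_star G a b)"
proof -
  have "zhu_class W G (zhu_star G x y) = zhu_class W G (zhu_star G a b)"
    if "x \<in> zhu_class W G a" "y \<in> zhu_class W G b" for x y
    unfolding zhu_class_eq_iff using zhu_class_memD that assms by (intro zhu_star_cong) auto
  from UN2_constant[OF zhu_class_self zhu_class_self this] show ?thesis
    by (simp add: zhu_algebra_def)
qed

lemma zhu_algebra_add:
  assumes "a \<in> W" "b \<in> W"
  shows "add (zhu_algebra W G) (zhu_class W G a) (zhu_class W G b) = zhu_class W G (a + b)"
proof -
  have "zhu_class W G (x + y) = zhu_class W G (a + b)"
    if "x \<in> zhu_class W G a" "y \<in> zhu_class W G b" for x y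
  proof -
    have "(x - a) + (y - b) \<in> OW" using zhu_class_memD that assms by (intro O_closed(2)) auto
    then show ?thesis unfolding zhu_class_eq_iff by (simp add: algebra_simps)
  qed
  from UN2_constant[OF zhu_class_self zhu_class_self this] show ?thesis
    by (simp add: zhu_algebra_def)
qed

lemma zhu_algebra_smult:
  assumes "a \<in> W"
  shows "module.smult (zhu_algebra W G) s (zhu_class W G a) = zhu_class W G (scale s a)"
proof -
  have "zhu_class W G (scale s x) = zhu_class W G (scale s a)" if "x \<in> zhu_class W G a" for x
    unfolding zhu_class_eq_iff scale_right_diff_distrib[symmetric]
    using zhu_class_memD that assms by (intro O_closed(4)) auto
  from UN_constant_eq[OF zhu_class_self ballI[OF this]] show ?thesis
    by (simp add: zhu_algebra_def)
qed

text \<open>The predicate \<open>algebra\<close> of HOL-Algebra includes \<open>cring\<close>, so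
  commutativity is part of the conclusion and has to enter as a premise; the other axioms hold for
  every graded subalgebra.\<close>

theorem zhu_algebra_is_algebra:
  assumes comm: "\<And>a b. a \<in> W \<Longrightarrow> b \<in> W \<Longrightarrow> zhu_star G a b - zhu_star G b a \<in> OW"
  shows "Module.algebra complex_ring (zhu_algebra W G)"
proof -
  note simps = zhu_algebra_simps zhu_algebra_mult zhu_algebra_add zhu_algebra_smult W_closed zhu_star_W
  let ?R = "zhu_algebra W G"
  have ab: "abelian_group ?R"
  proof (rule abelian_groupI)
    fix x assume "x \<in> carrier ?R"
    then obtain a where a: "a \<in> W" "x = zhu_class W G a" by (auto simp: simps)
    have "zhu_class W G (- a) \<in> carrier ?R" "zhu_class W G (- a) \<oplus>\<^bsub>?R\<^esub> x = \<zero>\<^bsub>?R\<^esub>"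
      using a by (auto simp: simps)
    then show "\<exists>y\<in>carrier ?R. y \<oplus>\<^bsub>?R\<^esub> x = \<zero>\<^bsub>?R\<^esub>" by blast
  qed (auto simp: simps add_ac)
  have complex: "cring complex_ring"
  proof (rule cringI)
    show "abelian_group complex_ring"
      by (rule abelian_groupI) (auto simp: complex_ring_def add_ac intro: exI[of _ "- x" for x])
    show "Group.comm_monoid complex_ring"
      by (rule comm_monoidI) (auto simp: complex_ring_def)
  qed (auto simp: complex_ring_def ring_distribs)
  have ring: "cring ?R"
  proof (rule cringI[OF ab])
    show "Group.comm_monoid ?R"
    proof (rule comm_monoidI)
      fix x y z assume "x \<in> carrier ?R" "y \<in> carrier ?R" "z \<in> carrier ?R"
      then show "x \<otimes>\<^bsub>?R\<^esub> y \<otimes>\<^bsub>?R\<^esub> z = x \<otimes>\<^bsub>?R\<^esub> (y \<otimes>\<^bsub>?R\<^esub> z)"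
        unfolding zhu_algebra_simps by (elim imageE) (simp add: simps zhu_class_eq_iff zhu_star_assoc)
    next
      fix x y assume "x \<in> carrier ?R" "y \<in> carrier ?R"
      then show "x \<otimes>\<^bsub>?R\<^esub> y = y \<otimes>\<^bsub>?R\<^esub> x"
        unfolding zhu_algebra_simps by (elim imageE) (simp add: simps zhu_class_eq_iff comm)
    qed (auto simp: simps zhu_star_vac_left)
    fix x y z assume "x \<in> carrier ?R" "y \<in> carrier ?R" "z \<in> carrier ?R"
    then show "(x \<oplus>\<^bsub>?R\<^esub> y) \<otimes>\<^bsub>?R\<^esub> z = x \<otimes>\<^bsub>?R\<^esub> z \<oplus>\<^bsub>?R\<^esub> y \<otimes>\<^bsub>?R\<^esub> z"
      by (auto simp: simps zhu_star_add_left)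
  qed
  have "module complex_ring ?R"
    by (rule moduleI[OF complex ab])
      (auto simp: simps complex_ring_def scale_left_distrib scale_right_distrib)
  moreover have "algebra_axioms complex_ring ?R"
    by unfold_locales (auto simp: simps zhu_star_scale_left)
  ultimately show ?thesis
    using ring by (simp add: algebra_def)
qed

text \<open>Zhu's operator o(v), the weight-preserving mode of v, extended to inhomogeneous elements
  through their components.\<close>

definition zero_mode_op :: "'v \<Rightarrow> 'v \<Rightarrow> 'v" where
  "zero_mode_op v u = (\<Sum>h | component G v h \<noteq> 0. Y (component G v h) (int h - 1) u)"

lemma zero_mode_op_homogeneous: "v \<in> G h \<Longrightarrow> zero_mode_op v u = Y v (int h - 1) u"
  unfolding zero_mode_op_def by (subst sum_component_homogeneous) auto

lemma zero_mode_op_add: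
  "v \<in> W \<Longrightarrow> v' \<in> W \<Longrightarrow> zero_mode_op (v + v') u = zero_mode_op v u + zero_mode_op v' u"
  unfolding zero_mode_op_def by (rule sum_component_add) (simp_all add: Y_linear)

lemma zero_mode_op_scale: "v \<in> W \<Longrightarrow> zero_mode_op (scale s v) u = scale s (zero_mode_op v u)"
  unfolding zero_mode_op_def by (rule sum_component_scale) (simp_all add: Y_linear)

lemma zero_mode_op_zero [simp]: "zero_mode_op 0 u = 0"
  using zero_mode_op_scale[of vac 0 u] vac_W by simp

lemma zero_mode_op_sum:
  "(\<And>x. x \<in> A \<Longrightarrow> f x \<in> W) \<Longrightarrow> zero_mode_op (sum f A) u = (\<Sum>x\<in>A. zero_mode_op (f x) u)"
  by (induction A rule: infinite_finite_induct) (auto simp: zero_mode_op_add W_closed)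

text \<open>This element is the circle product of a with the vacuum: by the creation axiom only the
  modes -2 and -1 survive.\<close>

lemma T_plus_weight_O: "a \<in> G h \<Longrightarrow> D (Suc 0) a + scale (of_nat h) a \<in> OW"
proof -
  assume a: "a \<in> G h"
  have "zres h (-2) a vac = D (Suc 0) a + scale (of_nat h) a"
  proof (cases h)
    case 0
    then show ?thesis by (simp add: D_def)
  next
    case (Suc h')
    have "zres h (-2) a vac = (\<Sum>j\<in>{0,1}. scale (of_nat (h choose j)) (Y a (-2 + int j) vac))"
      unfolding zres_def by (rule sum.mono_neutral_right) (auto simp: creation Suc)
    then show ?thesis by (simp add: D_def creation)
  qed
  then show ?thesis using zres_O[OF a vac_W] by simp
qed

text \<open>Ta has weight h + 1, and its mode of index h is -h a_(h-1). This works on every vector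
  u.\<close>

lemma zero_mode_op_T: "a \<in> G h \<Longrightarrow> zero_mode_op (D (Suc 0) a + scale (of_nat h) a) u = 0"
  using T_G[of a h]
  by (simp add: zero_mode_op_add zero_mode_op_scale G_W W_closed zero_mode_op_homogeneous Y_T)

text \<open>The bracket has the coefficients of the commutator formula at p = m - 1, and the index
  occurring there is the zero mode index of a_k b.\<close>

lemma zero_mode_op_bracket:
  assumes "a \<in> G m" "b \<in> G l" "m > 0" and K: "\<And>k. k \<ge> K \<Longrightarrow> Y a (int k) b = 0"
  shows "zero_mode_op (\<Sum>k<K. scale (of_nat m - 1 gchoose k) (Y a (int k) b)) u
    = Y a (int m - 1) (Y b (int l - 1) u) - Y b (int l - 1) (Y a (int m - 1) u)"
proof -
  have W': "Y a (int k) b \<in> W" for k using assms by (intro W_closed G_W)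
  have "zero_mode_op (\<Sum>k<K. scale (of_nat m - 1 gchoose k) (Y a (int k) b)) u
      = (\<Sum>k<K. scale (of_nat m - 1 gchoose k) (zero_mode_op (Y a (int k) b) u))"
    by (simp add: zero_mode_op_sum zero_mode_op_scale W' W_closed)
  also have "\<dots> = (\<Sum>k<K. scale (of_int (int m - 1) gchoose k) (Y (Y a (int k) b) (int m - 1 + (int l - 1) - int k) u))"
  proof (intro sum.cong refl arg_cong2[of _ _ _ _ scale])
    fix k
    show "zero_mode_op (Y a (int k) b) u = Y (Y a (int k) b) (int m - 1 + (int l - 1) - int k) u"
    proof (cases "int m + int l - int k - 1 < 0")
      case True
      then show ?thesis using Y_G_neg[OF assms(1,2)] by simp
    next
      case False
      define h where "h = nat (int m + int l - int k - 1)"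
      have h: "int h = int m + int l - int k - 1" using False by (simp add: h_def)
      have "zero_mode_op (Y a (int k) b) u = Y (Y a (int k) b) (int h - 1) u"
        by (rule zero_mode_op_homogeneous[OF Y_G[OF assms(1,2) h]])
      moreover have "int h - 1 = int m - 1 + (int l - 1) - int k" using h by simp
      ultimately show ?thesis by simp
    qed
  qed simp
  also have "\<dots> = Y a (int m - 1) (Y b (int l - 1) u) - Y b (int l - 1) (Y a (int m - 1) u)"
    by (rule commutator_formula[symmetric]) (rule K)
  finally show ?thesis .
qed

end

section \<open>The Fock space\<close>

context heisenberg_vertex_algebra
begin

text \<open>Abstracted from \<open>\<alpha>\<close> because the rotated generators satisfy the same
  relations; automorphisms arise from comparing two such families.\<close>

definition heisenberg_family :: "(nat \<Rightarrow> 'v) \<Rightarrow> bool" where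
  "heisenberg_family \<beta> \<longleftrightarrow> (\<forall>i<n. \<forall>j<n. \<forall>k\<ge>0. Y (\<beta> i) k (\<beta> j) = (if i = j \<and> k = 1 then vac else 0))"

lemma heisenberg_family_\<alpha>: "heisenberg_family \<alpha>"
  using heisenberg_ope by (auto simp: heisenberg_family_def)

lemma heisenberg_commutator:
  assumes "heisenberg_family \<beta>" "i < n" "j < n"
  shows "Y (\<beta> i) p (Y (\<beta> j) q c) = Y (\<beta> j) q (Y (\<beta> i) p c) + (if i = j \<and> p + q = 0 then scale (of_int p) c else 0)"
proof -
  have ope: "Y (\<beta> i) k (\<beta> j) = (if i = j \<and> k = 1 then vac else 0)" if "k \<ge> 0" for k
    using assms that by (auto simp: heisenberg_family_def)
  have "Y (\<beta> i) p (Y (\<beta> j) q c) - Y (\<beta> j) q (Y (\<beta> i) p c)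
      = (\<Sum>k<2. scale (of_int p gchoose k) (Y (Y (\<beta> i) (int k) (\<beta> j)) (p + q - int k) c))"
    by (rule commutator_formula) (auto simp: ope)
  also have "\<dots> = (if i = j \<and> p + q = 0 then scale (of_int p) c else 0)"
    by (auto simp: ope numeral_2_eq_2 vacuum)
  finally show ?thesis by (simp add: algebra_simps)
qed

text \<open>The letter \<open>(i, k)\<close> stands for the creation mode \<open>-k-1\<close> of the \<open>i\<close>-th generator.\<close>

definition cr :: "(nat \<Rightarrow> 'v) \<Rightarrow> nat \<times> nat \<Rightarrow> 'v \<Rightarrow> 'v" where
  "cr \<beta> x v = (if fst x < n then Y (\<beta> (fst x)) (- int (snd x) - 1) v else v)"

definition an :: "(nat \<Rightarrow> 'v) \<Rightarrow> nat \<times> nat \<Rightarrow> 'v \<Rightarrow> 'v" where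
  "an \<beta> x v = Y (\<beta> (fst x)) (int (snd x) + 1) v"

definition words :: "(nat \<times> nat) multiset set" where
  "words = {M. \<forall>x\<in>#M. fst x < n}"

definition mono :: "(nat \<Rightarrow> 'v) \<Rightarrow> (nat \<times> nat) multiset \<Rightarrow> 'v" where
  "mono \<beta> M = fold_mset (cr \<beta>) vac M"

lemma cr_linear: "cr \<beta> x (u + v) = cr \<beta> x u + cr \<beta> x v" "cr \<beta> x (u - v) = cr \<beta> x u - cr \<beta> x v"
  "cr \<beta> x (scale s v) = scale s (cr \<beta> x v)" "cr \<beta> x 0 = 0"
  by (simp_all add: cr_def Y_linear)

lemma an_linear: "an \<beta> x (u + v) = an \<beta> x u + an \<beta> x v" "an \<beta> x (u - v) = an \<beta> x u - an \<beta> x v"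
  "an \<beta> x (scale s v) = scale s (an \<beta> x v)" "an \<beta> x 0 = 0"
  by (simp_all add: an_def Y_linear)

lemma cr_sum: "fst x < n \<Longrightarrow> cr \<beta> x (sum f A) = (\<Sum>a\<in>A. cr \<beta> x (f a))"
  by (simp add: cr_def Y_linear)

lemma an_sum: "an \<beta> x (sum f A) = (\<Sum>a\<in>A. an \<beta> x (f a))"
  by (simp add: an_def Y_linear)

lemma words_simps [simp]: "{#} \<in> words" "add_mset x M \<in> words \<longleftrightarrow> fst x < n \<and> M \<in> words"
  by (auto simp: words_def)

lemma words_diff: "M \<in> words \<Longrightarrow> M - N \<in> words"
  by (auto simp: words_def dest: in_diffD)

text \<open>Letters with first index at least n act as the identity by definition, so that
  commutation holds for all letters, as \<open>fold_mset\<close> requires.\<close>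

lemma cr_cr:
  assumes "heisenberg_family \<beta>"
  shows "cr \<beta> x (cr \<beta> y v) = cr \<beta> y (cr \<beta> x v)"
  using heisenberg_commutator[OF assms, of "fst x" "fst y" "- int (snd x) - 1" "- int (snd y) - 1" v]
  by (auto simp: cr_def)

lemma an_cr:
  assumes "heisenberg_family \<beta>" "fst x < n" "fst y < n"
  shows "an \<beta> x (cr \<beta> y v) = cr \<beta> y (an \<beta> x v) + (if x = y then scale (of_nat (Suc (snd x))) v else 0)"
  using heisenberg_commutator[OF assms, of "int (snd x) + 1" "- int (snd y) - 1" v] assms
  by (auto simp: cr_def an_def prod_eq_iff add.commute)

section \<open>Monomials span the Fock space and are independent\<close>

lemma mono_empty [simp]: "mono \<beta> {#} = vac"
  by (simp add: mono_def)

lemma mono_add_mset: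
  assumes "heisenberg_family \<beta>"
  shows "mono \<beta> (add_mset x M) = cr \<beta> x (mono \<beta> M)"
proof -
  interpret comp_fun_commute "cr \<beta>"
    by unfold_locales (auto simp: fun_eq_iff cr_cr[OF assms])
  show ?thesis by (simp add: mono_def)
qed

text \<open>On polynomials in the letters, annihilation by (i, k) is k + 1 times the partial
  derivative by that letter; the multiplicity is the exponent.\<close>

lemma an_mono:
  assumes "heisenberg_family \<beta>" "fst x < n" "M \<in> words"
  shows "an \<beta> x (mono \<beta> M) = scale (of_nat (Suc (snd x) * count M x)) (mono \<beta> (M - {#x#}))"
  using assms(3)
proof (induction M)
  case empty
  then show ?case by (simp add: an_def creation)
next
  case (add y M)
  have y: "fst y < n" and IH: "an \<beta> x (mono \<beta> M) = scale (of_nat (Suc (snd x) * count M x)) (mono \<beta> (M - {#x#}))"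
    using add by auto
  have "an \<beta> x (mono \<beta> (add_mset y M)) = scale (of_nat (Suc (snd x) * count M x)) (mono \<beta> (add_mset y (M - {#x#})))
      + (if x = y then scale (of_nat (Suc (snd x))) (mono \<beta> M) else 0)"
    by (simp only: mono_add_mset[OF assms(1)] an_cr[OF assms(1,2) y] IH cr_linear)
  also have "\<dots> = scale (of_nat (Suc (snd x) * count (add_mset y M) x)) (mono \<beta> (add_mset y M - {#x#}))"
  proof (cases "x = y")
    case True
    have "scale (of_nat (Suc (snd x) * count M x)) (mono \<beta> (add_mset y (M - {#x#})))
        = scale (of_nat (Suc (snd x) * count M x)) (mono \<beta> M)"
      using True by (cases "x \<in># M") (auto simp: not_in_iff)
    then show ?thesis
      using True by (simp only: if_True flip: scale_left_distrib of_nat_add) (simp add: algebra_simps)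
  next
    case False
    then show ?thesis
      by (cases "x \<in># M") (auto simp: not_in_iff add_mset_diff_bothsides)
  qed
  finally show ?case .
qed

lemma zero_mode_mono:
  assumes "heisenberg_family \<beta>" "i < n" "M \<in> words"
  shows "Y (\<beta> i) 0 (mono \<beta> M) = 0"
  using assms(3)
proof (induction M)
  case empty
  then show ?case by (simp add: creation)
next
  case (add y M)
  then show ?case
    using heisenberg_commutator[OF assms(1,2), of "fst y" 0 "- int (snd y) - 1" "mono \<beta> M"]
    by (simp add: mono_add_mset[OF assms(1)] cr_def)
qed

lemma mode_cases:
  obtains k where "p = - int k - 1" | "p = 0" | k where "p = int k + 1"
proof -
  consider "p < 0" | "p = 0" | "p > 0" by linarith
  then show thesis
  proof cases
    case 1
    then have "p = - int (nat (- p - 1)) - 1" by simp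
    then show thesis by (rule that(1))
  next
    case 2
    then show thesis by (rule that(2))
  next
    case 3
    then have "p = int (nat (p - 1)) + 1" by simp
    then show thesis by (rule that(3))
  qed
qed

lemma mode_mono_in_span:
  assumes "i < n" "M \<in> words"
  shows "Y (\<alpha> i) p (mono \<alpha> M) \<in> span (mono \<alpha> ` words)"
proof (cases p rule: mode_cases)
  case (1 k)
  have "Y (\<alpha> i) p (mono \<alpha> M) = mono \<alpha> (add_mset (i, k) M)"
    using assms 1 by (simp add: mono_add_mset[OF heisenberg_family_\<alpha>] cr_def)
  also have "\<dots> \<in> span (mono \<alpha> ` words)"
    using assms by (intro span_base imageI) simp
  finally show ?thesis .
next
  case 2
  then show ?thesis using assms zero_mode_mono[OF heisenberg_family_\<alpha>] by (simp add: span_zero)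
next
  case (3 k)
  have "Y (\<alpha> i) p (mono \<alpha> M) = an \<alpha> (i, k) (mono \<alpha> M)"
    using 3 by (simp add: an_def)
  then show ?thesis
    using assms an_mono[OF heisenberg_family_\<alpha>, of "(i, k)" M]
    by (simp add: span_scale span_base words_diff)
qed

text \<open>The span is closed under all modes of the generators, hence, by the associator formula,
  under all modes of monomials. So it is a vertex subalgebra containing the generators.\<close>

lemma mono_span: "span (mono \<alpha> ` words) = UNIV"
proof -
  let ?S = "span (mono \<alpha> ` words)"
  have mode: "Y (\<alpha> i) p v \<in> ?S" if "i < n" "v \<in> ?S" for i p v
    using that(2)
  proof (induction v rule: span_induct_alt)
    case base
    then show ?case by (simp add: span_zero)
  next
    case (step c x y)
    then show ?case using mode_mono_in_span[OF that(1)]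
      by (auto simp: Y_linear intro!: span_add span_scale)
  qed
  have mono_closed: "Y (mono \<alpha> M) k b \<in> ?S" if "M \<in> words" "b \<in> ?S" for M k b
    using that
  proof (induction M arbitrary: k b)
    case empty
    then show ?case by (auto simp: vacuum span_zero)
  next
    case (add x M)
    then have x: "fst x < n" and IH: "\<And>k b. b \<in> ?S \<Longrightarrow> Y (mono \<alpha> M) k b \<in> ?S" by auto
    obtain K where "\<And>j. j \<ge> K \<Longrightarrow> Y (mono \<alpha> M) (k + int j) b = 0" "\<And>j. j \<ge> K \<Longrightarrow> Y (\<alpha> (fst x)) (int j) b = 0"
      using associator_bound by blast
    note assoc = associator_formula[OF this, where r="- int (snd x) - 1"]
    show ?case
      using x IH mode add.prems unfolding mono_add_mset[OF heisenberg_family_\<alpha>] cr_def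
      by (auto simp: assoc intro!: span_sum span_scale span_diff)
  qed
  have "Y a k b \<in> ?S" if "a \<in> ?S" "b \<in> ?S" for a k b
    using that(1)
  proof (induction a rule: span_induct_alt)
    case base
    then show ?case by (simp add: span_zero)
  next
    case (step c x y)
    then show ?case using that(2) mono_closed
      by (auto simp: Y_linear intro!: span_add span_scale)
  qed
  moreover have "vac \<in> ?S"
    by (rule span_base) (metis mono_empty words_simps(1) image_eqI)
  ultimately have "vertex_subalgebra ?S"
    by (simp add: vertex_subalgebra_def)
  moreover have "\<alpha> ` {..<n} \<subseteq> ?S"
  proof
    fix v assume "v \<in> \<alpha> ` {..<n}"
    then obtain i where "i < n" "v = \<alpha> i" by auto
    moreover have "Y (\<alpha> i) (-1) vac \<in> ?S" using mode[OF \<open>i < n\<close> \<open>vac \<in> ?S\<close>] .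
    ultimately show "v \<in> ?S" by (simp add: creation)
  qed
  ultimately show ?thesis
    using generated by (auto simp: generated_by_def)
qed

lemma fock_induct [case_names mono add]:
  assumes "\<And>s M. M \<in> words \<Longrightarrow> P (scale s (mono \<alpha> M))" "\<And>u v. P u \<Longrightarrow> P v \<Longrightarrow> P (u + v)"
  shows "P v"
proof -
  have "v \<in> span (mono \<alpha> ` words)" by (simp add: mono_span)
  then show ?thesis
  proof (induction v rule: span_induct_alt)
    case base
    show ?case using assms(1)[of "{#}" 0] by simp
  next
    case (step c x y)
    then show ?case using assms by auto
  qed
qed

lemma fock_cr_induct [case_names vac add scale cr]:
  assumes "P vac" "\<And>u v. P u \<Longrightarrow> P v \<Longrightarrow> P (u + v)" "\<And>s v. P v \<Longrightarrow> P (scale s v)"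
    "\<And>x v. fst x < n \<Longrightarrow> P v \<Longrightarrow> P (cr \<alpha> x v)"
  shows "P v"
proof (induction v rule: fock_induct)
  case (mono s M)
  then have "P (mono \<alpha> M)"
    by (induction M) (auto simp: mono_add_mset[OF heisenberg_family_\<alpha>] assms)
  then show ?case by (rule assms)
qed (rule assms)

primrec ans :: "(nat \<times> nat) list \<Rightarrow> 'v \<Rightarrow> 'v" where
  "ans [] v = v"
| "ans (x # xs) v = ans xs (an \<alpha> x v)"

lemma ans_linear: "ans xs (sum f A) = (\<Sum>a\<in>A. ans xs (f a))" "ans xs (scale s v) = scale s (ans xs v)"
  "ans xs 0 = 0"
  by (induction xs arbitrary: f v) (auto simp: an_linear an_sum)

text \<open>Differentiating by all letters of \<open>xs\<close> isolates one coefficient, as long as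
  no longer words are present.\<close>

lemma ans_mono:
  assumes "mset xs \<in> words"
  shows "\<exists>\<kappa>. \<kappa> \<noteq> 0 \<and> (\<forall>M\<in>words. size M \<le> length xs \<longrightarrow>
    ans xs (mono \<alpha> M) = (if M = mset xs then scale \<kappa> vac else 0))"
  using assms
proof (induction xs)
  case Nil
  then show ?case by (intro exI[of _ 1]) auto
next
  case (Cons x xs)
  then obtain \<kappa> where \<kappa>: "\<kappa> \<noteq> 0" "\<And>M. M \<in> words \<Longrightarrow> size M \<le> length xs \<Longrightarrow>
    ans xs (mono \<alpha> M) = (if M = mset xs then scale \<kappa> vac else 0)" by auto
  have x: "fst x < n" using Cons.prems by simp
  let ?c = "of_nat (Suc (snd x) * count (mset (x # xs)) x) :: complex"
  have "?c \<noteq> 0" unfolding of_nat_eq_0_iff by simp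
  moreover have "ans (x # xs) (mono \<alpha> M) = (if M = mset (x # xs) then scale (?c * \<kappa>) vac else 0)"
    if M: "M \<in> words" "size M \<le> length (x # xs)" for M
  proof (cases "x \<in># M")
    case False
    then have "M \<noteq> mset (x # xs)" by auto
    then show ?thesis
      using False an_mono[OF heisenberg_family_\<alpha> x M(1)] by (simp add: not_in_iff ans_linear)
  next
    case True
    then obtain N where N: "M = add_mset x N" by (metis insert_DiffM)
    have "ans xs (mono \<alpha> N) = (if N = mset xs then scale \<kappa> vac else 0)"
      by (rule \<kappa>) (use M N in auto)
    then show ?thesis
      unfolding ans.simps an_mono[OF heisenberg_family_\<alpha> x M(1)] ans_linear
      by (simp add: N)
  qed
  ultimately show ?case
    using \<kappa>(1) by (intro exI[of _ "?c * \<kappa>"]) simp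
qed

text \<open>Take a word of maximal size among those with nonzero coefficient in the relation:
  annihilating its letters kills all other terms and leaves a nonzero multiple of the
  vacuum.\<close>

lemma mono_independent:
  assumes "finite F" "F \<subseteq> words" "(\<Sum>M\<in>F. scale (c M) (mono \<alpha> M)) = 0" "M \<in> F"
  shows "c M = 0"
proof (rule ccontr)
  assume "c M \<noteq> 0"
  let ?F = "{M \<in> F. c M \<noteq> 0}"
  have "finite ?F" "?F \<noteq> {}" using assms \<open>c M \<noteq> 0\<close> by auto
  then have "Max (size ` ?F) \<in> size ` ?F" by (intro Max_in) auto
  then obtain M0 where M0: "M0 \<in> ?F" "size M0 = Max (size ` ?F)" by (metis (no_types, lifting) imageE)
  have max: "size N \<le> size M0" if "N \<in> ?F" for N
    using that \<open>finite ?F\<close> M0(2) by simp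
  obtain xs where xs: "mset xs = M0" using ex_mset by blast
  have "mset xs \<in> words" using M0 assms(2) xs by auto
  from ans_mono[OF this] obtain \<kappa> where \<kappa>: "\<kappa> \<noteq> 0" "\<And>M. M \<in> words \<Longrightarrow> size M \<le> length xs \<Longrightarrow>
    ans xs (mono \<alpha> M) = (if M = mset xs then scale \<kappa> vac else 0)" by blast
  have len: "length xs = size M0" using xs by auto
  have "0 = ans xs (\<Sum>M\<in>F. scale (c M) (mono \<alpha> M))"
    by (simp add: assms(3) ans_linear)
  also have "\<dots> = (\<Sum>M\<in>F. scale (c M) (ans xs (mono \<alpha> M)))"
    by (simp add: ans_linear)
  also have "\<dots> = (\<Sum>M\<in>{M0}. scale (c M) (scale \<kappa> vac))"
  proof (rule sum.mono_neutral_cong_right)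
    show "\<forall>N\<in>F - {M0}. scale (c N) (ans xs (mono \<alpha> N)) = 0"
    proof
      fix N assume N: "N \<in> F - {M0}"
      show "scale (c N) (ans xs (mono \<alpha> N)) = 0"
      proof (cases "c N = 0")
        case False
        then have "N \<in> ?F" using N by simp
        then have "size N \<le> length xs" using max len by metis
        moreover have "N \<in> words" using N assms(2) by blast
        ultimately show ?thesis using \<kappa>(2)[of N] N xs by simp
      qed simp
    qed
    have "M0 \<in> words" using M0(1) assms(2) by blast
    then have "ans xs (mono \<alpha> M0) = scale \<kappa> vac"
      using \<kappa>(2)[of M0] xs len by simp
    then show "scale (c N) (ans xs (mono \<alpha> N)) = scale (c N) (scale \<kappa> vac)" if "N \<in> {M0}" for N
      using that by simp
  qed (use M0 assms in auto)
  finally show False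
    using M0 \<kappa>(1) vac_nonzero by simp
qed

lemma mono_inj: "inj_on (mono \<alpha>) words"
proof (rule inj_onI)
  fix M N assume MN: "M \<in> words" "N \<in> words" "mono \<alpha> M = mono \<alpha> N"
  show "M = N"
  proof (rule ccontr)
    assume ne: "M \<noteq> N"
    have "(if M = M then 1 else -1 :: complex) = 0"
      by (rule mono_independent[where F="{M, N}" and c="\<lambda>K. if K = M then 1 else -1"]) (use MN ne in auto)
    then show False by simp
  qed
qed

lemma independent_mono: "independent (mono \<alpha> ` words)"
  unfolding independent_explicit_module
proof (intro allI impI)
  fix t u v assume t: "finite t" "t \<subseteq> mono \<alpha> ` words" "(\<Sum>v\<in>t. scale (u v) v) = 0" "v \<in> t"
  obtain F where F: "F \<subseteq> words" "t = mono \<alpha> ` F"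
    using t(2) by (meson subset_imageE)
  have inj: "inj_on (mono \<alpha>) F" using F mono_inj inj_on_subset by blast
  obtain M where M: "M \<in> F" "v = mono \<alpha> M" using t F by auto
  have "(\<lambda>M. u (mono \<alpha> M)) M = 0"
    by (rule mono_independent[where F=F])
      (use t F M inj in \<open>auto simp: sum.reindex finite_image_iff\<close>)
  then show "u v = 0" using M by simp
qed

section \<open>Coordinates and the endomorphism given by a Heisenberg family\<close>

definition coef :: "'v \<Rightarrow> (nat \<times> nat) multiset \<Rightarrow> complex" where
  "coef v M = (if M \<in> words then representation (mono \<alpha> ` words) v (mono \<alpha> M) else 0)"

lemma coef_linear: "coef (u + v) M = coef u M + coef v M" "coef (u - v) M = coef u M - coef v M"
  "coef (scale s v) M = s * coef v M" "coef 0 M = 0"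
  by (simp_all add: coef_def independent_mono mono_span representation_add representation_diff
      representation_scale representation_zero)

lemma coef_sum: "coef (sum f A) M = (\<Sum>a\<in>A. coef (f a) M)"
  by (induction A rule: infinite_finite_induct) (auto simp: coef_linear)

lemma coef_mono: "N \<in> words \<Longrightarrow> coef (mono \<alpha> N) M = (if M = N then 1 else 0)"
  using representation_basis[OF independent_mono, of "mono \<alpha> N"] mono_inj
  by (auto simp: coef_def inj_on_def)

lemma coef_vac: "coef vac M = (if M = {#} then 1 else 0)"
  using coef_mono[of "{#}" M] by simp

lemma coef_nonzero_words: "coef v M \<noteq> 0 \<Longrightarrow> M \<in> words"
  by (auto simp: coef_def split: if_splits)

lemma coef_finite: "finite {M. coef v M \<noteq> 0}"
proof -
  have "mono \<alpha> ` {M. coef v M \<noteq> 0} \<subseteq> {b. representation (mono \<alpha> ` words) v b \<noteq> 0}"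
    by (auto simp: coef_def)
  then have "finite (mono \<alpha> ` {M. coef v M \<noteq> 0})"
    using finite_representation finite_subset by blast
  moreover have "inj_on (mono \<alpha>) {M. coef v M \<noteq> 0}"
    using mono_inj by (rule inj_on_subset) (auto dest: coef_nonzero_words)
  ultimately show ?thesis by (simp add: finite_image_iff)
qed

lemma coef_expansion: "v = (\<Sum>M | coef v M \<noteq> 0. scale (coef v M) (mono \<alpha> M))"
proof (induction v rule: fock_induct)
  case (mono s M)
  have "{N. coef (scale s (mono \<alpha> M)) N \<noteq> 0} = (if s = 0 then {} else {M})"
    using mono by (auto simp: coef_linear coef_mono)
  then show ?case using mono by (simp add: coef_linear coef_mono)
next
  case (add u v)
  let ?F = "{M. coef u M \<noteq> 0} \<union> {M. coef v M \<noteq> 0}"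
  have fin: "finite ?F" using coef_finite by simp
  have *: "(\<Sum>M | coef w M \<noteq> 0. scale (coef w M) (mono \<alpha> M)) = (\<Sum>M\<in>?F. scale (coef w M) (mono \<alpha> M))"
    if "{M. coef w M \<noteq> 0} \<subseteq> ?F" for w
    by (rule sum.mono_neutral_left) (use fin that in auto)
  have "u + v = (\<Sum>M\<in>?F. scale (coef u M) (mono \<alpha> M)) + (\<Sum>M\<in>?F. scale (coef v M) (mono \<alpha> M))"
    using add *[of u] *[of v] by auto
  also have "\<dots> = (\<Sum>M\<in>?F. scale (coef (u + v) M) (mono \<alpha> M))"
    by (simp add: coef_linear scale_left_distrib sum.distrib)
  also have "\<dots> = (\<Sum>M | coef (u + v) M \<noteq> 0. scale (coef (u + v) M) (mono \<alpha> M))"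
    by (rule *[symmetric]) (auto simp: coef_linear)
  finally show ?case .
qed

lemma coef_ext: "(\<And>M. coef u M = coef v M) \<Longrightarrow> u = v"
  using coef_expansion[of u] coef_expansion[of v] by simp

text \<open>The existence half of the universal property: for a Heisenberg family
  \<open>\<beta>\<close> this linear map turns out to be the vertex algebra endomorphism extending
  \<open>\<alpha> i \<mapsto> \<beta> i\<close>.\<close>

definition phi :: "(nat \<Rightarrow> 'v) \<Rightarrow> 'v \<Rightarrow> 'v" where
  "phi \<beta> v = (\<Sum>M | coef v M \<noteq> 0. scale (coef v M) (mono \<beta> M))"

lemma phi_superset:
  assumes "finite F" "{M. coef v M \<noteq> 0} \<subseteq> F"
  shows "phi \<beta> v = (\<Sum>M\<in>F. scale (coef v M) (mono \<beta> M))"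
  unfolding phi_def by (rule sum.mono_neutral_left) (use assms in auto)

lemma phi_add: "phi \<beta> (u + v) = phi \<beta> u + phi \<beta> v"
proof -
  let ?F = "{M. coef u M \<noteq> 0} \<union> {M. coef v M \<noteq> 0}"
  have fin: "finite ?F" using coef_finite by simp
  have "phi \<beta> (u + v) = (\<Sum>M\<in>?F. scale (coef (u + v) M) (mono \<beta> M))"
    by (rule phi_superset[OF fin]) (auto simp: coef_linear)
  then show ?thesis
    by (simp add: phi_superset[OF fin, of u] phi_superset[OF fin, of v] coef_linear scale_left_distrib sum.distrib)
qed

lemma phi_scale: "phi \<beta> (scale s v) = scale s (phi \<beta> v)"
proof -
  have "phi \<beta> (scale s v) = (\<Sum>M | coef v M \<noteq> 0. scale (coef (scale s v) M) (mono \<beta> M))"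
    by (rule phi_superset[OF coef_finite]) (auto simp: coef_linear)
  then show ?thesis by (simp add: phi_def coef_linear scale_sum_right)
qed

lemma phi_zero [simp]: "phi \<beta> 0 = 0"
  using phi_scale[of \<beta> 0 0] by simp

lemma phi_diff: "phi \<beta> (u - v) = phi \<beta> u - phi \<beta> v"
  using phi_add[of \<beta> u "scale (-1) v"] phi_scale[of \<beta> "-1" v] by simp

lemma phi_sum: "phi \<beta> (sum f A) = (\<Sum>a\<in>A. phi \<beta> (f a))"
  by (induction A rule: infinite_finite_induct) (auto simp: phi_add)

lemma phi_mono: "M \<in> words \<Longrightarrow> phi \<beta> (mono \<alpha> M) = mono \<beta> M"
  by (subst phi_superset[where F="{M}"]) (auto simp: coef_mono)

lemma phi_vac [simp]: "phi \<beta> vac = vac"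
  using phi_mono[of "{#}"] by simp

text \<open>Creation modes correspond by construction, zero modes vanish for both families, and
  annihilation acts with coefficients that depend only on the relations.\<close>

lemma phi_mode:
  assumes "heisenberg_family \<beta>" "i < n"
  shows "phi \<beta> (Y (\<alpha> i) p v) = Y (\<beta> i) p (phi \<beta> v)"
proof (induction v rule: fock_induct)
  case (mono s M)
  have "phi \<beta> (Y (\<alpha> i) p (mono \<alpha> M)) = Y (\<beta> i) p (mono \<beta> M)"
  proof (cases p rule: mode_cases)
    case (1 k)
    have "Y (\<gamma> i) p v = cr \<gamma> (i, k) v" for \<gamma> v
      using assms 1 by (simp add: cr_def)
    then show ?thesis
      using mono assms(2) phi_mono[of "add_mset (i, k) M" \<beta>]
      by (simp add: mono_add_mset[OF assms(1)] mono_add_mset[OF heisenberg_family_\<alpha>])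
  next
    case 2
    then show ?thesis
      using mono assms by (simp add: zero_mode_mono heisenberg_family_\<alpha>)
  next
    case (3 k)
    have "Y (\<gamma> i) p v = an \<gamma> (i, k) v" for \<gamma> v
      using 3 by (simp add: an_def)
    then show ?thesis
      using mono assms an_mono[OF assms(1), of "(i, k)" M] an_mono[OF heisenberg_family_\<alpha>, of "(i, k)" M]
      by (simp add: phi_scale phi_mono words_diff)
  qed
  then show ?case using mono by (simp add: phi_scale phi_mono Y_linear)
qed (simp add: phi_add Y_linear)

text \<open>The associator formula writes the modes of a longer monomial through those of a shorter
  one and of a generator, with the same coefficients on both sides.\<close>

lemma phi_Y:
  assumes "heisenberg_family \<beta>"
  shows "phi \<beta> (Y a k b) = Y (phi \<beta> a) k (phi \<beta> b)"
proof (induction a arbitrary: k b rule: fock_cr_induct)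
  case vac
  then show ?case by (simp add: vacuum)
next
  case (cr x a)
  obtain K where K: "\<And>j. j \<ge> K \<Longrightarrow> Y a (k + int j) b = 0" "\<And>j. j \<ge> K \<Longrightarrow> Y (\<alpha> (fst x)) (int j) b = 0"
    using associator_bound by blast
  \<comment> \<open>The truncation bound carries over because \<open>phi\<close> intertwines the
    products in question and maps 0 to 0.\<close>
  have K': "Y (phi \<beta> a) (k + int j) (phi \<beta> b) = 0" "Y (\<beta> (fst x)) (int j) (phi \<beta> b) = 0" if "j \<ge> K" for j
    using K[OF that] cr phi_mode[OF assms cr(1)] by (metis phi_zero)+
  let ?r = "- int (snd x) - 1"
  have "phi \<beta> (Y (cr \<alpha> x a) k b) = phi \<beta> (Y (Y (\<alpha> (fst x)) ?r a) k b)"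
    using cr by (simp add: cr_def)
  also have "\<dots> = Y (Y (\<beta> (fst x)) ?r (phi \<beta> a)) k (phi \<beta> b)"
  proof -
    have "Y (Y (\<alpha> (fst x)) ?r a) k b = (\<Sum>j<K. scale ((-1) ^ j * (of_int ?r gchoose j))
        (Y (\<alpha> (fst x)) (?r - int j) (Y a (k + int j) b) - scale (sg ?r) (Y a (k + ?r - int j) (Y (\<alpha> (fst x)) (int j) b))))"
      by (rule associator_formula) (use K in auto)
    moreover have "Y (Y (\<beta> (fst x)) ?r (phi \<beta> a)) k (phi \<beta> b) = (\<Sum>j<K. scale ((-1) ^ j * (of_int ?r gchoose j))
        (Y (\<beta> (fst x)) (?r - int j) (Y (phi \<beta> a) (k + int j) (phi \<beta> b))
          - scale (sg ?r) (Y (phi \<beta> a) (k + ?r - int j) (Y (\<beta> (fst x)) (int j) (phi \<beta> b)))))"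
      by (rule associator_formula) (use K' in auto)
    ultimately show ?thesis
      by (simp only: phi_sum phi_scale phi_diff phi_mode[OF assms cr(1)] cr(2))
  qed
  also have "\<dots> = Y (phi \<beta> (cr \<alpha> x a)) k (phi \<beta> b)"
    using cr(1) by (simp add: cr_def phi_mode[OF assms])
  finally show ?case .
qed (simp_all add: phi_add phi_scale Y_linear)

lemma phi_generator: "heisenberg_family \<beta> \<Longrightarrow> i < n \<Longrightarrow> phi \<beta> (\<alpha> i) = \<beta> i"
  using phi_mode[of \<beta> i "-1" vac] by (simp add: creation)

text \<open>The equalizer of f and g is a vertex subalgebra containing the generators.\<close>

lemma endomorphism_eqI:
  assumes "\<And>u v. f (u + v) = f u + f v" "\<And>s v. f (scale s v) = scale s (f v)" "f vac = vac"
    "\<And>a k b. f (Y a k b) = Y (f a) k (f b)"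
    "\<And>u v. g (u + v) = g u + g v" "\<And>s v. g (scale s v) = scale s (g v)" "g vac = vac"
    "\<And>a k b. g (Y a k b) = Y (g a) k (g b)"
    "\<And>i. i < n \<Longrightarrow> f (\<alpha> i) = g (\<alpha> i)"
  shows "f = g"
proof -
  have "f 0 = 0" "g 0 = 0" using assms(2,6)[of 0 0] by simp_all
  then have "vertex_subalgebra {v. f v = g v}"
    by (auto simp: vertex_subalgebra_def subspace_def assms)
  moreover have "\<alpha> ` {..<n} \<subseteq> {v. f v = g v}"
    using assms(9) by auto
  ultimately have "{v. f v = g v} = UNIV"
    using generated unfolding generated_by_def by blast
  then show ?thesis by auto
qed

section \<open>The action of the orthogonal group\<close>

definition rotated :: "complex mat \<Rightarrow> nat \<Rightarrow> 'v" where
  "rotated g j = (\<Sum>i<n. scale (g $$ (i, j)) (\<alpha> i))"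

abbreviation act :: "complex mat \<Rightarrow> 'v \<Rightarrow> 'v" where
  "act g \<equiv> phi (rotated g)"

lemma orthogonal_columns:
  assumes "g \<in> complex_orthogonal_group n" "j < n" "l < n"
  shows "(\<Sum>i<n. g $$ (i, j) * g $$ (i, l)) = (if j = l then 1 else 0)"
proof -
  have g: "g \<in> carrier_mat n n" "transpose_mat g * g = 1\<^sub>m n"
    using assms by (auto simp: complex_orthogonal_group_def)
  have "(transpose_mat g * g) $$ (j, l) = (\<Sum>i<n. g $$ (i, j) * g $$ (i, l))"
    using g(1) assms(2,3) by (auto simp: scalar_prod_def atLeast0LessThan intro!: sum.cong)
  then show ?thesis using g(2) assms(2,3) by simp
qed

lemma transpose_orthogonal:
  assumes "g \<in> complex_orthogonal_group n"
  shows "transpose_mat g \<in> complex_orthogonal_group n"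
proof -
  have g: "g \<in> carrier_mat n n" "transpose_mat g * g = 1\<^sub>m n"
    using assms by (auto simp: complex_orthogonal_group_def)
  then have "g * transpose_mat g = 1\<^sub>m n"
    by (intro mat_mult_left_right_inverse[of "transpose_mat g"]) auto
  then show ?thesis
    using g by (auto simp: complex_orthogonal_group_def)
qed

lemma orthogonal_rows:
  assumes "g \<in> complex_orthogonal_group n" "j < n" "l < n"
  shows "(\<Sum>i<n. g $$ (j, i) * g $$ (l, i)) = (if j = l then 1 else 0)"
proof -
  have "g \<in> carrier_mat n n" using assms by (auto simp: complex_orthogonal_group_def)
  then have "(\<Sum>i<n. g $$ (j, i) * g $$ (l, i)) = (\<Sum>i<n. transpose_mat g $$ (i, j) * transpose_mat g $$ (i, l))"
    using assms(2,3) by (intro sum.cong refl) auto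
  then show ?thesis
    using orthogonal_columns[OF transpose_orthogonal[OF assms(1)] assms(2,3)] by simp
qed

lemma sum_delta_double:
  assumes "\<And>i j. i < n \<Longrightarrow> j < n \<Longrightarrow> i \<noteq> j \<Longrightarrow> f i j = 0"
  shows "(\<Sum>i<n. \<Sum>j<n. f i j) = (\<Sum>i<n. f i i)"
proof (rule sum.cong[OF refl])
  fix i assume "i \<in> {..<n}"
  then have "(\<Sum>j<n. f i j) = (\<Sum>j\<in>{i}. f i j)"
    by (intro sum.mono_neutral_right) (auto simp: assms)
  then show "(\<Sum>j<n. f i j) = f i i" by simp
qed

lemma heisenberg_family_rotated:
  assumes "g \<in> complex_orthogonal_group n"
  shows "heisenberg_family (rotated g)"
  unfolding heisenberg_family_def
proof (intro allI impI)
  fix j l and k :: int assume jl: "j < n" "l < n" and k: "k \<ge> 0"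
  have "Y (rotated g j) k (rotated g l) = (\<Sum>i<n. \<Sum>i'<n. scale (g $$ (i, j) * g $$ (i', l)) (Y (\<alpha> i) k (\<alpha> i')))"
    unfolding rotated_def Y_sum_left unfolding Y_sum_right by (simp add: Y_linear mult.commute)
  also have "\<dots> = (\<Sum>i<n. scale (g $$ (i, j) * g $$ (i, l)) (Y (\<alpha> i) k (\<alpha> i)))"
    by (rule sum_delta_double) (simp add: heisenberg_ope k)
  also have "\<dots> = (\<Sum>i<n. scale (g $$ (i, j) * g $$ (i, l)) (if k = 1 then vac else 0))"
    by (intro sum.cong refl) (simp add: heisenberg_ope k)
  also have "\<dots> = (if j = l \<and> k = 1 then vac else 0)"
    unfolding scale_sum_left[symmetric] orthogonal_columns[OF assms jl] by simp
  finally show "Y (rotated g j) k (rotated g l) = (if j = l \<and> k = 1 then vac else 0)" .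
qed

text \<open>By uniqueness of endomorphisms only generators matter, and there the rows of g are
  orthonormal.\<close>

lemma act_transpose:
  assumes "g \<in> complex_orthogonal_group n"
  shows "act g (act (transpose_mat g) v) = v"
proof -
  note fam = heisenberg_family_rotated[OF assms] heisenberg_family_rotated[OF transpose_orthogonal[OF assms]]
  have g: "g \<in> carrier_mat n n" using assms by (auto simp: complex_orthogonal_group_def)
  have "(\<lambda>v. act g (act (transpose_mat g) v)) = (\<lambda>v. v)"
  proof (rule endomorphism_eqI)
    fix j assume j: "j < n"
    have "act g (act (transpose_mat g) (\<alpha> j)) = (\<Sum>i<n. scale (g $$ (j, i)) (rotated g i))"
      using g j by (simp add: phi_generator[OF fam(2)] rotated_def[of "transpose_mat g"] phi_sum phi_scale
          phi_generator[OF fam(1)])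
    also have "\<dots> = (\<Sum>k<n. scale (\<Sum>i<n. g $$ (j, i) * g $$ (k, i)) (\<alpha> k))"
      unfolding rotated_def scale_sum_right scale_sum_left by (subst sum.swap) simp
    also have "\<dots> = (\<Sum>k<n. if k = j then \<alpha> k else 0)"
      by (intro sum.cong refl) (simp add: orthogonal_rows[OF assms j])
    also have "\<dots> = \<alpha> j" using j by simp
    finally show "act g (act (transpose_mat g) (\<alpha> j)) = \<alpha> j" .
  qed (simp_all add: phi_add phi_scale phi_Y fam)
  then show ?thesis by (simp add: fun_eq_iff)
qed

lemma act_bij:
  assumes "g \<in> complex_orthogonal_group n"
  shows "bij (act g)"
proof (rule o_bij)
  show "act g \<circ> act (transpose_mat g) = id"
    using act_transpose[OF assms] by (auto simp: fun_eq_iff)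
  show "act (transpose_mat g) \<circ> act g = id"
    using act_transpose[OF transpose_orthogonal[OF assms]] by (auto simp: fun_eq_iff)
qed

text \<open>Resolves the definite description: \<open>act g\<close> is such an automorphism, and
  generation makes it the only one.\<close>

lemma orthogonal_action_eq:
  assumes "g \<in> complex_orthogonal_group n"
  shows "orthogonal_action g = act g"
  unfolding orthogonal_action_def
proof (rule the_equality)
  note fam = heisenberg_family_rotated[OF assms]
  have "Vector_Spaces.linear scale scale (act g)"
    using vector_space_axioms by (simp add: Vector_Spaces.linear_iff phi_add phi_scale)
  then show "va_automorphism (act g) \<and> (\<forall>j<n. act g (\<alpha> j) = (\<Sum>i<n. scale (g $$ (i, j)) (\<alpha> i)))"
    using fam act_bij[OF assms]
    by (auto simp: va_automorphism_def phi_Y phi_generator rotated_def)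
  fix f assume f: "va_automorphism f \<and> (\<forall>j<n. f (\<alpha> j) = (\<Sum>i<n. scale (g $$ (i, j)) (\<alpha> i)))"
  then have lin: "f (u + v) = f u + f v" "f (scale s v) = scale s (f v)" for u v s
    by (auto simp: va_automorphism_def Vector_Spaces.linear_iff)
  show "f = act g"
    by (rule endomorphism_eqI)
      (use f fam in \<open>auto simp: va_automorphism_def phi_add phi_scale phi_Y phi_generator rotated_def lin\<close>)
qed

lemma invariants_iff: "v \<in> orthogonal_invariants \<longleftrightarrow> (\<forall>g\<in>complex_orthogonal_group n. act g v = v)"
  by (auto simp: orthogonal_invariants_def orthogonal_action_eq)

section \<open>The Virasoro element and the weight grading\<close>

lemma virasoro_OPE:
  assumes "i < n" "k \<ge> 0"
  shows "Y (\<alpha> i) k virasoro = (if k = 1 then \<alpha> i else 0)"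
proof -
  have "Y (\<alpha> i) k (Y (\<alpha> a) (-1) (\<alpha> a)) = (if i = a then (if k = 1 then scale 2 (\<alpha> i) else 0) else 0)" if "a < n" for a
  proof -
    \<comment> \<open>Each factor of the quadratic contributes one contraction; the resulting 2
      cancels the factor 1/2.\<close>
    have "scale 2 v = v + v" for v :: 'v
      using scale_left_distrib[of 1 1 v] by simp
    then show ?thesis
      using heisenberg_commutator[OF heisenberg_family_\<alpha> assms(1) that, of k "-1" "\<alpha> a"] assms that
      by (auto simp: heisenberg_ope creation)
  qed
  then have "(\<Sum>a<n. Y (\<alpha> i) k (Y (\<alpha> a) (-1) (\<alpha> a))) = (\<Sum>a<n. if i = a then (if k = 1 then scale 2 (\<alpha> i) else 0) else 0)"
    by (intro sum.cong refl) auto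
  then show ?thesis
    using assms by (simp add: virasoro_def Y_linear)
qed

text \<open>Obtained from the modes of \<open>\<alpha> i\<close> acting on the Virasoro element,
  with the sign reversed, so that the modes of the quadratic need not be computed.\<close>

lemma virasoro_commutator:
  assumes "i < n"
  shows "Y virasoro q (Y (\<alpha> i) p c) = Y (\<alpha> i) p (Y virasoro q c) - scale (of_int p) (Y (\<alpha> i) (p + q - 1) c)"
proof -
  have "Y (\<alpha> i) p (Y virasoro q c) - Y virasoro q (Y (\<alpha> i) p c)
    = (\<Sum>j<2. scale (of_int p gchoose j) (Y (Y (\<alpha> i) (int j) virasoro) (p + q - int j) c))"
    by (rule commutator_formula) (auto simp: virasoro_OPE assms)
  then show ?thesis
    by (simp add: virasoro_OPE assms numeral_2_eq_2 algebra_simps)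
qed

text \<open>In this indexing \<open>Y virasoro 0\<close> is L(-1) and \<open>Y virasoro 1\<close> is
  L(0). Both sides kill the vacuum and have the same commutators with the creation modes.\<close>

lemma virasoro_0: "Y virasoro 0 v = D (Suc 0) v"
proof (induction v rule: fock_cr_induct)
  case (cr x v)
  then show ?case
    by (simp add: cr_def virasoro_commutator T_Y)
qed (simp_all add: creation T_vac Y_linear D_linear)

definition wt :: "(nat \<times> nat) multiset \<Rightarrow> nat" where
  "wt M = (\<Sum>x\<in>#M. Suc (snd x))"

lemma wt_simps [simp]: "wt {#} = 0" "wt (add_mset x M) = Suc (snd x) + wt M"
  by (simp_all add: wt_def)

lemma L0_mono: "M \<in> words \<Longrightarrow> Y virasoro 1 (mono \<alpha> M) = scale (of_nat (wt M)) (mono \<alpha> M)"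
proof (induction M)
  case empty
  then show ?case by (simp add: creation)
next
  case (add x M)
  then show ?case
    by (simp add: mono_add_mset[OF heisenberg_family_\<alpha>] cr_def virasoro_commutator Y_linear algebra_simps)
qed

lemma coef_L0: "coef (Y virasoro 1 v) M = of_nat (wt M) * coef v M"
  by (induction v rule: fock_induct) (auto simp: Y_linear coef_linear L0_mono coef_mono algebra_simps)

lemma weight_space_iff: "v \<in> weight_space virasoro m \<longleftrightarrow> (\<forall>M. coef v M \<noteq> 0 \<longrightarrow> wt M = m)"
proof
  assume "v \<in> weight_space virasoro m"
  then have "of_nat (wt M) * coef v M = of_nat m * coef v M" for M
    by (simp add: weight_space_def coef_linear flip: coef_L0)
  then show "\<forall>M. coef v M \<noteq> 0 \<longrightarrow> wt M = m" by auto
next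
  assume "\<forall>M. coef v M \<noteq> 0 \<longrightarrow> wt M = m"
  then have "coef (Y virasoro 1 v) M = coef (scale (of_nat m) v) M" for M
    by (auto simp: coef_L0 coef_linear)
  then show "v \<in> weight_space virasoro m"
    using coef_ext by (auto simp: weight_space_def)
qed

text \<open>[L(0), a_k] = (Ta)_(k+1) + (L(0) a)_k, and (Ta)_(k+1) = -(k+1) a_k.\<close>

lemma L0_Y:
  assumes "a \<in> weight_space virasoro m" "b \<in> weight_space virasoro l"
  shows "Y virasoro 1 (Y a k b) = scale (of_int (int m + int l - k - 1)) (Y a k b)"
proof -
  obtain K where K: "\<And>j. j \<ge> K \<Longrightarrow> Y virasoro (int j) a = 0" using commutator_bound by blast
  have "Y virasoro 1 (Y a k b) - Y a k (Y virasoro 1 b)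
      = (\<Sum>j<K + 2. scale (of_int 1 gchoose j) (Y (Y virasoro (int j) a) (1 + k - int j) b))"
    by (rule commutator_formula) (simp add: K)
  also have "\<dots> = (\<Sum>j\<in>{0,1}. scale (of_int 1 gchoose j) (Y (Y virasoro (int j) a) (1 + k - int j) b))"
  proof (rule sum.mono_neutral_right)
    show "\<forall>j\<in>{..<K + 2} - {0, 1}. scale (of_int 1 gchoose j) (Y (Y virasoro (int j) a) (1 + k - int j) b) = 0"
    proof
      fix j assume "j \<in> {..<K + 2} - {0, 1}"
      then have z: "(1::nat) choose j = 0" by (intro binomial_eq_0) auto
      have "(of_int 1 :: complex) gchoose j = 0"
        using binomial_gbinomial[of 1 j, where 'a=complex] unfolding z by simp
      then show "scale (of_int 1 gchoose j) (Y (Y virasoro (int j) a) (1 + k - int j) b) = 0" by simp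
    qed
  qed auto
  also have "\<dots> = Y (D (Suc 0) a) (1 + k) b + scale (of_nat m) (Y a k b)"
    using assms(1) by (simp add: virasoro_0 weight_space_def Y_linear)
  finally show ?thesis
    using assms(2) by (simp add: Y_T weight_space_def Y_linear algebra_simps)
qed

lemma coef_Y_weight:
  assumes "a \<in> weight_space virasoro m" "b \<in> weight_space virasoro l" "coef (Y a k b) M \<noteq> 0"
  shows "int (wt M) = int m + int l - k - 1"
proof -
  have "of_nat (wt M) * coef (Y a k b) M = of_int (int m + int l - k - 1) * coef (Y a k b) M"
    by (simp only: L0_Y[OF assms(1,2)] coef_linear flip: coef_L0)
  then have "(of_int (int (wt M)) :: complex) = of_int (int m + int l - k - 1)"
    using assms(3) by simp
  then show ?thesis by (simp only: of_int_eq_iff)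
qed

lemma rotated_quadratic:
  assumes "g \<in> complex_orthogonal_group n"
  shows "(\<Sum>a<n. Y (rotated g a) p (Y (rotated g a) q v)) = (\<Sum>a<n. Y (\<alpha> a) p (Y (\<alpha> a) q v))"
proof -
  have "(\<Sum>a<n. Y (rotated g a) p (Y (rotated g a) q v))
    = (\<Sum>a<n. \<Sum>i<n. \<Sum>j<n. scale (g $$ (i, a) * g $$ (j, a)) (Y (\<alpha> i) p (Y (\<alpha> j) q v)))"
    unfolding rotated_def Y_sum_left unfolding Y_sum_right by (simp add: Y_linear mult.commute)
  also have "\<dots> = (\<Sum>i<n. \<Sum>j<n. scale (\<Sum>a<n. g $$ (i, a) * g $$ (j, a)) (Y (\<alpha> i) p (Y (\<alpha> j) q v)))"
    unfolding scale_sum_left by (rule sum_rotate[symmetric])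
  also have "\<dots> = (\<Sum>i<n. scale (\<Sum>a<n. g $$ (i, a) * g $$ (i, a)) (Y (\<alpha> i) p (Y (\<alpha> i) q v)))"
    by (rule sum_delta_double) (simp add: orthogonal_rows[OF assms])
  also have "\<dots> = (\<Sum>a<n. Y (\<alpha> a) p (Y (\<alpha> a) q v))"
    by (intro sum.cong refl) (simp add: orthogonal_rows[OF assms])
  finally show ?thesis .
qed

lemma act_quadratic:
  assumes "g \<in> complex_orthogonal_group n"
  shows "act g (\<Sum>a<n. Y (\<alpha> a) p (Y (\<alpha> a) q v)) = (\<Sum>a<n. Y (\<alpha> a) p (Y (\<alpha> a) q (act g v)))"
proof -
  have "act g (\<Sum>a<n. Y (\<alpha> a) p (Y (\<alpha> a) q v)) = (\<Sum>a<n. Y (rotated g a) p (Y (rotated g a) q (act g v)))"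
    unfolding phi_sum by (intro sum.cong refl) (simp add: phi_mode[OF heisenberg_family_rotated[OF assms]])
  then show ?thesis by (simp only: rotated_quadratic[OF assms])
qed

lemma virasoro_alt: "virasoro = scale (1/2) (\<Sum>a<n. Y (\<alpha> a) (-1) (Y (\<alpha> a) (-1) vac))"
  by (simp add: virasoro_def creation)

lemma act_virasoro: "g \<in> complex_orthogonal_group n \<Longrightarrow> act g virasoro = virasoro"
  by (simp add: virasoro_alt phi_scale act_quadratic)

lemma act_weight_space:
  assumes "g \<in> complex_orthogonal_group n" "v \<in> weight_space virasoro m"
  shows "act g v \<in> weight_space virasoro m"
proof -
  have "Y virasoro 1 (act g v) = act g (Y virasoro 1 v)"
    by (simp add: phi_Y[OF heisenberg_family_rotated[OF assms(1)]] act_virasoro[OF assms(1)])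
  then show ?thesis using assms(2) by (simp add: weight_space_def phi_scale)
qed

definition weight_part :: "nat \<Rightarrow> 'v \<Rightarrow> 'v" where
  "weight_part m v = (\<Sum>M | coef v M \<noteq> 0 \<and> wt M = m. scale (coef v M) (mono \<alpha> M))"

lemma coef_weight_part: "coef (weight_part m v) M = (if wt M = m then coef v M else 0)"
proof -
  have fin: "finite {M. coef v M \<noteq> 0 \<and> wt M = m}"
    using coef_finite by (rule rev_finite_subset) auto
  have "coef (weight_part m v) M = (\<Sum>N | coef v N \<noteq> 0 \<and> wt N = m. if N = M then coef v N else 0)"
    unfolding weight_part_def coef_sum coef_linear
    by (intro sum.cong refl) (auto simp: coef_mono dest: coef_nonzero_words)
  then show ?thesis using fin by simp
qed

lemma weight_part_weight_space: "weight_part m v \<in> weight_space virasoro m"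
  by (auto simp: weight_space_iff coef_weight_part split: if_splits)

lemma sum_weight_parts: "v = (\<Sum>m\<in>wt ` {M. coef v M \<noteq> 0}. weight_part m v)"
proof (rule coef_ext)
  fix M
  have "coef (\<Sum>m\<in>wt ` {M. coef v M \<noteq> 0}. weight_part m v) M
    = (\<Sum>m\<in>wt ` {M. coef v M \<noteq> 0}. if m = wt M then coef v M else 0)"
    unfolding coef_sum by (intro sum.cong refl) (auto simp: coef_weight_part)
  also have "\<dots> = coef v M"
    using coef_finite[of v] by (auto simp: sum.delta)
  finally show "coef v M = coef (\<Sum>m\<in>wt ` {M. coef v M \<noteq> 0}. weight_part m v) M" by simp
qed

text \<open>The action fixes the Virasoro element and so preserves weights. It follows that the
  weight components of an invariant are invariant, which gives the decomposition of the graded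
  subalgebra.\<close>

lemma act_weight_part:
  assumes g: "g \<in> complex_orthogonal_group n"
  shows "act g (weight_part m v) = weight_part m (act g v)"
proof (rule coef_ext)
  fix M
  let ?A = "wt ` {M. coef v M \<noteq> 0}"
  have 0: "coef (act g (weight_part k v)) M = 0" if "wt M \<noteq> k" for k
    using act_weight_space[OF g weight_part_weight_space[of k v]] that by (auto simp: weight_space_iff)
  have "coef (act g v) M = (\<Sum>k\<in>?A. coef (act g (weight_part k v)) M)"
    by (subst sum_weight_parts[of v]) (simp add: phi_sum coef_sum)
  also have "\<dots> = (\<Sum>k\<in>?A. if k = wt M then coef (act g (weight_part k v)) M else 0)"
    by (intro sum.cong refl) (auto simp: 0)
  also have "\<dots> = (if wt M \<in> ?A then coef (act g (weight_part (wt M) v)) M else 0)"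
    using coef_finite[of v] by (simp add: sum.delta)
  also have "\<dots> = coef (act g (weight_part (wt M) v)) M"
  proof -
    have "weight_part (wt M) v = 0" if "wt M \<notin> ?A"
      using that by (intro coef_ext) (simp add: coef_weight_part coef_linear image_iff, metis)
    then show ?thesis by (auto simp: coef_linear)
  qed
  finally show "coef (act g (weight_part m v)) M = coef (weight_part m (act g v)) M"
    using 0[of m] by (auto simp: coef_weight_part)
qed

abbreviation Inv :: "'v set" where "Inv \<equiv> orthogonal_invariants"

lemma subspace_Inv: "subspace Inv"
  by (auto simp: subspace_def invariants_iff phi_add phi_scale)

lemma subspace_weight_space: "subspace (weight_space virasoro m)"
  by (auto simp: subspace_def weight_space_def Y_linear scale_right_distrib mult.commute)

lemma vertex_subalgebra_Inv: "vertex_subalgebra Inv"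
  using subspace_Inv by (auto simp: vertex_subalgebra_def invariants_iff phi_Y heisenberg_family_rotated)

sublocale inv: graded_subalgebra scale vac Y orthogonal_invariants invariants_grading
proof
  show "vertex_subalgebra Inv" by (rule vertex_subalgebra_Inv)
  show "subspace (invariants_grading m)" for m
    unfolding invariants_grading_def using subspace_Inv subspace_weight_space by (rule subspace_inter)
  show "a \<in> Inv" if "a \<in> invariants_grading m" for a m
    using that by (simp add: invariants_grading_def)
  show "vac \<in> invariants_grading 0"
    using vertex_subalgebra_Inv by (auto simp: invariants_grading_def weight_space_def vertex_subalgebra_def creation)
  show "Y a k b \<in> invariants_grading h"
    if "a \<in> invariants_grading m" "b \<in> invariants_grading l" "int h = int m + int l - k - 1" for a m b l k h
  proof -
    have "wt M = h" if "coef (Y a k b) M \<noteq> 0" for M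
    proof -
      have "int (wt M) = int m + int l - k - 1"
        by (rule coef_Y_weight[OF _ _ that])
          (use \<open>a \<in> invariants_grading m\<close> \<open>b \<in> invariants_grading l\<close> in \<open>auto simp: invariants_grading_def\<close>)
      then show ?thesis using \<open>int h = int m + int l - k - 1\<close> by linarith
    qed
    then show ?thesis
      using that vertex_subalgebra_Inv
      by (simp add: invariants_grading_def vertex_subalgebra_def weight_space_iff[of "Y a k b"])
  qed
  show "Y a k b = 0"
    if "a \<in> invariants_grading m" "b \<in> invariants_grading l" "int m + int l - k - 1 < 0" for a m b l k
    using that coef_Y_weight[of a m b l k]
    by (intro coef_ext) (auto simp: invariants_grading_def coef_linear)
  show "\<exists>A c. finite A \<and> (\<forall>m\<in>A. c m \<in> invariants_grading m) \<and> v = sum c A" if "v \<in> Inv" for v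
  proof (intro exI conjI ballI)
    show "finite (wt ` {M. coef v M \<noteq> 0})" using coef_finite by simp
    show "weight_part m v \<in> invariants_grading m" for m
      using that by (simp add: invariants_grading_def weight_part_weight_space invariants_iff act_weight_part)
    show "v = (\<Sum>m\<in>wt ` {M. coef v M \<noteq> 0}. weight_part m v)" by (rule sum_weight_parts)
  qed
  show "c m = 0" if A: "finite A" "\<And>m. m \<in> A \<Longrightarrow> c m \<in> invariants_grading m" "sum c A = 0" "m \<in> A"
    for A c m
  proof (rule coef_ext)
    fix M
    have 0: "coef (c k) M = 0" if "k \<in> A" "k \<noteq> wt M" for k
      using A(2)[OF that(1)] that(2) by (auto simp: invariants_grading_def weight_space_iff)
    have "0 = (\<Sum>k\<in>A. coef (c k) M)"
      using A(3) by (simp add: coef_linear flip: coef_sum)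
    also have "\<dots> = (\<Sum>k\<in>A. if k = wt M then coef (c k) M else 0)"
      by (intro sum.cong refl) (auto simp: 0)
    also have "\<dots> = (if wt M \<in> A then coef (c (wt M)) M else 0)"
      using A(1) by (simp add: sum.delta)
    finally show "coef (c m) M = coef 0 M"
      using 0[OF A(4)] A(4) by (cases "m = wt M") (auto simp: coef_linear)
  qed
qed

end

section \<open>The first fundamental theorem\<close>

context vector_space
begin

text \<open>Dimension count inside a finite-dimensional subspace: the image of a basis of X is
  independent, and a vector of X outside its span would give too many independent vectors.\<close>

lemma injective_endomorphism_surjective:
  assumes B: "finite B" "X \<subseteq> span B" and X: "subspace X"
    and f: "Vector_Spaces.linear scale scale f" "\<And>x. x \<in> X \<Longrightarrow> f x \<in> X" "\<And>x. x \<in> X \<Longrightarrow> f x = 0 \<Longrightarrow> x = 0"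
  shows "X \<subseteq> f ` X"
proof
  fix x assume x: "x \<in> X"
  interpret f: Vector_Spaces.linear scale scale f by fact
  obtain C where C: "C \<subseteq> X" "independent C" "X \<subseteq> span C"
    using maximal_independent_subset[of X] by blast
  have spanC: "span C = X" using C X by (simp add: span_minimal subset_antisym)
  have inj: "inj_on f (span C)"
    unfolding spanC
  proof (rule inj_onI)
    fix u v assume uv: "u \<in> X" "v \<in> X" "f u = f v"
    then have "f (u - v) = 0" by (simp add: f.diff)
    then have "u - v = 0" using uv X f(3) subspace_diff by blast
    then show "u = v" by simp
  qed
  have finC: "finite C" using independent_span_bound[OF B(1) C(2)] C(1) B(2) by blast
  have ind: "independent (f ` C)" by (rule f.independent_injective_image[OF C(2) inj])
  have card: "card (f ` C) = card C"
    using inj C(1) spanC by (intro card_image) (auto intro: inj_on_subset)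
  have "x \<in> span (f ` C)"
  proof (rule ccontr)
    assume nx: "x \<notin> span (f ` C)"
    then have "independent (insert x (f ` C))" using ind by (simp add: independent_insertI)
    moreover have "insert x (f ` C) \<subseteq> span C"
      using x C(1) f(2) spanC by auto
    ultimately have "card (insert x (f ` C)) \<le> card C"
      using independent_span_bound[OF finC] by blast
    moreover have "x \<notin> f ` C" using nx span_base by blast
    ultimately show False using finC card by simp
  qed
  then show "x \<in> f ` X" by (simp add: f.span_image spanC)
qed

text \<open>Applying f minus the eigenvalue of one summand removes that summand and multiplies the
  others by nonzero factors.\<close>

lemma eigenvectors_sum_zero:
  fixes R :: "'i set"
  assumes "finite R" "\<And>u v. f (u + v) = f u + f v" "\<And>s v. f (scale s v) = scale s (f v)"
    and "inj_on \<mu> R" "\<And>r. r \<in> R \<Longrightarrow> f (u r) = scale (\<mu> r) (u r)" "sum u R = 0" "r \<in> R"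
  shows "u r = 0"
  using assms(1,4-7)
proof (induction R arbitrary: u r rule: finite_induct)
  case empty
  then show ?case by simp
next
  case (insert t R)
  have f0: "f 0 = 0" using assms(3)[of 0 0] by simp
  have fsum: "f (sum w A) = (\<Sum>x\<in>A. f (w x))" for w and A :: "'i set"
    by (induction A rule: infinite_finite_induct) (auto simp: assms(2) f0)
  have "0 = f (sum u (insert t R)) - scale (\<mu> t) (sum u (insert t R))"
    using insert.prems f0 by simp
  also have "\<dots> = (\<Sum>r\<in>insert t R. scale (\<mu> r - \<mu> t) (u r))"
    unfolding fsum scale_sum_right sum_subtractf[symmetric]
    using insert.prems by (intro sum.cong refl) (simp add: scale_left_diff_distrib)
  also have "\<dots> = (\<Sum>r\<in>R. scale (\<mu> r - \<mu> t) (u r))"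
    using insert.hyps by simp
  finally have zero: "(\<Sum>r\<in>R. scale (\<mu> r - \<mu> t) (u r)) = 0" by simp
  have "scale (\<mu> r - \<mu> t) (u r) = 0" if "r \<in> R" for r
  proof (rule insert.IH[OF _ _ zero that])
    show "inj_on \<mu> R" using insert.prems by simp
    show "f (scale (\<mu> r - \<mu> t) (u r)) = scale (\<mu> r) (scale (\<mu> r - \<mu> t) (u r))" if "r \<in> R" for r
      using that insert.prems by (simp add: assms(3) mult.commute)
  qed
  moreover have "\<mu> r \<noteq> \<mu> t" if "r \<in> R" for r
    using that insert.prems(1) insert.hyps by (auto simp: inj_on_def)
  ultimately have R: "u r = 0" if "r \<in> R" for r using that by auto
  then have "u t = 0" using insert.prems(3) insert.hyps by simp
  then show ?case using R insert.prems(4) by auto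
qed

end

context heisenberg_vertex_algebra
begin

lemmas cr_add_mset = mono_add_mset[OF heisenberg_family_\<alpha>, symmetric]

section \<open>The Hermitian form and the gl(n)-action\<close>

lemma coef_cr: "fst x < n \<Longrightarrow> coef (cr \<alpha> x v) M = (if x \<in># M then coef v (M - {#x#}) else 0)"
proof (induction v rule: fock_induct)
  case (mono s N)
  then have "coef (cr \<alpha> x (mono \<alpha> N)) M = (if M = add_mset x N then 1 else 0)"
    by (simp add: cr_add_mset coef_mono)
  then show ?case using mono by (auto simp: cr_linear coef_linear coef_mono)
qed (simp add: cr_linear coef_linear)

lemma coef_an:
  "fst x < n \<Longrightarrow> coef (an \<alpha> x v) M = of_nat (Suc (snd x) * Suc (count M x)) * coef v (add_mset x M)"
proof (induction v rule: fock_induct)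
  case (mono s N)
  have "coef (an \<alpha> x (mono \<alpha> N)) M = of_nat (Suc (snd x) * Suc (count M x)) * coef (mono \<alpha> N) (add_mset x M)"
  proof (cases "x \<in># N")
    case True
    then obtain N' where "N = add_mset x N'" by (metis insert_DiffM)
    then show ?thesis
      using mono an_mono[OF heisenberg_family_\<alpha>, of x N] by (auto simp: coef_linear coef_mono)
  next
    case False
    then have "count N x = 0" by (simp add: not_in_iff)
    then show ?thesis
      using mono False an_mono[OF heisenberg_family_\<alpha>, of x N] by (auto simp: coef_linear coef_mono)
  qed
  then show ?case by (simp add: an_linear coef_linear)
qed (simp add: an_linear coef_linear distrib_left)

text \<open>The squared norm of a monomial for which annihilation is adjoint to creation.\<close>

definition nrm :: "(nat \<times> nat) multiset \<Rightarrow> real" where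
  "nrm M = (\<Prod>x\<in>set_mset M. real (Suc (snd x)) ^ count M x * fact (count M x))"

lemma nrm_pos: "nrm M > 0"
  unfolding nrm_def by (intro prod_pos) auto

lemma nrm_empty [simp]: "nrm {#} = 1"
  by (simp add: nrm_def)

text \<open>The ratio equals the factor in \<open>coef_an\<close>; this makes creation and
  annihilation adjoint to each other.\<close>

lemma nrm_add_mset: "nrm (add_mset x M) = real (Suc (snd x) * Suc (count M x)) * nrm M"
proof -
  let ?f = "\<lambda>M x. real (Suc (snd x)) ^ count M x * fact (count M x)"
  have "nrm M = prod (?f M) (insert x (set_mset M))"
    unfolding nrm_def by (rule prod.mono_neutral_left) (auto simp: not_in_iff)
  also have "\<dots> = ?f M x * prod (?f M) (set_mset M - {x})"
    by (simp add: prod.insert_remove)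
  finally have 1: "nrm M = ?f M x * prod (?f M) (set_mset M - {x})" .
  have "nrm (add_mset x M) = ?f (add_mset x M) x * prod (?f (add_mset x M)) (set_mset M - {x})"
    by (simp add: nrm_def prod.insert_remove)
  also have "prod (?f (add_mset x M)) (set_mset M - {x}) = prod (?f M) (set_mset M - {x})"
    by (rule prod.cong) auto
  finally show ?thesis unfolding 1 by (simp add: algebra_simps)
qed

lemma mult_cnj_self: "z * cnj z = (of_real (cmod z))\<^sup>2"
  using complex_norm_square[of z] by simp

definition ip :: "'v \<Rightarrow> 'v \<Rightarrow> complex" where
  "ip u v = (\<Sum>M | coef v M \<noteq> 0. of_real (nrm M) * coef u M * cnj (coef v M))"

lemma ip_superset:
  assumes "finite F" "{M. coef v M \<noteq> 0} \<subseteq> F"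
  shows "ip u v = (\<Sum>M\<in>F. of_real (nrm M) * coef u M * cnj (coef v M))"
  unfolding ip_def by (rule sum.mono_neutral_left) (use assms in auto)

lemma ip_linear: "ip (u + u') v = ip u v + ip u' v" "ip (u - u') v = ip u v - ip u' v"
  "ip (scale s u) v = s * ip u v" "ip 0 v = 0"
  by (simp_all add: ip_def coef_linear algebra_simps sum.distrib sum_subtractf sum_distrib_left)

lemma ip_sum: "ip (sum f A) v = (\<Sum>a\<in>A. ip (f a) v)"
  by (induction A rule: infinite_finite_induct) (auto simp: ip_linear)

lemma ip_hermitian: "ip v u = cnj (ip u v)"
proof -
  let ?F = "{M. coef u M \<noteq> 0} \<union> {M. coef v M \<noteq> 0}"
  have fin: "finite ?F" using coef_finite by simp
  show ?thesis
    using ip_superset[OF fin, of u v] ip_superset[OF fin, of v u] by (simp add: mult_ac)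
qed

lemma ip_right: "ip u (scale s v) = cnj s * ip u v" "ip u (sum f A) = (\<Sum>a\<in>A. ip u (f a))"
  by (simp_all add: ip_hermitian[of u] ip_linear ip_sum)

lemma ip_self: "ip v v = of_real (\<Sum>M | coef v M \<noteq> 0. nrm M * (cmod (coef v M))\<^sup>2)"
  by (simp add: ip_def mult_cnj_self mult.assoc)

lemma ip_self_nonneg: "Re (ip v v) \<ge> 0"
  unfolding ip_self by (simp add: sum_nonneg nrm_pos less_imp_le)

lemma ip_cr:
  assumes "fst x < n"
  shows "ip (cr \<alpha> x u) v = ip u (an \<alpha> x v)"
proof -
  have c: "of_nat (Suc (snd x) * Suc (count N x)) \<noteq> (0::complex)" for N
    unfolding of_nat_eq_0_iff by simp
  have supp: "{M. coef (an \<alpha> x v) M \<noteq> 0} = {N. coef v (add_mset x N) \<noteq> 0}"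
    using c by (simp add: coef_an assms del: of_nat_mult of_nat_Suc mult_Suc)
  have "ip (cr \<alpha> x u) v = (\<Sum>M | coef v M \<noteq> 0 \<and> x \<in># M. of_real (nrm M) * coef u (M - {#x#}) * cnj (coef v M))"
    unfolding ip_def by (rule sum.mono_neutral_cong_right) (use coef_finite in \<open>auto simp: coef_cr assms\<close>)
  also have "\<dots> = (\<Sum>N | coef v (add_mset x N) \<noteq> 0. of_real (nrm (add_mset x N)) * coef u N * cnj (coef v (add_mset x N)))"
    by (rule sum.reindex_bij_witness[where i="add_mset x" and j="\<lambda>M. M - {#x#}"]) auto
  also have "\<dots> = ip u (an \<alpha> x v)"
    unfolding ip_def supp
    by (intro sum.cong refl) (simp add: coef_an[OF assms] nrm_add_mset mult_ac del: of_nat_Suc mult_Suc mult_Suc_right)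
  finally show ?thesis .
qed

lemma ip_an: "fst x < n \<Longrightarrow> ip (an \<alpha> x u) v = ip u (cr \<alpha> x v)"
  using ip_cr[of x v u] ip_hermitian by metis

text \<open>The \<open>gl(n)\<close>-action on letters, restricted to the letters \<open>(a, k)\<close> with \<open>k < K\<close>.\<close>

definition E :: "nat \<Rightarrow> nat \<Rightarrow> nat \<Rightarrow> 'v \<Rightarrow> 'v" where
  "E K a b v = (\<Sum>k<K. scale (1 / of_nat (Suc k)) (cr \<alpha> (a, k) (an \<alpha> (b, k) v)))"

lemma E_linear: "E K a b (u + v) = E K a b u + E K a b v" "E K a b (u - v) = E K a b u - E K a b v"
  "E K a b (scale s v) = scale s (E K a b v)" "E K a b 0 = 0"
  by (simp_all add: E_def an_linear cr_linear scale_right_distrib scale_right_diff_distrib sum.distrib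
      sum_subtractf scale_sum_right mult.commute)

lemma E_sum: "E K a b (sum f A) = (\<Sum>x\<in>A. E K a b (f x))"
  by (induction A rule: infinite_finite_induct) (auto simp: E_linear)

lemma E_adjoint:
  assumes "a < n" "b < n"
  shows "ip (E K a b u) v = ip u (E K b a v)"
  using assms by (simp add: E_def ip_sum ip_linear ip_right ip_cr ip_an)

lemma E_vac: "E K a b vac = 0"
  by (simp add: E_def an_def creation cr_linear)

text \<open>\<open>E K a b\<close> is a derivation on words that replaces a letter (b, k) by (a, k);
  the factor 1/(k+1) in its definition cancels the one from the Heisenberg relation.\<close>

lemma E_cr:
  assumes "a < n" "b < n" "c < n"
  shows "E K a b (cr \<alpha> (c, k) v) = cr \<alpha> (c, k) (E K a b v) + (if b = c \<and> k < K then cr \<alpha> (a, k) v else 0)"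
proof -
  have "E K a b (cr \<alpha> (c, k) v) = (\<Sum>l<K. scale (1 / of_nat (Suc l)) (cr \<alpha> (c, k) (cr \<alpha> (a, l) (an \<alpha> (b, l) v)))
      + (if l = k then if b = c then cr \<alpha> (a, l) v else 0 else 0))"
    unfolding E_def
  proof (intro sum.cong refl)
    fix l
    have "of_nat (Suc l) \<noteq> (0::complex)" unfolding of_nat_eq_0_iff by simp
    then show "scale (1 / of_nat (Suc l)) (cr \<alpha> (a, l) (an \<alpha> (b, l) (cr \<alpha> (c, k) v)))
      = scale (1 / of_nat (Suc l)) (cr \<alpha> (c, k) (cr \<alpha> (a, l) (an \<alpha> (b, l) v)))
      + (if l = k then if b = c then cr \<alpha> (a, l) v else 0 else 0)"
      using assms
      by (simp add: an_cr[OF heisenberg_family_\<alpha>] cr_linear scale_right_distrib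
          cr_cr[OF heisenberg_family_\<alpha>, of "(a, l)" "(c, k)"] del: of_nat_Suc)
  qed
  also have "\<dots> = cr \<alpha> (c, k) (E K a b v) + (if b = c \<and> k < K then cr \<alpha> (a, k) v else 0)"
    using assms by (simp add: sum.distrib E_def cr_sum cr_linear)
  finally show ?thesis .
qed

definition letters :: "nat \<Rightarrow> nat \<Rightarrow> (nat \<times> nat) multiset \<Rightarrow> nat" where
  "letters K a M = (\<Sum>k<K. count M (a, k))"

lemma coef_E_diag:
  assumes "a < n"
  shows "coef (E K a a v) M = of_nat (letters K a M) * coef v M"
proof -
  have "coef (scale (1 / of_nat (Suc k)) (cr \<alpha> (a, k) (an \<alpha> (a, k) v))) M = of_nat (count M (a, k)) * coef v M" for k
  proof (cases "(a, k) \<in># M")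
    case True
    then obtain N where N: "M = add_mset (a, k) N" by (metis insert_DiffM)
    have "of_nat (Suc k) \<noteq> (0::complex)" unfolding of_nat_eq_0_iff by simp
    then show ?thesis
      using assms by (simp add: N coef_linear coef_cr coef_an del: of_nat_Suc mult_Suc mult_Suc_right)
  next
    case False
    then have "count M (a, k) = 0" by (simp add: not_in_iff)
    then show ?thesis using assms False by (simp add: coef_linear coef_cr)
  qed
  then show ?thesis
    by (simp only: E_def coef_sum letters_def of_nat_sum sum_distrib_right)
qed

lemma ip_E_diag:
  assumes "a < n"
  shows "ip (E K a a v) (E K a a v) - ip (E K a a v) v
    = of_real (\<Sum>M | coef v M \<noteq> 0. nrm M * (cmod (coef v M))\<^sup>2 * (real (letters K a M) * (real (letters K a M) - 1)))"
proof -
  have "ip (E K a a v) (E K a a v) = (\<Sum>M | coef v M \<noteq> 0. of_real (nrm M) * coef (E K a a v) M * cnj (coef (E K a a v) M))"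
    by (rule ip_superset) (use coef_finite in \<open>auto simp: coef_E_diag assms\<close>)
  then show ?thesis
    by (simp add: ip_def coef_E_diag[OF assms] mult_cnj_self algebra_simps flip: sum_subtractf)
qed

text \<open>The operator T of the overview. Subtracting the counting operators cancels the
  contractions from normally ordering the square of \<open>E K a b\<close>, and produces the
  eigenvalues N (N - 1) on the diagonal.\<close>

definition casimir :: "nat \<Rightarrow> 'v \<Rightarrow> 'v" where
  "casimir K v = (\<Sum>a<n. \<Sum>b<n. E K a b (E K b a v)) - (\<Sum>a<n. E K a a v)"

text \<open>
  The inner product of \<open>casimir K f\<close> with \<open>f\<close> is the sum of the squared norms of the \<open>E K b a f\<close>, \<open>a \<noteq> b\<close>,
  and of a diagonal form with the eigenvalues \<open>N (N - 1)\<close>, where \<open>N\<close> counts the letters with first index \<open>a\<close>.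
  If all these numbers are even, the form is definite on words other than the empty one.
\<close>

lemma casimir_injective:
  assumes even: "\<And>M a. coef f M \<noteq> 0 \<Longrightarrow> a < n \<Longrightarrow> even (letters K a M)"
    and K: "\<And>M x. coef f M \<noteq> 0 \<Longrightarrow> x \<in># M \<Longrightarrow> snd x < K"
    and zero: "casimir K f + scale (coef f {#}) vac = 0"
  shows "f = 0"
proof -
  let ?e = "\<lambda>a. \<Sum>M | coef f M \<noteq> 0. nrm M * (cmod (coef f M))\<^sup>2 * (real (letters K a M) * (real (letters K a M) - 1))"
  have term_nonneg: "nrm M * (cmod (coef f M))\<^sup>2 * (real (letters K a M) * (real (letters K a M) - 1)) \<ge> 0" for M a
    by (cases "letters K a M") (auto simp: nrm_pos less_imp_le)
  have vac: "ip vac f = cnj (coef f {#})"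
    using ip_superset[of "{M. coef vac M \<noteq> 0} \<union> {M. coef f M \<noteq> 0}" f vac] coef_finite
    by (simp add: coef_vac if_distrib[of "\<lambda>x. _ * x"] if_distrib[of "\<lambda>x. x * _"] cong: if_cong)
  have "ip (casimir K f) f = (\<Sum>a<n. \<Sum>b<n. ip (E K b a f) (E K b a f)) - (\<Sum>a<n. ip (E K a a f) f)"
    by (simp add: casimir_def ip_linear ip_sum E_adjoint)
  also have "(\<Sum>a<n. \<Sum>b<n. ip (E K b a f) (E K b a f))
      = (\<Sum>a<n. \<Sum>b\<in>{..<n} - {a}. ip (E K b a f) (E K b a f)) + (\<Sum>a<n. ip (E K a a f) (E K a a f))"
    unfolding sum.distrib[symmetric] by (intro sum.cong refl) (simp add: sum.remove)
  finally have "ip (casimir K f) f = (\<Sum>a<n. \<Sum>b\<in>{..<n} - {a}. ip (E K b a f) (E K b a f)) + of_real (\<Sum>a<n. ?e a)"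
    by (simp add: ip_E_diag flip: sum_subtractf)
  moreover have "ip (casimir K f + scale (coef f {#}) vac) f = 0"
    by (simp add: zero ip_linear)
  ultimately have "(\<Sum>a<n. \<Sum>b\<in>{..<n} - {a}. ip (E K b a f) (E K b a f)) + of_real (\<Sum>a<n. ?e a)
      + of_real ((cmod (coef f {#}))\<^sup>2) = 0"
    by (simp add: ip_linear vac mult_cnj_self)
  from arg_cong[OF this, of Re]
  have "(\<Sum>a<n. \<Sum>b\<in>{..<n} - {a}. Re (ip (E K b a f) (E K b a f))) + (\<Sum>a<n. ?e a) + (cmod (coef f {#}))\<^sup>2 = 0"
    by (simp del: of_real_sum)
  moreover have "(\<Sum>a<n. \<Sum>b\<in>{..<n} - {a}. Re (ip (E K b a f) (E K b a f))) \<ge> 0"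
    by (intro sum_nonneg ip_self_nonneg)
  moreover have "(\<Sum>a<n. ?e a) \<ge> 0"
    by (intro sum_nonneg term_nonneg)
  ultimately have sums: "(\<Sum>a<n. ?e a) = 0" and empty: "coef f {#} = 0"
    by (smt (verit) zero_le_power2 power2_eq_square mult_eq_0_iff norm_eq_zero)+
  have "coef f M = 0" for M
  proof (rule ccontr)
    assume M: "coef f M \<noteq> 0"
    have "letters K a M = 0" if a: "a < n" for a
    proof -
      have "?e a = 0"
        using sums a by (subst (asm) sum_nonneg_eq_0_iff) (auto intro!: sum_nonneg term_nonneg)
      then have "nrm M * (cmod (coef f M))\<^sup>2 * (real (letters K a M) * (real (letters K a M) - 1)) = 0"
        using M coef_finite by (subst (asm) sum_nonneg_eq_0_iff) (auto intro: term_nonneg)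
      then have "letters K a M = 0 \<or> letters K a M = 1"
        using M nrm_pos[of M] by auto
      then show ?thesis using even[OF M a] by auto
    qed
    moreover have "M \<in> words" using M by (rule coef_nonzero_words)
    ultimately have "x \<notin># M" for x
    proof (intro notI)
      assume x: "x \<in># M"
      obtain a k where ak: "x = (a, k)" by (cases x)
      have "a < n" "k < K" using x K[OF M x] \<open>M \<in> words\<close> ak by (auto simp: words_def)
      then have "count M (a, k) = 0"
        using \<open>\<And>a. a < n \<Longrightarrow> letters K a M = 0\<close> by (auto simp: letters_def)
      then show False using x ak by (simp add: count_eq_zero_iff)
    qed
    then have "M = {#}" by (simp add: multiset_eqI not_in_iff)
    then show False using M empty by simp
  qed
  then show ?thesis by (intro coef_ext) (simp add: coef_linear)
qed

section \<open>Parity from reflections\<close>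

definition reflection :: "nat \<Rightarrow> complex mat" where
  "reflection a = mat n n (\<lambda>(i, j). if i = j then if i = a then -1 else 1 else 0)"

lemma reflection_orthogonal: "reflection a \<in> complex_orthogonal_group n"
proof -
  have "transpose_mat (reflection a) * reflection a = 1\<^sub>m n"
  proof (rule eq_matI)
    fix i j assume "i < dim_row (1\<^sub>m n :: complex mat)" "j < dim_col (1\<^sub>m n :: complex mat)"
    then have ij: "i < n" "j < n" by auto
    then have "(transpose_mat (reflection a) * reflection a) $$ (i, j)
        = (\<Sum>k<n. (if k = i then if k = a then -1 else 1 else 0) * (if k = j then if k = a then -1 else 1 else 0))"
      by (auto simp: scalar_prod_def atLeast0LessThan reflection_def intro!: sum.cong)
    also have "\<dots> = (\<Sum>k<n. if k = i then if i = j then 1 else 0 else 0)"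
      by (intro sum.cong refl) auto
    finally show "(transpose_mat (reflection a) * reflection a) $$ (i, j) = 1\<^sub>m n $$ (i, j)"
      using ij by simp
  qed (auto simp: reflection_def)
  then show ?thesis by (simp add: complex_orthogonal_group_def reflection_def)
qed

lemma rotated_reflection: "i < n \<Longrightarrow> rotated (reflection a) i = scale (if i = a then -1 else 1) (\<alpha> i)"
proof -
  assume i: "i < n"
  have "rotated (reflection a) i = (\<Sum>k<n. if k = i then scale (if i = a then -1 else 1) (\<alpha> i) else 0)"
    unfolding rotated_def by (intro sum.cong refl) (use i in \<open>auto simp: reflection_def\<close>)
  then show ?thesis using i by simp
qed

lemma act_reflection_mono:
  assumes "M \<in> words" "\<And>x. x \<in># M \<Longrightarrow> snd x < K"
  shows "act (reflection a) (mono \<alpha> M) = scale ((-1) ^ letters K a M) (mono \<alpha> M)"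
  using assms
proof (induction M)
  case empty
  then show ?case by (simp add: letters_def)
next
  case (add x M)
  note fam = heisenberg_family_rotated[OF reflection_orthogonal]
  have x: "fst x < n" "snd x < K" using add.prems by auto
  have IH: "act (reflection a) (mono \<alpha> M) = scale ((-1) ^ letters K a M) (mono \<alpha> M)"
    using add by simp
  have "letters K a (add_mset x M) = (\<Sum>k<K. if k = snd x then if fst x = a then 1 else 0 else 0) + letters K a M"
    unfolding letters_def sum.distrib[symmetric] by (intro sum.cong refl) (auto simp: prod_eq_iff)
  then have l: "letters K a (add_mset x M) = (if fst x = a then Suc (letters K a M) else letters K a M)"
    using x by simp
  have "act (reflection a) (mono \<alpha> (add_mset x M))
      = Y (rotated (reflection a) (fst x)) (- int (snd x) - 1) (act (reflection a) (mono \<alpha> M))"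
    using x by (simp add: mono_add_mset[OF heisenberg_family_\<alpha>] cr_def phi_mode[OF fam])
  then show ?case
    using x by (simp add: IH l rotated_reflection Y_linear mono_add_mset[OF heisenberg_family_\<alpha>] cr_def)
qed

lemma Inv_even_letters:
  assumes f: "f \<in> Inv" and K: "\<And>M x. coef f M \<noteq> 0 \<Longrightarrow> x \<in># M \<Longrightarrow> snd x < K" and M: "coef f M \<noteq> 0"
  shows "even (letters K a M)"
proof -
  have "f = act (reflection a) f"
    using f reflection_orthogonal by (simp add: invariants_iff)
  also have "\<dots> = (\<Sum>N | coef f N \<noteq> 0. scale (coef f N * (-1) ^ letters K a N) (mono \<alpha> N))"
  proof -
    have "mono (rotated (reflection a)) N = scale ((-1) ^ letters K a N) (mono \<alpha> N)" if "coef f N \<noteq> 0" for N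
      using act_reflection_mono[of N K a] phi_mono[of N "rotated (reflection a)"] K[OF that]
        coef_nonzero_words[OF that] by simp
    then show ?thesis
      unfolding phi_superset[OF coef_finite subset_refl] by (intro sum.cong refl) simp
  qed
  finally have "coef f M = coef (\<Sum>N | coef f N \<noteq> 0. scale (coef f N * (-1) ^ letters K a N) (mono \<alpha> N)) M"
    by simp
  also have "\<dots> = (\<Sum>N | coef f N \<noteq> 0. if N = M then coef f N * (-1) ^ letters K a N else 0)"
    unfolding coef_sum coef_linear by (intro sum.cong refl) (auto simp: coef_mono coef_nonzero_words)
  also have "\<dots> = coef f M * (-1) ^ letters K a M"
    using coef_finite M by (simp add: sum.delta)
  finally show ?thesis using M by (cases "even (letters K a M)") auto
qed

text \<open>
  A complex rotation in the plane of \<open>a\<close> and \<open>b\<close> with cosine 5/4 and sine 3i/4; its eigenvectors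
  are the isotropic vectors \<open>\<alpha> a \<plusminus> i \<alpha> b\<close>, with eigenvalues 2 and 1/2.
\<close>

definition rotation :: "nat \<Rightarrow> nat \<Rightarrow> complex mat" where
  "rotation a b = mat n n (\<lambda>(i, j).
    if j = a then if i = a then 5/4 else if i = b then 3/4 * \<i> else 0
    else if j = b then if i = a then - 3/4 * \<i> else if i = b then 5/4 else 0
    else if i = j then 1 else 0)"

section \<open>From a fixed rotation to the infinitesimal rotation\<close>

context
  fixes a b :: nat
  assumes ab: "a < n" "b < n" "a \<noteq> b"
begin

lemma sum_two: "(\<And>i. i < n \<Longrightarrow> i \<noteq> a \<Longrightarrow> i \<noteq> b \<Longrightarrow> f i = 0) \<Longrightarrow> (\<Sum>i<n. f i) = f a + (f b :: 'b::ab_group_add)"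
proof -
  assume "\<And>i. i < n \<Longrightarrow> i \<noteq> a \<Longrightarrow> i \<noteq> b \<Longrightarrow> f i = 0"
  then have "(\<Sum>i<n. f i) = (\<Sum>i\<in>{a, b}. f i)"
    by (intro sum.mono_neutral_right) (use ab in auto)
  then show ?thesis using ab by simp
qed

lemma rotation_orthogonal: "rotation a b \<in> complex_orthogonal_group n"
proof -
  have "transpose_mat (rotation a b) * rotation a b = 1\<^sub>m n"
  proof (rule eq_matI)
    fix i j assume "i < dim_row (1\<^sub>m n :: complex mat)" "j < dim_col (1\<^sub>m n :: complex mat)"
    then have ij: "i < n" "j < n" by auto
    then have eq: "(transpose_mat (rotation a b) * rotation a b) $$ (i, j)
        = (\<Sum>k<n. rotation a b $$ (k, i) * rotation a b $$ (k, j))"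
      by (auto simp: scalar_prod_def atLeast0LessThan rotation_def intro!: sum.cong)
    have "(\<Sum>k<n. rotation a b $$ (k, i) * rotation a b $$ (k, j)) = (if i = j then 1 else 0)"
    proof (cases "i \<in> {a, b} \<or> j \<in> {a, b}")
      case True
      then have "(\<Sum>k<n. rotation a b $$ (k, i) * rotation a b $$ (k, j))
        = rotation a b $$ (a, i) * rotation a b $$ (a, j) + rotation a b $$ (b, i) * rotation a b $$ (b, j)"
        by (intro sum_two) (use ij in \<open>auto simp: rotation_def\<close>)
      then show ?thesis
        using True ij ab by (auto simp: rotation_def)
    next
      case False
      have "(\<Sum>k<n. rotation a b $$ (k, i) * rotation a b $$ (k, j)) = (\<Sum>k<n. if k = i then if i = j then 1 else 0 else 0)"
        by (intro sum.cong refl) (use ij False in \<open>auto simp: rotation_def\<close>)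
      then show ?thesis using ij by simp
    qed
    then show "(transpose_mat (rotation a b) * rotation a b) $$ (i, j) = 1\<^sub>m n $$ (i, j)"
      using ij eq by simp
  qed (auto simp: rotation_def)
  then show ?thesis by (simp add: complex_orthogonal_group_def rotation_def)
qed

lemma rotated_rotation:
  "rotated (rotation a b) a = scale (5/4) (\<alpha> a) + scale (3/4 * \<i>) (\<alpha> b)"
  "rotated (rotation a b) b = scale (- 3/4 * \<i>) (\<alpha> a) + scale (5/4) (\<alpha> b)"
  "c < n \<Longrightarrow> c \<noteq> a \<Longrightarrow> c \<noteq> b \<Longrightarrow> rotated (rotation a b) c = \<alpha> c"
proof -
  show "rotated (rotation a b) a = scale (5/4) (\<alpha> a) + scale (3/4 * \<i>) (\<alpha> b)"
    unfolding rotated_def by (subst sum_two) (use ab in \<open>auto simp: rotation_def\<close>)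
  show "rotated (rotation a b) b = scale (- 3/4 * \<i>) (\<alpha> a) + scale (5/4) (\<alpha> b)"
    unfolding rotated_def by (subst sum_two) (use ab in \<open>auto simp: rotation_def\<close>)
  assume c: "c < n" "c \<noteq> a" "c \<noteq> b"
  have "rotated (rotation a b) c = (\<Sum>i<n. if i = c then \<alpha> c else 0)"
    unfolding rotated_def by (intro sum.cong refl) (use c in \<open>auto simp: rotation_def\<close>)
  then show "rotated (rotation a b) c = \<alpha> c" using c by simp
qed

definition L :: "nat \<Rightarrow> 'v \<Rightarrow> 'v" where
  "L K v = E K a b v - E K b a v"

lemma L_linear: "L K (u + v) = L K u + L K v" "L K (scale s v) = scale s (L K v)" "L K 0 = 0"
  "L K (u - v) = L K u - L K v"
  by (simp_all add: L_def E_linear scale_right_diff_distrib)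

lemma L_cr:
  assumes "c < n" "k < K"
  shows "L K (cr \<alpha> (c, k) v) = cr \<alpha> (c, k) (L K v)
    + (if c = b then cr \<alpha> (a, k) v else 0) - (if c = a then cr \<alpha> (b, k) v else 0)"
  using assms ab by (auto simp: L_def E_cr cr_linear)

text \<open>Both eigenvalues are governed by the same integer r: on these spaces the rotation is
  formally 2 to the power L / i. This is what replaces differentiation.\<close>

definition joint :: "nat \<Rightarrow> int \<Rightarrow> 'v set" where
  "joint K r = {v. L K v = scale (\<i> * of_int r) v \<and> act (rotation a b) v = scale (2 powi r) v}"

lemma joint_scale: "v \<in> joint K r \<Longrightarrow> scale s v \<in> joint K r"
  by (simp add: joint_def L_linear phi_scale mult.commute)

lemma joint_add: "u \<in> joint K r \<Longrightarrow> v \<in> joint K r \<Longrightarrow> u + v \<in> joint K r"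
  by (simp add: joint_def L_linear phi_add scale_right_distrib)

lemma joint_zero: "0 \<in> joint K r"
  by (simp add: joint_def L_linear)

lemma act_rotation_cr:
  assumes "c < n"
  shows "act (rotation a b) (cr \<alpha> (c, k) v) = (if c = a then
      scale (5/4) (cr \<alpha> (a, k) (act (rotation a b) v)) + scale (3/4 * \<i>) (cr \<alpha> (b, k) (act (rotation a b) v))
    else if c = b then
      scale (- 3/4 * \<i>) (cr \<alpha> (a, k) (act (rotation a b) v)) + scale (5/4) (cr \<alpha> (b, k) (act (rotation a b) v))
    else cr \<alpha> (c, k) (act (rotation a b) v))"
  using assms ab phi_mode[OF heisenberg_family_rotated[OF rotation_orthogonal] assms]
  by (auto simp: cr_def rotated_rotation Y_linear)

text \<open>The isotropic combinations have eigenvalue i or -i under L and 2 or 1/2 under the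
  rotation, so creating one shifts r by 1 or -1 in both equations.\<close>

lemma joint_isotropic:
  assumes v: "v \<in> joint K r" and k: "k < K"
  shows "cr \<alpha> (a, k) v + scale \<i> (cr \<alpha> (b, k) v) \<in> joint K (r + 1)"
    "cr \<alpha> (a, k) v - scale \<i> (cr \<alpha> (b, k) v) \<in> joint K (r - 1)"
proof -
  have powi: "(2::complex) powi (r + 1) = 2 * 2 powi r" "(2::complex) powi (r - 1) = 1/2 * 2 powi r"
    by (simp_all add: power_int_add power_int_diff)
  have L: "L K v = scale (\<i> * of_int r) v" and g: "act (rotation a b) v = scale (2 powi r) v"
    using v by (auto simp: joint_def)
  let ?x = "cr \<alpha> (a, k) v" and ?y = "cr \<alpha> (b, k) v" and ?p = "2 powi r :: complex"
  have L1: "L K ?x = scale (\<i> * of_int r) ?x + scale (-1) ?y" "L K ?y = scale 1 ?x + scale (\<i> * of_int r) ?y"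
    using ab k by (auto simp: L_cr L cr_linear)
  have g1: "act (rotation a b) ?x = scale (5/4 * ?p) ?x + scale (3/4 * \<i> * ?p) ?y"
    "act (rotation a b) ?y = scale (- 3/4 * \<i> * ?p) ?x + scale (5/4 * ?p) ?y"
    using ab by (auto simp: act_rotation_cr g cr_linear)
  \<comment> \<open>The numbers p, q, p', q' are the matrix entries of an operator on the two
    created vectors; the conditions say that (1, i) is an eigenvector with value s.\<close>
  have plus: "(scale p ?x + scale q ?y) + scale \<i> (scale p' ?x + scale q' ?y) = scale s (?x + scale \<i> ?y)"
    if "p + \<i> * p' = s" "q + \<i> * q' = s * \<i>" for p q p' q' s
  proof -
    have "(scale p ?x + scale q ?y) + scale \<i> (scale p' ?x + scale q' ?y) = scale (p + \<i> * p') ?x + scale (q + \<i> * q') ?y"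
      by (simp only: scale_right_distrib scale_left_distrib scale_scale add_ac)
    then show ?thesis unfolding that by (simp add: scale_right_distrib)
  qed
  have minus: "(scale p ?x + scale q ?y) - scale \<i> (scale p' ?x + scale q' ?y) = scale s (?x - scale \<i> ?y)"
    if "p - \<i> * p' = s" "q - \<i> * q' = - (s * \<i>)" for p q p' q' s
  proof -
    have "(scale p ?x + scale q ?y) - scale \<i> (scale p' ?x + scale q' ?y) = scale (p - \<i> * p') ?x + scale (q - \<i> * q') ?y"
      by (simp only: scale_right_distrib scale_left_diff_distrib scale_scale add_diff_add)
    then show ?thesis unfolding that by (simp add: scale_right_diff_distrib)
  qed
  have "L K (?x + scale \<i> ?y) = scale (\<i> * of_int (r + 1)) (?x + scale \<i> ?y)"
    unfolding L_linear L1 by (rule plus) (auto simp: algebra_simps)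
  moreover have "act (rotation a b) (?x + scale \<i> ?y) = scale (2 * ?p) (?x + scale \<i> ?y)"
    unfolding phi_add phi_scale g1 by (rule plus) (auto simp: algebra_simps)
  ultimately show "?x + scale \<i> ?y \<in> joint K (r + 1)"
    by (simp add: joint_def powi)
  have "L K (?x - scale \<i> ?y) = scale (\<i> * of_int (r - 1)) (?x - scale \<i> ?y)"
    unfolding L_linear L1 by (rule minus) (auto simp: algebra_simps)
  moreover have "act (rotation a b) (?x - scale \<i> ?y) = scale (1/2 * ?p) (?x - scale \<i> ?y)"
    unfolding phi_diff phi_scale g1 by (rule minus) (auto simp: algebra_simps)
  ultimately show "?x - scale \<i> ?y \<in> joint K (r - 1)"
    by (simp add: joint_def powi)
qed

lemma joint_other:
  assumes "v \<in> joint K r" "k < K" "c < n" "c \<noteq> a" "c \<noteq> b"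
  shows "cr \<alpha> (c, k) v \<in> joint K r"
  using assms by (simp add: joint_def L_cr act_rotation_cr cr_linear)

text \<open>The two letters of the plane are combinations of isotropic ones, and letters outside the
  plane leave r unchanged.\<close>

lemma cr_joint_span:
  assumes "v \<in> span (\<Union>r. joint K r)" "k < K" "c < n"
  shows "cr \<alpha> (c, k) v \<in> span (\<Union>r. joint K r)"
  using assms(1)
proof (induction v rule: span_induct_alt)
  case base
  then show ?case by (simp add: cr_linear span_zero)
next
  case (step s x y)
  then obtain r where x: "x \<in> joint K r" by auto
  let ?S = "span (\<Union>r. joint K r)"
  have J: "u \<in> ?S" if "u \<in> joint K t" for u t
    using that by (intro span_base) auto
  let ?p = "cr \<alpha> (a, k) x + scale \<i> (cr \<alpha> (b, k) x)" and ?m = "cr \<alpha> (a, k) x - scale \<i> (cr \<alpha> (b, k) x)"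
  have pm: "?p \<in> ?S" "?m \<in> ?S" using J joint_isotropic[OF x assms(2)] by blast+
  have "cr \<alpha> (c, k) x \<in> ?S"
  proof -
    consider "c = a" | "c = b" | "c \<noteq> a" "c \<noteq> b" by blast
    then show ?thesis
    proof cases
      case 1
      have "cr \<alpha> (a, k) x = scale (1/2) (?p + ?m)"
        by (simp flip: scale_left_distrib add: scale_right_distrib)
      also have "\<dots> \<in> ?S" by (rule span_scale[OF span_add[OF pm]])
      finally show ?thesis using 1 by simp
    next
      case 2
      have "cr \<alpha> (b, k) x = scale (- \<i> / 2) (?p - ?m)"
        by (simp flip: scale_left_distrib add: scale_right_distrib)
      also have "\<dots> \<in> ?S" by (rule span_scale[OF span_diff[OF pm]])
      finally show ?thesis using 2 by simp
    next
      case 3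
      then show ?thesis using J joint_other[OF x assms(2,3)] by blast
    qed
  qed
  then show ?case using step by (simp add: cr_linear span_add span_scale)
qed

lemma mono_joint_span:
  assumes "M \<in> words" "\<And>x. x \<in># M \<Longrightarrow> snd x < K"
  shows "mono \<alpha> M \<in> span (\<Union>r. joint K r)"
  using assms
proof (induction M)
  case empty
  have "vac \<in> joint K 0" by (simp add: joint_def L_def E_vac)
  then show ?case by (auto intro: span_base)
next
  case (add x M)
  then show ?case
    using cr_joint_span[of "mono \<alpha> M" K "snd x" "fst x"] by (simp add: mono_add_mset[OF heisenberg_family_\<alpha>])
qed

lemma span_joint_decomp:
  assumes "v \<in> span (\<Union>r. joint K r)"
  obtains R c where "finite R" "\<And>r. c r \<in> joint K r" "v = (\<Sum>r\<in>R. c r)"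
proof -
  have "\<exists>R c. finite R \<and> (\<forall>r. c r \<in> joint K r) \<and> v = (\<Sum>r\<in>R. c r)"
    using assms
  proof (induction v rule: span_induct_alt)
    case base
    show ?case by (intro exI[of _ "{}"] exI[of _ "\<lambda>_. 0"]) (simp add: joint_zero)
  next
    case (step s x y)
    then obtain R c where c: "finite R" "\<And>r. c r \<in> joint K r" "y = (\<Sum>r\<in>R. c r)" by blast
    obtain t where t: "x \<in> joint K t" using step by blast
    let ?c = "\<lambda>r. (if r = t then scale s x else 0) + (if r \<in> R then c r else 0)"
    have "sum ?c (insert t R) = scale s x + y"
      using c(1) by (simp add: sum.distrib c(3) sum.inter_restrict[symmetric] insert_absorb Int_absorb1
          subset_insertI)
    moreover have "?c r \<in> joint K r" for r
      using t c(2) by (intro joint_add) (auto intro: joint_scale joint_zero)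
    ultimately show ?case
      using c(1) by (intro exI[of _ "insert t R"] exI[of _ ?c]) simp
  qed
  then show thesis using that by blast
qed

lemma inj_powi: "inj (\<lambda>r. 2 powi r :: complex)"
proof (rule injI, rule ccontr)
  fix r s assume eq: "(2 powi r :: complex) = 2 powi s" and ne: "r \<noteq> s"
  have "of_real (2 powi r) = (of_real (2 powi s) :: complex)" using eq by simp
  then have eq': "(2::real) powi r = 2 powi s" by (simp only: of_real_eq_iff)
  have "(2::real) powi r < 2 powi s \<or> (2::real) powi s < 2 powi r"
    using ne by (cases r s rule: linorder_cases) (auto intro: power_int_strict_increasing)
  then show False using eq' by simp
qed

text \<open>Components of a fixed vector with 2^r different from 1 vanish; what remains has r = 0,
  where L is zero.\<close>

lemma L_eq_zero_of_fixed:
  assumes "v \<in> span (\<Union>r. joint K r)" "act (rotation a b) v = v"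
  shows "L K v = 0"
proof -
  obtain R c where c: "finite R" "\<And>r. c r \<in> joint K r" "v = (\<Sum>r\<in>R. c r)"
    using span_joint_decomp[OF assms(1)] by blast
  have cr: "L K (c r) = scale (\<i> * of_int r) (c r)" "act (rotation a b) (c r) = scale (2 powi r) (c r)" for r
    using c(2)[of r] by (auto simp: joint_def)
  have sum0: "(\<Sum>r\<in>R. scale (2 powi r - 1) (c r)) = 0"
    using assms(2) unfolding c(3) phi_sum cr(2) by (simp add: scale_left_diff_distrib sum_subtractf)
  have "scale (2 powi r - 1) (c r) = 0" if "r \<in> R" for r
  proof (rule eigenvectors_sum_zero[where f="act (rotation a b)" and \<mu>="\<lambda>r. 2 powi r" and R=R])
    show "inj_on (\<lambda>r. 2 powi r :: complex) R" using inj_powi by (rule inj_on_subset) simp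
  qed (use c(1) sum0 that in \<open>auto simp: phi_add phi_scale cr mult.commute\<close>)
  moreover have "(2 powi r :: complex) \<noteq> 1" if "r \<noteq> 0" for r
    using injD[OF inj_powi, of r 0] that by auto
  ultimately have "scale (\<i> * of_int r) (c r) = 0" if "r \<in> R" for r
    using that by (cases "r = 0") auto
  then have "(\<Sum>r\<in>R. L K (c r)) = 0"
    unfolding cr by (intro sum.neutral) blast
  moreover have "L K v = (\<Sum>r\<in>R. L K (c r))"
    unfolding c(3) by (induction R rule: infinite_finite_induct) (auto simp: L_linear)
  ultimately show ?thesis by simp
qed

end

lemma Inv_E_symmetric:
  assumes f: "f \<in> Inv" and K: "\<And>M x. coef f M \<noteq> 0 \<Longrightarrow> x \<in># M \<Longrightarrow> snd x < K" and ab: "a < n" "b < n"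
  shows "E K a b f = E K b a f"
proof (cases "a = b")
  case False
  have "f = (\<Sum>M | coef f M \<noteq> 0. scale (coef f M) (mono \<alpha> M))" by (rule coef_expansion)
  also have "\<dots> \<in> span (\<Union>r. joint a b K r)"
    using K ab False by (intro span_sum span_scale mono_joint_span) (auto dest: coef_nonzero_words)
  finally have "L a b K f = 0"
    using f rotation_orthogonal[OF ab False] ab False
    by (intro L_eq_zero_of_fixed) (auto simp: invariants_iff)
  then show ?thesis using ab False by (simp add: L_def)
qed simp

text \<open>In the notation of the overview, \<open>Qm k l\<close> is Q(-k-1, -l-1) and
  \<open>Qp k l\<close> is Q(k+1, l+1).\<close>

definition Qm :: "nat \<Rightarrow> nat \<Rightarrow> 'v \<Rightarrow> 'v" where
  "Qm k l v = (\<Sum>a<n. cr \<alpha> (a, k) (cr \<alpha> (a, l) v))"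

definition Qp :: "nat \<Rightarrow> nat \<Rightarrow> 'v \<Rightarrow> 'v" where
  "Qp k l v = (\<Sum>a<n. an \<alpha> (a, k) (an \<alpha> (a, l) v))"

lemma Qm_alt: "Qm k l v = (\<Sum>a<n. Y (\<alpha> a) (- int k - 1) (Y (\<alpha> a) (- int l - 1) v))"
  by (simp add: Qm_def cr_def)

lemma Qm_zero [simp]: "Qm k l 0 = 0"
  by (simp add: Qm_def cr_linear)

lemma Qm_Inv: "v \<in> Inv \<Longrightarrow> Qm k l v \<in> Inv"
  by (simp add: invariants_iff Qm_alt act_quadratic)

lemma Qp_Inv: "v \<in> Inv \<Longrightarrow> Qp k l v \<in> Inv"
  by (simp add: invariants_iff Qp_def an_def act_quadratic)

text \<open>Moving the inner creation mode to the left of the annihilation mode leaves a contraction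
  only for a = b.\<close>

lemma E_E:
  assumes "a < n" "b < n"
  shows "E K a b (E K a b v) = (\<Sum>l<K. \<Sum>k<K. scale (1 / of_nat (Suc l) * (1 / of_nat (Suc k)))
      (cr \<alpha> (a, l) (cr \<alpha> (a, k) (an \<alpha> (b, k) (an \<alpha> (b, l) v))))) + (if a = b then E K a a v else 0)"
proof -
  have "E K a b (E K a b v) = (\<Sum>l<K. scale (1 / of_nat (Suc l)) (E K a b (cr \<alpha> (a, l) (an \<alpha> (b, l) v))))"
    by (subst (2) E_def) (simp add: E_sum E_linear)
  also have "\<dots> = (\<Sum>l<K. scale (1 / of_nat (Suc l)) (cr \<alpha> (a, l) (E K a b (an \<alpha> (b, l) v)))
      + (if a = b then scale (1 / of_nat (Suc l)) (cr \<alpha> (a, l) (an \<alpha> (a, l) v)) else 0))"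
    using assms by (intro sum.cong refl) (simp add: E_cr scale_right_distrib)
  also have "\<dots> = (\<Sum>l<K. \<Sum>k<K. scale (1 / of_nat (Suc l) * (1 / of_nat (Suc k)))
      (cr \<alpha> (a, l) (cr \<alpha> (a, k) (an \<alpha> (b, k) (an \<alpha> (b, l) v))))) + (if a = b then E K a a v else 0)"
    unfolding sum.distrib E_def[of K a b] using assms
    by (simp add: cr_sum cr_linear scale_sum_right E_def)
  finally show ?thesis .
qed

text \<open>Invariance replaces the inner \<open>E K b a f\<close> by \<open>E K a b f\<close>.
  After normal ordering a occurs only in creation and b only in annihilation modes, so the sums over
  a and b factor, and the contractions cancel the subtracted term.\<close>

lemma casimir_Inv:
  assumes f: "f \<in> Inv" and K: "\<And>M x. coef f M \<noteq> 0 \<Longrightarrow> x \<in># M \<Longrightarrow> snd x < K"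
  shows "casimir K f = (\<Sum>l<K. \<Sum>k<K. scale (1 / of_nat (Suc l) * (1 / of_nat (Suc k))) (Qm l k (Qp k l f)))"
proof -
  let ?c = "\<lambda>l k. 1 / of_nat (Suc l) * (1 / of_nat (Suc k)) :: complex"
  let ?t = "\<lambda>a b l k. scale (?c l k) (cr \<alpha> (a, l) (cr \<alpha> (a, k) (an \<alpha> (b, k) (an \<alpha> (b, l) f))))"
  have sym: "E K b a f = E K a b f" if "a < n" "b < n" for a b
    by (rule Inv_E_symmetric[OF f _ that(2,1)]) (rule K)
  have "(\<Sum>a<n. \<Sum>b<n. E K a b (E K b a f)) = (\<Sum>a<n. \<Sum>b<n. E K a b (E K a b f))"
    by (intro sum.cong refl arg_cong[where f="E K _ _"] sym) auto
  also have "\<dots> = (\<Sum>a<n. \<Sum>b<n. (\<Sum>l<K. \<Sum>k<K. ?t a b l k) + (if a = b then E K a a f else 0))"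
    by (intro sum.cong refl) (simp add: E_E)
  also have "\<dots> = (\<Sum>a<n. \<Sum>b<n. \<Sum>l<K. \<Sum>k<K. ?t a b l k) + (\<Sum>a<n. E K a a f)"
    by (simp add: sum.distrib)
  finally have "casimir K f = (\<Sum>a<n. \<Sum>b<n. \<Sum>l<K. \<Sum>k<K. ?t a b l k)"
    by (simp add: casimir_def)
  also have "\<dots> = (\<Sum>l<K. \<Sum>a<n. \<Sum>b<n. \<Sum>k<K. ?t a b l k)"
    by (rule sum_rotate)
  also have "\<dots> = (\<Sum>l<K. \<Sum>k<K. \<Sum>a<n. \<Sum>b<n. ?t a b l k)"
    by (rule sum.cong[OF refl], rule sum_rotate)
  also have "\<dots> = (\<Sum>l<K. \<Sum>k<K. scale (?c l k) (Qm l k (Qp k l f)))"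
    by (intro sum.cong refl) (simp add: Qm_def Qp_def cr_sum scale_sum_right)
  finally show ?thesis .
qed

text \<open>The operators \<open>E K a b\<close> preserve both bounds. The weight bound limits the
  second components of letters, the degree bound the length of words; the degree is recorded because
  the later induction runs on it.\<close>

definition bounded :: "nat \<Rightarrow> nat \<Rightarrow> 'v set" where
  "bounded w d = {v. \<forall>M. coef v M \<noteq> 0 \<longrightarrow> wt M \<le> w \<and> size M \<le> d}"

lemma subspace_bounded: "subspace (bounded w d)"
  unfolding subspace_def bounded_def
  by (auto simp: coef_linear) (metis add.right_neutral)+

lemma E_bounded:
  assumes "v \<in> bounded w d" "a < n" "b < n"
  shows "E K a b v \<in> bounded w d"
proof -
  have "cr \<alpha> (a, k) (an \<alpha> (b, k) v) \<in> bounded w d" for k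
    unfolding bounded_def
  proof (intro CollectI allI impI)
    fix M assume M: "coef (cr \<alpha> (a, k) (an \<alpha> (b, k) v)) M \<noteq> 0"
    then have "(a, k) \<in># M" using assms by (auto simp: coef_cr split: if_splits)
    then obtain N where N: "M = add_mset (a, k) N" by (metis insert_DiffM)
    have "coef v (add_mset (b, k) N) \<noteq> 0"
      using M assms by (auto simp: coef_cr coef_an N)
    then show "wt M \<le> w \<and> size M \<le> d"
      using assms(1) by (auto simp: bounded_def N)
  qed
  then show ?thesis
    unfolding E_def using subspace_bounded by (intro subspace_sum subspace_scale) auto
qed

lemma snd_less_wt: "x \<in># M \<Longrightarrow> snd x < wt M"
  by (auto dest!: multi_member_split)

lemma finite_bounded_words: "finite {M \<in> words. wt M \<le> w \<and> size M \<le> d}"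
proof (rule finite_subset)
  show "{M \<in> words. wt M \<le> w \<and> size M \<le> d} \<subseteq> mset ` {xs. set xs \<subseteq> {..<n} \<times> {..<w} \<and> length xs \<le> d}"
  proof
    fix M assume M: "M \<in> {M \<in> words. wt M \<le> w \<and> size M \<le> d}"
    obtain xs where xs: "mset xs = M" using ex_mset by blast
    have "set xs \<subseteq> {..<n} \<times> {..<w}"
    proof
      fix x assume "x \<in> set xs"
      then have "x \<in># M" using xs by auto
      then have "fst x < n" "snd x < w" using M snd_less_wt[of x M] by (auto simp: words_def)
      then show "x \<in> {..<n} \<times> {..<w}" by (cases x) auto
    qed
    moreover have "length xs \<le> d" using M xs by auto
    ultimately show "M \<in> mset ` {xs. set xs \<subseteq> {..<n} \<times> {..<w} \<and> length xs \<le> d}"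
      using xs by blast
  qed
qed (intro finite_imageI finite_lists_length_le, simp)

text \<open>
  The first fundamental theorem of invariant theory for the orthogonal group: on invariants of
  bounded weight and degree, the Casimir operator plus the projection to the vacuum is injective,
  hence surjective, and it factors through the quadratic invariants.
\<close>

theorem invariants_first_fundamental:
  assumes "f \<in> Inv" "f \<in> bounded w d"
  obtains g s where "g \<in> Inv" "g \<in> bounded w d"
    "f = (\<Sum>l<w. \<Sum>k<w. scale (1 / of_nat (Suc l) * (1 / of_nat (Suc k))) (Qm l k (Qp k l g))) + scale s vac"
proof -
  let ?X = "Inv \<inter> bounded w d"
  let ?T = "\<lambda>v. casimir w v + scale (coef v {#}) vac"
  \<comment> \<open>A letter has second component below the weight of its word, so the weight bound
    \<open>w\<close> also serves as the cutoff.\<close>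
  have K: "snd x < w" if "v \<in> bounded w d" "coef v M \<noteq> 0" "x \<in># M" for v M x
    using that snd_less_wt[of x M] by (fastforce simp: bounded_def)
  have X: "subspace ?X" using subspace_Inv subspace_bounded by (rule subspace_inter)
  have "?X \<subseteq> ?T ` ?X"
  proof (rule injective_endomorphism_surjective)
    show "finite (mono \<alpha> ` {M \<in> words. wt M \<le> w \<and> size M \<le> d})"
      using finite_bounded_words by simp
    show "?X \<subseteq> span (mono \<alpha> ` {M \<in> words. wt M \<le> w \<and> size M \<le> d})"
    proof
      fix v assume v: "v \<in> ?X"
      have "v = (\<Sum>M | coef v M \<noteq> 0. scale (coef v M) (mono \<alpha> M))" by (rule coef_expansion)
      also have "\<dots> \<in> span (mono \<alpha> ` {M \<in> words. wt M \<le> w \<and> size M \<le> d})"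
        using v by (intro span_sum span_scale span_base imageI) (auto simp: bounded_def coef_nonzero_words)
      finally show "v \<in> span (mono \<alpha> ` {M \<in> words. wt M \<le> w \<and> size M \<le> d})" .
    qed
    show "Vector_Spaces.linear scale scale ?T"
      using vector_space_axioms
      by (simp add: Vector_Spaces.linear_iff casimir_def E_linear coef_linear sum.distrib
          scale_left_distrib scale_right_distrib scale_right_diff_distrib scale_sum_right)
    fix v assume v: "v \<in> ?X"
    have "casimir w v \<in> Inv"
      using v K by (subst casimir_Inv) (auto intro!: inv.W_closed(4,6) Qm_Inv Qp_Inv)
    moreover have "casimir w v \<in> bounded w d"
      unfolding casimir_def using v subspace_bounded
      by (intro subspace_diff subspace_sum E_bounded) auto
    moreover have "scale (coef v {#}) vac \<in> ?X"
      by (intro subspace_scale[OF X]) (auto simp: inv.vac_W bounded_def coef_vac)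
    ultimately show "?T v \<in> ?X"
      by (intro subspace_add[OF X]) auto
    assume "?T v = 0"
    then show "v = 0"
      using v K Inv_even_letters[of v w] by (intro casimir_injective[of v w]) auto
  qed (rule X)
  then obtain g where g: "g \<in> ?X" "f = ?T g" using assms by blast
  show thesis
  proof (rule that[of g "coef g {#}"])
    show "f = (\<Sum>l<w. \<Sum>k<w. scale (1 / of_nat (Suc l) * (1 / of_nat (Suc k))) (Qm l k (Qp k l g))) + scale (coef g {#}) vac"
      using g K by (subst casimir_Inv[symmetric]) auto
  qed (use g in auto)
qed

section \<open>Degree filtration and generation by quadratics\<close>

definition deg_le :: "nat \<Rightarrow> 'v set" where
  "deg_le d = {v. \<forall>M. coef v M \<noteq> 0 \<longrightarrow> size M \<le> d}"

text \<open>The strict bound avoids a truncated d - 1: nonnegative modes lead from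
  \<open>deg_le d\<close> to \<open>deg_less d\<close>, and arbitrary modes lead back.\<close>

definition deg_less :: "nat \<Rightarrow> 'v set" where
  "deg_less d = {v. \<forall>M. coef v M \<noteq> 0 \<longrightarrow> size M < d}"

lemma subspace_deg_le: "subspace (deg_le d)"
  unfolding subspace_def deg_le_def
  by (auto simp: coef_linear) (metis add.right_neutral)+

lemma subspace_deg_less: "subspace (deg_less d)"
  unfolding subspace_def deg_less_def
  by (auto simp: coef_linear) (metis add.right_neutral)+

lemma deg_less_Suc: "deg_less (Suc d) = deg_le d"
  by (auto simp: deg_le_def deg_less_def)

lemma zero_mode: "i < n \<Longrightarrow> Y (\<alpha> i) 0 v = 0"
  by (induction v rule: fock_induct) (auto simp: Y_linear zero_mode_mono heisenberg_family_\<alpha>)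

lemma an_deg_less:
  assumes "v \<in> deg_le d" "fst x < n"
  shows "an \<alpha> x v \<in> deg_less d"
  unfolding deg_less_def
proof (intro CollectI allI impI)
  fix M assume "coef (an \<alpha> x v) M \<noteq> 0"
  then have "coef v (add_mset x M) \<noteq> 0" using assms by (auto simp: coef_an)
  then show "size M < d" using assms by (fastforce simp: deg_le_def)
qed

lemma nonneg_mode_deg_less:
  assumes "v \<in> deg_le d" "i < n" "p \<ge> 0"
  shows "Y (\<alpha> i) p v \<in> deg_less d"
proof (cases "p = 0")
  case True
  then show ?thesis using assms zero_mode by (simp add: subspace_0[OF subspace_deg_less])
next
  case False
  then have "p = int (nat (p - 1)) + 1" using assms by simp
  then have "Y (\<alpha> i) p v = an \<alpha> (i, nat (p - 1)) v" by (simp add: an_def)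
  then show ?thesis using an_deg_less[OF assms(1), of "(i, nat (p - 1))"] assms by simp
qed

lemma mode_deg_le:
  assumes "v \<in> deg_less d" "i < n"
  shows "Y (\<alpha> i) p v \<in> deg_le d"
proof (cases "p \<ge> 0")
  case True
  have "v \<in> deg_le d" using assms by (auto simp: deg_le_def deg_less_def less_imp_le)
  then have "Y (\<alpha> i) p v \<in> deg_less d" using nonneg_mode_deg_less assms True by blast
  then show ?thesis by (auto simp: deg_le_def deg_less_def less_imp_le)
next
  case False
  then have "p = - int (nat (- p - 1)) - 1" by simp
  then have Y: "Y (\<alpha> i) p v = cr \<alpha> (i, nat (- p - 1)) v" using assms by (simp add: cr_def)
  show ?thesis
    unfolding deg_le_def Y
  proof (intro CollectI allI impI)
    fix M assume M: "coef (cr \<alpha> (i, nat (- p - 1)) v) M \<noteq> 0"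
    then have "(i, nat (- p - 1)) \<in># M" using assms by (auto simp: coef_cr split: if_splits)
    then obtain N where N: "M = add_mset (i, nat (- p - 1)) N" by (metis insert_DiffM)
    then have "coef v N \<noteq> 0" using M assms by (simp add: coef_cr)
    then have "size N < d" using assms(1) by (simp add: deg_less_def)
    then show "size M \<le> d" by (simp add: N)
  qed
qed

definition q :: "nat \<Rightarrow> nat \<Rightarrow> 'v" where
  "q k l = Qm k l vac"

lemma q_alt: "q k l = (\<Sum>a<n. Y (\<alpha> a) (- int k - 1) (D l (\<alpha> a)))"
  unfolding q_def Qm_alt D_def minus_diff_commute[of 1 "int l"] ..

text \<open>Only two creations raise the degree by two, and this happens solely in the first term
  for t = -1. In every other nonzero term of the associator formula one factor is a nonnegative
  generator mode, which lowers the degree, and the other raises it by at most one.\<close>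

lemma q_mode_leading:
  assumes h: "h \<in> deg_le d" and t: "t \<ge> -1"
  shows "Y (q k l) t h - (if t = -1 then Qm k l h else 0) \<in> deg_le d"
proof -
  have "Y (Y (\<alpha> a) (- int k - 1) (D l (\<alpha> a))) t h
      - (if t = -1 then Y (\<alpha> a) (- int k - 1) (Y (\<alpha> a) (- int l - 1) h) else 0) \<in> deg_le d"
    if a: "a < n" for a
  proof -
    let ?r = "- int k - 1"
    obtain K where K: "\<And>j. j \<ge> K \<Longrightarrow> Y (D l (\<alpha> a)) (t + int j) h = 0" "\<And>j. j \<ge> K \<Longrightarrow> Y (\<alpha> a) (int j) h = 0"
      using associator_bound by blast
    let ?t = "\<lambda>j. scale ((-1) ^ j * (of_int ?r gchoose j))
        (Y (\<alpha> a) (?r - int j) (Y (D l (\<alpha> a)) (t + int j) h)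
          - scale (sg ?r) (Y (D l (\<alpha> a)) (t + ?r - int j) (Y (\<alpha> a) (int j) h)))"
    have assoc: "Y (Y (\<alpha> a) ?r (D l (\<alpha> a))) t h = (\<Sum>j<Suc K. ?t j)"
      by (rule associator_formula) (use K in auto)
    have right: "Y (D l (\<alpha> a)) s (Y (\<alpha> a) (int j) h) \<in> deg_le d" for s j
      unfolding Y_D_mode
      by (intro subspace_scale[OF subspace_deg_le] mode_deg_le nonneg_mode_deg_less h a) simp
    \<comment> \<open>For 0 <= s < l the mode vanishes because (s choose l) = 0; for s >= l it is a
      multiple of the nonnegative generator mode s - l.\<close>
    have left: "Y (\<alpha> a) p (Y (D l (\<alpha> a)) s h) \<in> deg_le d" if "s \<ge> 0" for p s
    proof (cases "s \<ge> int l")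
      case True
      then show ?thesis
        unfolding Y_D_mode
        by (intro mode_deg_le a subspace_scale[OF subspace_deg_less] nonneg_mode_deg_less h) simp
    next
      case False
      then have z: "nat s choose l = 0" by (intro binomial_eq_0) (use that in simp)
      have "(of_int s :: complex) gchoose l = of_nat (nat s choose l)"
        using that by (simp add: binomial_gbinomial)
      then have "(of_int s :: complex) gchoose l = 0" using z by simp
      then show ?thesis
        unfolding Y_D_mode by (simp add: subspace_0[OF subspace_deg_le])
    qed
    have term_deg: "?t j \<in> deg_le d" if "t + int j \<ge> 0" for j
      using that by (intro subspace_scale[OF subspace_deg_le] subspace_diff[OF subspace_deg_le] left right)
    have split: "Y (Y (\<alpha> a) ?r (D l (\<alpha> a))) t h = ?t 0 + (\<Sum>j<K. ?t (Suc j))"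
      unfolding assoc by (rule sum.lessThan_Suc_shift)
    have rest: "(\<Sum>j<K. ?t (Suc j)) \<in> deg_le d"
      using t by (intro subspace_sum[OF subspace_deg_le] term_deg) auto
    have head: "?t 0 - (if t = -1 then Y (\<alpha> a) ?r (Y (\<alpha> a) (- int l - 1) h) else 0) \<in> deg_le d"
    proof (cases "t = -1")
      case True
      have "(-1) ^ l * ((-1) ^ l :: complex) = 1" by (simp flip: power_mult_distrib)
      then have "Y (D l (\<alpha> a)) (-1) h = Y (\<alpha> a) (- int l - 1) h"
        unfolding Y_D_mode minus_diff_commute[of 1 "int l"] by (simp add: gchoose_minus_one)
      then have "?t 0 - (if t = -1 then Y (\<alpha> a) ?r (Y (\<alpha> a) (- int l - 1) h) else 0)
          = - scale (sg ?r) (Y (D l (\<alpha> a)) (t + ?r - int 0) (Y (\<alpha> a) (int 0) h))"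
        using True by simp
      also have "\<dots> \<in> deg_le d"
        by (intro subspace_neg[OF subspace_deg_le] subspace_scale[OF subspace_deg_le] right)
      finally show ?thesis .
    next
      case False
      then have "?t 0 \<in> deg_le d" using t by (intro term_deg) simp
      then show ?thesis using False by simp
    qed
    from subspace_add[OF subspace_deg_le head rest] show ?thesis
      unfolding split by (simp only: diff_add_eq)
  qed
  then have "(\<Sum>a<n. Y (Y (\<alpha> a) (- int k - 1) (D l (\<alpha> a))) t h
      - (if t = -1 then Y (\<alpha> a) (- int k - 1) (Y (\<alpha> a) (- int l - 1) h) else 0)) \<in> deg_le d"
    by (intro subspace_sum[OF subspace_deg_le]) simp
  then show ?thesis
    by (cases "t = -1") (simp_all add: q_alt Y_linear Qm_alt sum_subtractf)
qed

lemma q_commute: "q k l = q l k"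
  unfolding q_def Qm_def by (intro sum.cong refl cr_cr heisenberg_family_\<alpha>)

lemma q_Inv: "q k l \<in> Inv"
  unfolding q_def by (intro Qm_Inv inv.vac_W)

lemma coef_q_weight: "coef (q k l) M \<noteq> 0 \<Longrightarrow> wt M = k + l + 2"
proof -
  assume "coef (q k l) M \<noteq> 0"
  then obtain a where a: "a < n" "coef (cr \<alpha> (a, k) (cr \<alpha> (a, l) vac)) M \<noteq> 0"
    unfolding q_def Qm_def coef_sum by (metis (no_types, lifting) lessThan_iff sum.not_neutral_contains_not_neutral)
  have "cr \<alpha> (a, k) (cr \<alpha> (a, l) vac) = mono \<alpha> {#(a, k), (a, l)#}"
    by (simp add: mono_add_mset[OF heisenberg_family_\<alpha>])
  then show ?thesis using a by (simp add: coef_mono split: if_splits)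
qed

lemma q_grading: "q k l \<in> invariants_grading (k + l + 2)"
  using q_Inv coef_q_weight by (auto simp: invariants_grading_def weight_space_iff)

text \<open>Induction on the degree: an invariant is a combination of \<open>vac\<close> and vectors
  \<open>Qm l k h\<close>, where h is an invariant of degree lower by two, and the star product of
  \<open>q l k\<close> with h agrees with \<open>Qm l k h\<close> up to an invariant within the
  degree bound for h.\<close>

lemma Inv_generated:
  assumes V: "subspace V" "vac \<in> V" "inv.OW \<subseteq> V"
    and star: "\<And>k l v. v \<in> V \<Longrightarrow> v \<in> Inv \<Longrightarrow> zhu_star invariants_grading (q k l) v \<in> V"
  shows "Inv \<subseteq> V"
proof -
  have "Inv \<inter> deg_le d \<subseteq> V" for d
  proof (induction d rule: less_induct)
    case (less d)
    show ?case
    proof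
      fix f assume f: "f \<in> Inv \<inter> deg_le d"
      define w where "w = Max (insert 0 (wt ` {M. coef f M \<noteq> 0}))"
      have "wt M \<le> w" if "coef f M \<noteq> 0" for M
        unfolding w_def using coef_finite[of f] that by (intro Max_ge) auto
      then have "f \<in> bounded w d" using f by (auto simp: bounded_def deg_le_def)
      then obtain g s where g: "g \<in> Inv" "g \<in> bounded w d"
        "f = (\<Sum>l<w. \<Sum>k<w. scale (1 / of_nat (Suc l) * (1 / of_nat (Suc k))) (Qm l k (Qp k l g))) + scale s vac"
        using invariants_first_fundamental f by blast
      have gd: "g \<in> deg_le d" using g(2) by (auto simp: bounded_def deg_le_def)
      have "Qm l k (Qp k l g) \<in> V" for k l
      proof -
        let ?h = "Qp k l g"
        have h: "?h \<in> Inv" using Qp_Inv g by blast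
        show ?thesis
        \<comment> \<open>For d < 2 there is no induction hypothesis at degree d - 2, but two
          annihilations give 0.\<close>
        proof (cases "d < 2")
          case True
          have "an \<alpha> (a, k) (an \<alpha> (a, l) g) = 0" if "a < n" for a
          proof (rule coef_ext)
            fix M
            have "an \<alpha> (a, l) g \<in> deg_less d" using an_deg_less[OF gd] that by simp
            then have "an \<alpha> (a, l) g \<in> deg_le (d - 1)" by (auto simp: deg_less_def deg_le_def)
            then have "an \<alpha> (a, k) (an \<alpha> (a, l) g) \<in> deg_less (d - 1)" using an_deg_less that by simp
            then show "coef (an \<alpha> (a, k) (an \<alpha> (a, l) g)) M = coef 0 M"
              using True by (auto simp: deg_less_def coef_linear)
          qed
          then have "?h = 0" by (simp add: Qp_def)
          then show ?thesis using V(1) by (simp add: subspace_0)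
        next
          case False
          have "an \<alpha> (a, k) (an \<alpha> (a, l) g) \<in> deg_le (d - 2)" if "a < n" for a
          proof -
            have "an \<alpha> (a, l) g \<in> deg_less (Suc (d - 1))" using an_deg_less[OF gd, of "(a, l)"] that False by simp
            then have "an \<alpha> (a, k) (an \<alpha> (a, l) g) \<in> deg_less (d - 1)"
              unfolding deg_less_Suc using an_deg_less that by simp
            moreover have "d - 1 = Suc (d - 2)" using False by simp
            ultimately show ?thesis by (simp only: deg_less_Suc)
          qed
          then have hd: "?h \<in> deg_le (d - 2)"
            unfolding Qp_def by (intro subspace_sum[OF subspace_deg_le]) simp
          have IH: "Inv \<inter> deg_le (d - 2) \<subseteq> V" using less.IH False by simp
          let ?s = "zhu_star invariants_grading (q l k) ?h"
          have "?s = (\<Sum>j\<le>l + k + 2. scale (of_nat ((l + k + 2) choose j)) (Y (q l k) (-1 + int j) ?h))"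
            by (simp only: inv.zhu_star_homogeneous[OF q_grading] zres_def)
          moreover have "Qm l k ?h = (\<Sum>j\<le>l + k + 2. scale (of_nat ((l + k + 2) choose j))
              (if -1 + int j = -1 then Qm l k ?h else 0))"
          proof -
            have "(\<Sum>j\<le>l + k + 2. scale (of_nat ((l + k + 2) choose j)) (if -1 + int j = -1 then Qm l k ?h else 0))
              = (\<Sum>j\<in>{0}. scale (of_nat ((l + k + 2) choose j)) (if -1 + int j = -1 then Qm l k ?h else 0))"
              by (rule sum.mono_neutral_right) auto
            then show ?thesis by simp
          qed
          ultimately have "?s - Qm l k ?h = (\<Sum>j\<le>l + k + 2. scale (of_nat ((l + k + 2) choose j))
              (Y (q l k) (-1 + int j) ?h - (if -1 + int j = -1 then Qm l k ?h else 0)))"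
            by (simp only: scale_right_diff_distrib sum_subtractf)
          also have "\<dots> \<in> deg_le (d - 2)"
            by (intro subspace_sum[OF subspace_deg_le] subspace_scale[OF subspace_deg_le] q_mode_leading hd) simp
          finally have "?s - Qm l k ?h \<in> deg_le (d - 2)" .
          moreover have "?s - Qm l k ?h \<in> Inv"
            by (intro inv.W_closed(3) inv.zhu_star_W q_Inv Qm_Inv h)
          ultimately have "?s - Qm l k ?h \<in> V" using IH by blast
          moreover have "?s \<in> V" using IH h hd by (intro star) auto
          ultimately have "?s - (?s - Qm l k ?h) \<in> V" using V(1) by (metis subspace_diff)
          then show ?thesis by simp
        qed
      qed
      then show "f \<in> V"
        unfolding g(3) using V by (intro subspace_add subspace_sum subspace_scale) auto
    qed
  qed
  moreover have "\<exists>d. v \<in> deg_le d" for v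
  proof
    show "v \<in> deg_le (Max (insert 0 (size ` {M. coef v M \<noteq> 0})))"
      unfolding deg_le_def using coef_finite[of v] by (auto intro!: Max_ge)
  qed
  ultimately show ?thesis by blast
qed

end

section \<open>Commutativity\<close>

lemma monic_prod_linear:
  fixes c :: "nat \<Rightarrow> complex"
  shows "degree (\<Prod>i<l. [:c i, 1:]) = l" "coeff (\<Prod>i<l. [:c i, 1:]) l = 1"
proof -
  have "degree (\<Prod>i<l. [:c i, 1:]) = l \<and> lead_coeff (\<Prod>i<l. [:c i, 1:]) = 1"
  proof (induction l)
    case 0
    then show ?case by simp
  next
    case (Suc l)
    let ?P = "\<Prod>i<l. [:c i, 1:]"
    have "?P \<noteq> 0" using Suc by auto
    then have "degree (?P * [:c l, 1:]) = Suc l" using Suc by (subst degree_mult_eq) auto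
    moreover have "lead_coeff ?P = 1" using Suc by blast
    then have "lead_coeff (?P * [:c l, 1:]) = 1" by (simp only: lead_coeff_mult) simp
    ultimately show ?case by (simp only: prod.lessThan_Suc)
  qed
  then show "degree (\<Prod>i<l. [:c i, 1:]) = l" "coeff (\<Prod>i<l. [:c i, 1:]) l = 1" by metis+
qed

text \<open>
  The eigenvalue of the zero mode of the quadratic \<open>q 0 l\<close>, \<open>l\<close> even, on \<open>Y (\<alpha> i) p vac\<close> is a
  polynomial in \<open>p\<close> of degree \<open>l + 1\<close>.
\<close>

definition symbol :: "nat \<Rightarrow> complex poly" where
  "symbol l = Polynomial.smult (- 1 / fact l) ([:0, 1:] * ((\<Prod>i<l. [:of_nat l - of_nat i, 1:]) + (\<Prod>i<l. [:- 1 - of_nat i, 1:])))"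

lemma poly_symbol: "poly (symbol l) p = - p * ((p + of_nat l gchoose l) + (p - 1 gchoose l))"
  unfolding symbol_def gbinomial_prod_rev
  by (simp add: poly_prod atLeast0LessThan algebra_simps add_divide_distrib)

lemma coeff_symbol: "coeff (symbol l) (Suc l) = - 2 / fact l"
  by (simp add: symbol_def monic_prod_linear)

lemma degree_symbol: "degree (symbol l) \<le> Suc l"
proof -
  have "degree ((\<Prod>i<l. [:of_nat l - of_nat i, 1:]) + (\<Prod>i<l. [:- 1 - of_nat i :: complex, 1:])) \<le> l"
    by (rule degree_add_le) (simp_all add: monic_prod_linear)
  then have "degree ([:0, 1:] * ((\<Prod>i<l. [:of_nat l - of_nat i, 1:]) + (\<Prod>i<l. [:- 1 - of_nat i :: complex, 1:]))) \<le> Suc l"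
    by (intro order_trans[OF degree_mult_le]) simp
  then show ?thesis
    unfolding symbol_def using degree_smult_le order_trans by blast
qed

text \<open>The relation holds at the infinitely many points -s - 1, hence between polynomials. In
  \<open>symbol\<close> the two monic products add up instead of cancelling, so the degrees 2r + 1
  are attained and distinct, and the top coefficient can be peeled off.\<close>

lemma symbols_independent:
  assumes "\<And>s::nat. (\<Sum>r<N. y r * poly (symbol (2 * r)) (- of_nat s - 1)) = 0" "r < N"
  shows "y r = 0"
proof -
  let ?P = "\<Sum>r<N. Polynomial.smult (y r) (symbol (2 * r))"
  have "range (\<lambda>s::nat. - of_nat s - 1 :: complex) \<subseteq> {x. poly ?P x = 0}"
    using assms(1) by (auto simp: poly_sum)
  moreover have "inj (\<lambda>s::nat. - of_nat s - 1 :: complex)"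
    by (auto simp: inj_def)
  ultimately have "infinite {x. poly ?P x = 0}"
    using finite_subset range_inj_infinite by blast
  then have "?P = 0" using poly_roots_finite by blast
  then show ?thesis using assms(2)
  proof (induction N)
    case 0
    then show ?case by simp
  next
    case (Suc N)
    have "coeff (\<Sum>r<N. Polynomial.smult (y r) (symbol (2 * r))) (Suc (2 * N)) = 0"
      unfolding coeff_sum coeff_smult
    proof (rule sum.neutral, rule ballI)
      fix r assume "r \<in> {..<N}"
      then have "degree (symbol (2 * r)) < Suc (2 * N)"
        using degree_symbol[of "2 * r"] by simp
      then show "y r * coeff (symbol (2 * r)) (Suc (2 * N)) = 0"
        by (simp add: coeff_eq_0)
    qed
    then have "y N = 0"
      using arg_cong[OF Suc.prems(1), of "\<lambda>p. coeff p (Suc (2 * N))"] coeff_symbol[of "2 * N"]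
      by simp
    then show ?case
      using Suc by (cases "r = N") auto
  qed
qed

context heisenberg_vertex_algebra
begin

section \<open>Brackets of quadratic invariants\<close>

lemma cr_vac: "i < n \<Longrightarrow> cr \<alpha> (i, l) vac = D l (\<alpha> i)"
  by (simp add: cr_def D_def minus_diff_commute[of 1 "int l"])

lemma generator_q:
  assumes "i < n"
  shows "Y (\<alpha> i) (int s) (q k l) = (if s = Suc k then scale (of_nat (Suc k)) (D l (\<alpha> i)) else 0)
    + (if s = Suc l then scale (of_nat (Suc l)) (D k (\<alpha> i)) else 0)"
proof (cases s)
  case 0
  then show ?thesis using zero_mode assms by simp
next
  case (Suc s')
  have "Y (\<alpha> i) (int s) (q k l) = an \<alpha> (i, s') (q k l)"
    by (simp add: an_def Suc add.commute)
  also have "\<dots> = (\<Sum>a<n. if a = i then (if s' = l then scale (of_nat (Suc l)) (D k (\<alpha> i)) else 0)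
      + (if s' = k then scale (of_nat (Suc k)) (D l (\<alpha> i)) else 0) else 0)"
    unfolding q_def Qm_def an_sum
  proof (intro sum.cong refl)
    fix a assume "a \<in> {..<n}"
    then have a: "a < n" by simp
    have "an \<alpha> (i, s') vac = 0" by (simp add: an_def creation)
    then show "an \<alpha> (i, s') (cr \<alpha> (a, k) (cr \<alpha> (a, l) vac)) = (if a = i then (if s' = l then scale (of_nat (Suc l)) (D k (\<alpha> i)) else 0)
      + (if s' = k then scale (of_nat (Suc k)) (D l (\<alpha> i)) else 0) else 0)"
      using a assms by (auto simp: an_cr[OF heisenberg_family_\<alpha>] cr_linear cr_vac[symmetric])
  qed
  also have "\<dots> = (if s' = l then scale (of_nat (Suc l)) (D k (\<alpha> i)) else 0)
      + (if s' = k then scale (of_nat (Suc k)) (D l (\<alpha> i)) else 0)"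
    using assms by (simp add: sum.delta)
  finally show ?thesis by (simp add: Suc add.commute)
qed

text \<open>The constant in the commutator of (q k l)_j with a generator mode of index p. Each
  summand combines the binomial of the commutator formula, one contraction and the mode of a divided
  derivative; the minus sign comes from exchanging the entries of the commutator.\<close>

definition gam :: "nat \<Rightarrow> nat \<Rightarrow> int \<Rightarrow> int \<Rightarrow> complex" where
  "gam k l p j = - ((of_int p gchoose Suc k) * of_nat (Suc k) * ((-1) ^ l * (of_int (p + j - int (Suc k)) gchoose l))
    + (of_int p gchoose Suc l) * of_nat (Suc l) * ((-1) ^ k * (of_int (p + j - int (Suc l)) gchoose k)))"

lemma q_generator:
  assumes i: "i < n"
  shows "Y (q k l) j (Y (\<alpha> i) p c) = Y (\<alpha> i) p (Y (q k l) j c)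
    + scale (gam k l p j) (Y (\<alpha> i) (p + j - int k - int l - 1) c)"
proof -
  let ?K = "k + l + 3"
  let ?x = "scale ((of_int p gchoose Suc k) * of_nat (Suc k)) (Y (D l (\<alpha> i)) (p + j - int (Suc k)) c)"
  let ?z = "scale ((of_int p gchoose Suc l) * of_nat (Suc l)) (Y (D k (\<alpha> i)) (p + j - int (Suc l)) c)"
  have "Y (\<alpha> i) p (Y (q k l) j c) - Y (q k l) j (Y (\<alpha> i) p c)
      = (\<Sum>s<?K. scale (of_int p gchoose s) (Y (Y (\<alpha> i) (int s) (q k l)) (p + j - int s) c))"
    by (rule commutator_formula) (simp add: generator_q i)
  also have "\<dots> = (\<Sum>s<?K. (if s = Suc k then ?x else 0) + (if s = Suc l then ?z else 0))"
    by (intro sum.cong refl) (auto simp: generator_q i Y_linear scale_right_distrib simp del: of_nat_Suc)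
  also have "\<dots> = ?x + ?z"
    by (simp add: sum.distrib)
  also have "\<dots> = scale (- gam k l p j) (Y (\<alpha> i) (p + j - int k - int l - 1) c)"
  proof -
    have "p + j - int (Suc k) - int l = p + j - int k - int l - 1"
      "p + j - int (Suc l) - int k = p + j - int k - int l - 1" by auto
    then show ?thesis
      unfolding Y_D_mode gam_def by (simp only: scale_scale minus_minus scale_left_distrib mult.assoc)
  qed
  finally show ?thesis by (simp add: algebra_simps)
qed

text \<open>Nonnegative modes of a quadratic kill the vacuum, and commuting them past a generator
  mode only shifts its index, so the product is again quadratic. The bound on j keeps the shifted
  modes among the creation modes.\<close>

lemma q_q:
  assumes "j \<le> k + l + 1"
  shows "Y (q k l) (int j) (q k' l') = scale (gam k l (- int k' - 1) (int j)) (q (k' + (k + l + 1 - j)) l')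
    + scale (gam k l (- int l' - 1) (int j)) (q k' (l' + (k + l + 1 - j)))"
proof -
  have e: "- int x - 1 + int j - int k - int l - 1 = - int (x + (k + l + 1 - j)) - 1" for x
    using assms by (simp add: of_nat_diff)
  have vac: "Y (q k l) (int j) vac = 0" by (simp add: creation)
  have "Y (q k l) (int j) (q k' l')
    = (\<Sum>i<n. Y (q k l) (int j) (Y (\<alpha> i) (- int k' - 1) (Y (\<alpha> i) (- int l' - 1) vac)))"
    by (simp only: q_def[of k' l'] Qm_alt Y_sum_right)
  also have "\<dots> = (\<Sum>i<n. scale (gam k l (- int k' - 1) (int j))
        (Y (\<alpha> i) (- int (k' + (k + l + 1 - j)) - 1) (Y (\<alpha> i) (- int l' - 1) vac))
      + scale (gam k l (- int l' - 1) (int j))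
        (Y (\<alpha> i) (- int k' - 1) (Y (\<alpha> i) (- int (l' + (k + l + 1 - j)) - 1) vac)))"
  proof (intro sum.cong refl)
    fix i assume "i \<in> {..<n}"
    then have i: "i < n" by simp
    show "Y (q k l) (int j) (Y (\<alpha> i) (- int k' - 1) (Y (\<alpha> i) (- int l' - 1) vac))
      = scale (gam k l (- int k' - 1) (int j))
        (Y (\<alpha> i) (- int (k' + (k + l + 1 - j)) - 1) (Y (\<alpha> i) (- int l' - 1) vac))
      + scale (gam k l (- int l' - 1) (int j))
        (Y (\<alpha> i) (- int k' - 1) (Y (\<alpha> i) (- int (l' + (k + l + 1 - j)) - 1) vac))"
      by (simp only: q_generator[OF i] vac e Y_zero_right Y_linear add_0_left add_0_right, rule add.commute)
  qed
  also have "\<dots> = scale (gam k l (- int k' - 1) (int j)) (q (k' + (k + l + 1 - j)) l')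
    + scale (gam k l (- int l' - 1) (int j)) (q k' (l' + (k + l + 1 - j)))"
    by (simp only: q_def Qm_alt sum.distrib scale_sum_right)
  finally show ?thesis .
qed

abbreviation probe :: "nat \<Rightarrow> 'v" where
  "probe s \<equiv> Y (\<alpha> 0) (- int s - 1) vac"

lemma q_zero_mode_probe:
  assumes "n > 0"
  shows "Y (q k l) (int (k + l + 1)) (probe s) = scale (gam k l (- int s - 1) (int (k + l + 1))) (probe s)"
proof -
  have "Y (q k l) (int (k + l + 1)) vac = 0" by (rule creation) simp
  moreover have "- int s - 1 + int (k + l + 1) - int k - int l - 1 = - int s - 1" by simp
  ultimately show ?thesis
    by (simp only: q_generator[OF assms] Y_zero_right add_0_left)
qed

lemma zero_mode_op_q_probe:
  "n > 0 \<Longrightarrow> inv.zero_mode_op (q k l) (probe s) = scale (gam k l (- int s - 1) (int (k + l + 1))) (probe s)"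
  by (subst inv.zero_mode_op_homogeneous[OF q_grading]) (simp add: q_zero_mode_probe[simplified])

lemma probe_nonzero:
  assumes "n > 0"
  shows "probe s \<noteq> 0"
proof
  assume "probe s = 0"
  moreover have "probe s = mono \<alpha> {#(0, s)#}"
    using assms by (simp add: mono_add_mset[OF heisenberg_family_\<alpha>] cr_def)
  ultimately have "coef (mono \<alpha> {#(0, s)#}) {#(0, s)#} = 0" by (simp add: coef_linear)
  then show False using assms by (simp add: coef_mono)
qed

text \<open>For k = 0 the second summand of \<open>gam\<close> becomes p times (p-1 choose 2r) by
  absorption, and the even index 2r removes the sign of the first.\<close>

lemma gam_symbol: "gam 0 (2 * r) p (int (2 * r + 1)) = poly (symbol (2 * r)) (of_int p)"
proof -
  have "of_nat (Suc (2 * r)) * ((of_int p :: complex) gchoose Suc (2 * r)) = of_int p * ((of_int p - 1) gchoose (2 * r))"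
    by (rule gbinomial_absorption)
  moreover have "p + int (2 * r + 1) - int (Suc 0) = p + int (2 * r)" by simp
  ultimately show ?thesis
    unfolding gam_def poly_symbol by (simp add: algebra_simps)
qed

text \<open>Membership in O(W) alone gives no control of the zero modes on the probes, so the
  elements discarded in the reduction carry both properties.\<close>

definition negligible :: "'v set" where
  "negligible = {z \<in> inv.OW. \<forall>s. inv.zero_mode_op z (probe s) = 0}"

lemma subspace_negligible: "subspace negligible"
  by (auto simp: subspace_def negligible_def inv.O_closed inv.zero_mode_op_add inv.zero_mode_op_scale inv.O_W)

section \<open>Reduction of quadratics modulo translation relations\<close>

lemma T_q: "D (Suc 0) (q k l) = scale (of_nat (Suc k)) (q (Suc k) l) + scale (of_nat (Suc l)) (q k (Suc l))"
proof -
  have T: "D (Suc 0) (Y (\<alpha> a) (- int x - 1) v)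
      = Y (\<alpha> a) (- int x - 1) (D (Suc 0) v) + scale (of_nat (Suc x)) (Y (\<alpha> a) (- int (Suc x) - 1) v)" for a x v
    using T_Y[of "\<alpha> a" "- int x - 1" v] by (simp add: algebra_simps)
  show ?thesis
    unfolding q_def Qm_alt
    by (simp only: D_linear T T_vac Y_zero_right add_0_left add_0_right Y_linear sum.distrib scale_sum_right add.commute)
qed

lemma q_relation:
  "scale (of_nat (Suc k)) (q (Suc k) l) + scale (of_nat (Suc l)) (q k (Suc l)) + scale (of_nat (k + l + 2)) (q k l)
    \<in> negligible"
  using inv.T_plus_weight_O[OF q_grading, of k l] inv.zero_mode_op_T[OF q_grading, of k l]
  by (auto simp: negligible_def T_q)

text \<open>By \<open>q_relation\<close>, modulo smaller k + l, the elements
  \<open>q (Suc k) l\<close> and \<open>q k (Suc l)\<close> are proportional, so everything reduces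
  to \<open>q 0 N\<close>. For N = 2m + 1 the relation at k = l = m and the symmetry of
  \<open>q\<close> show that 2(m+1) times \<open>q (Suc m) m\<close> reduces to smaller sums, so
  only even N remain.\<close>

lemma q_reduce:
  "q k l \<in> {u + z | u z. u \<in> span (range (\<lambda>r. q 0 (2 * r))) \<and> z \<in> negligible}" (is "_ \<in> ?S")
proof -
  have S: "subspace ?S"
    using subspace_span subspace_negligible by (rule subspace_sums)
  have neg: "z \<in> ?S" if "z \<in> negligible" for z
    using that span_zero by (intro CollectI exI[of _ 0] exI[of _ z]) auto
  have even: "q 0 (2 * r) \<in> ?S" for r
    using subspace_0[OF subspace_negligible]
    by (intro CollectI exI[of _ "q 0 (2 * r)"] exI[of _ 0]) (auto intro: span_base)
  have unscale: "v \<in> ?S" if "scale c v \<in> ?S" "c \<noteq> 0" for c v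
    using subspace_scale[OF S that(1), of "inverse c"] that(2) by simp
  have "\<forall>k l. k + l = N \<longrightarrow> q k l \<in> ?S" for N
  proof (induction N rule: less_induct)
    case (less N)
    have rel: "scale (of_nat (Suc k)) (q (Suc k) l) + scale (of_nat (Suc l)) (q k (Suc l)) \<in> ?S" if "Suc (k + l) = N" for k l
    proof -
      have "k + l < N" using that by simp
      from less.IH[OF this] have "q k l \<in> ?S" by blast
      from subspace_diff[OF S neg[OF q_relation[of k l]] subspace_scale[OF S this, of "of_nat (k + l + 2)"]]
      show ?thesis by (simp only: add_diff_cancel_right')
    qed
    have step: "q (Suc k) l \<in> ?S \<longleftrightarrow> q k (Suc l) \<in> ?S" if "Suc (k + l) = N" for k l
    proof
      assume "q (Suc k) l \<in> ?S"
      from subspace_diff[OF S rel[OF that] subspace_scale[OF S this, of "of_nat (Suc k)"]]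
      have "scale (of_nat (Suc l)) (q k (Suc l)) \<in> ?S" by (simp only: add_diff_cancel_left')
      then show "q k (Suc l) \<in> ?S" by (rule unscale) (simp only: of_nat_eq_0_iff)
    next
      assume "q k (Suc l) \<in> ?S"
      from subspace_diff[OF S rel[OF that] subspace_scale[OF S this, of "of_nat (Suc l)"]]
      have "scale (of_nat (Suc k)) (q (Suc k) l) \<in> ?S" by (simp only: add_diff_cancel_right')
      then show "q (Suc k) l \<in> ?S" by (rule unscale) (simp only: of_nat_eq_0_iff)
    qed
    have chain: "q k (N - k) \<in> ?S \<longleftrightarrow> q 0 N \<in> ?S" if "k \<le> N" for k
      using that
    proof (induction k)
      case 0
      then show ?case by simp
    next
      case (Suc k)
      have "Suc (N - Suc k) = N - k" "Suc (k + (N - Suc k)) = N" using Suc.prems by auto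
      then show ?case using Suc step[of k "N - Suc k"] by simp
    qed
    have q0: "q 0 N \<in> ?S"
    proof (cases "even N")
      case True
      then show ?thesis using even[of "N div 2"] by simp
    next
      case False
      then obtain m where m: "N = 2 * m + 1" by (elim oddE)
      have "scale (of_nat (Suc m)) (q (Suc m) m) + scale (of_nat (Suc m)) (q (Suc m) m) \<in> ?S"
        using rel[of m m] m q_commute[of m "Suc m"] by simp
      then have "scale (of_nat (Suc m) + of_nat (Suc m)) (q (Suc m) m) \<in> ?S"
        by (simp only: scale_left_distrib)
      moreover have "of_nat (Suc m) + of_nat (Suc m) \<noteq> (0::complex)"
        unfolding of_nat_add[symmetric] of_nat_eq_0_iff by simp
      ultimately have "q (Suc m) m \<in> ?S" by (rule unscale)
      moreover have "N - Suc m = m" "Suc m \<le> N" using m by auto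
      ultimately show ?thesis using chain[of "Suc m"] by simp
    qed
    show ?case
    proof (intro allI impI)
      fix k l assume kl: "k + l = N"
      then have "k \<le> N" "N - k = l" by auto
      then show "q k l \<in> ?S" using iffD2[OF chain q0, of k] by (simp only:)
    qed
  qed
  then show ?thesis by blast
qed

text \<open>After the reduction a combination of the \<open>q 0 (2 * r)\<close> remains, whose zero
  mode acts on the probes by the eigenvalue polynomials; vanishing on all probes forces its
  coefficients to be zero.\<close>

lemma q_span_zero_mode:
  assumes n: "n > 0" and v: "v \<in> span {q k l | k l. True}" and zero: "\<And>s. inv.zero_mode_op v (probe s) = 0"
  shows "v \<in> inv.OW"
proof -
  let ?S = "{u + z | u z. u \<in> span (range (\<lambda>r. q 0 (2 * r))) \<and> z \<in> negligible}"
  have "span {q k l | k l. True} \<subseteq> ?S"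
    by (rule span_minimal) (use q_reduce subspace_sums[OF subspace_span subspace_negligible] in auto)
  then obtain u z where uz: "v = u + z" "u \<in> span (range (\<lambda>r. q 0 (2 * r)))" "z \<in> negligible"
    using v by blast
  have z: "z \<in> inv.OW" "inv.zero_mode_op z (probe s) = 0" for s
    using uz(3) by (auto simp: negligible_def)
  have "\<exists>N y. u = (\<Sum>r<N. scale (y r) (q 0 (2 * r)))"
    using uz(2)
  proof (induction u rule: span_induct_alt)
    case base
    show ?case by (intro exI[of _ 0]) simp
  next
    case (step c x u)
    then obtain N y where y: "u = (\<Sum>r<N. scale (y r) (q 0 (2 * r)))" by blast
    obtain t where t: "x = q 0 (2 * t)" using step by blast
    let ?y = "\<lambda>r. (if r = t then c else 0) + (if r < N then y r else 0)"
    have "(\<Sum>r<N + Suc t. scale (?y r) (q 0 (2 * r)))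
        = (\<Sum>r<N + Suc t. if r = t then scale c x else 0) + (\<Sum>r<N + Suc t. if r < N then scale (y r) (q 0 (2 * r)) else 0)"
      unfolding sum.distrib[symmetric] by (intro sum.cong refl) (auto simp: t scale_left_distrib)
    also have "(\<Sum>r<N + Suc t. if r < N then scale (y r) (q 0 (2 * r)) else 0) = u"
      unfolding y by (rule sum.mono_neutral_cong_right) auto
    finally show ?case by (intro exI[of _ "N + Suc t"] exI[of _ ?y]) simp
  qed
  then obtain N y where y: "u = (\<Sum>r<N. scale (y r) (q 0 (2 * r)))" by blast
  have u: "u \<in> Inv" unfolding y by (intro inv.W_closed q_Inv)
  have "(\<Sum>r<N. y r * poly (symbol (2 * r)) (- of_nat s - 1)) = 0" for s
  proof -
    have "inv.zero_mode_op u (probe s) = 0"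
      using zero[of s] z u by (simp add: uz(1) inv.zero_mode_op_add inv.O_W)
    moreover have "inv.zero_mode_op u (probe s)
        = scale (\<Sum>r<N. y r * poly (symbol (2 * r)) (- of_nat s - 1)) (probe s)"
    proof -
      have "inv.zero_mode_op u (probe s) = (\<Sum>r<N. scale (y r) (inv.zero_mode_op (q 0 (2 * r)) (probe s)))"
        unfolding y by (simp add: inv.zero_mode_op_sum inv.zero_mode_op_scale q_Inv inv.W_closed)
      also have "\<dots> = (\<Sum>r<N. scale (y r * poly (symbol (2 * r)) (- of_nat s - 1)) (probe s))"
        using gam_symbol[of _ "- int s - 1"] by (intro sum.cong refl) (simp add: zero_mode_op_q_probe[OF n])
      finally show ?thesis by (simp add: scale_sum_left)
    qed
    ultimately show ?thesis using probe_nonzero[OF n] by simp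
  qed
  then have "y r = 0" if "r < N" for r
    using symbols_independent that by blast
  then have "u = 0" unfolding y by (intro sum.neutral) simp
  then show ?thesis using uz(1) z by simp
qed

text \<open>The star commutator is congruent to the bracket, a combination of quadratics. The zero
  mode of the bracket is a commutator of two operators that act on each probe by scalars, hence
  vanishes there.\<close>

lemma q_star_commute:
  assumes n: "n > 0"
  shows "zhu_star invariants_grading (q k l) (q k' l') - zhu_star invariants_grading (q k' l') (q k l) \<in> inv.OW"
proof -
  let ?m = "k + l + 2"
  obtain K where K: "\<And>j. j \<ge> K \<Longrightarrow> Y (q k l) (int j) (q k' l') = 0" using commutator_bound by blast
  let ?b = "\<Sum>j<K. scale (of_nat ?m - 1 gchoose j) (Y (q k l) (int j) (q k' l'))"
  have diff: "zhu_star invariants_grading (q k l) (q k' l') - zhu_star invariants_grading (q k' l') (q k l) - ?b \<in> inv.OW"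
    by (rule inv.zhu_commutator[OF q_grading q_grading]) (rule K)
  have "?b \<in> inv.OW"
  proof (rule q_span_zero_mode[OF n])
    show "?b \<in> span {q k l | k l. True}"
    proof (intro span_sum)
      fix j
      show "scale (of_nat ?m - 1 gchoose j) (Y (q k l) (int j) (q k' l')) \<in> span {q k l | k l. True}"
      proof (cases "j \<le> k + l + 1")
        case True
        show ?thesis
          unfolding q_q[OF True] by (intro span_scale span_add span_base) auto
      next
        \<comment> \<open>Beyond k + l + 1, one less than the weight, the binomial coefficient is 0,
          so the products not covered by \<open>q_q\<close> drop out.\<close>
        case False
        have "of_nat ?m - 1 = (of_nat (k + l + 1) :: complex)" by simp
        moreover have "(of_nat (k + l + 1) :: complex) gchoose j = of_nat ((k + l + 1) choose j)"
          by (rule binomial_gbinomial[symmetric])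
        moreover have "(k + l + 1) choose j = 0" using False by (intro binomial_eq_0) simp
        ultimately have "(of_nat ?m - 1 :: complex) gchoose j = 0" by (simp only: of_nat_0)
        then show ?thesis by (simp add: span_zero)
      qed
    qed
    show "inv.zero_mode_op ?b (probe s) = 0" for s
    proof -
      have z: "int ?m - 1 = int (k + l + 1)" "int (k' + l' + 2) - 1 = int (k' + l' + 1)" by auto
      have "inv.zero_mode_op ?b (probe s)
        = Y (q k l) (int ?m - 1) (Y (q k' l') (int (k' + l' + 2) - 1) (probe s))
          - Y (q k' l') (int (k' + l' + 2) - 1) (Y (q k l) (int ?m - 1) (probe s))"
        by (rule inv.zero_mode_op_bracket[OF q_grading q_grading]) (use K in auto)
      then show ?thesis
        unfolding z q_zero_mode_probe[OF n] Y_scale_right by (simp add: mult.commute)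
    qed
  qed
  from inv.O_closed(2)[OF diff this] show ?thesis
    by (simp only: diff_add_cancel)
qed

theorem zhu_algebra_of_invariants_commutative:
  assumes "n > 0"
  shows "Module.algebra complex_ring zhu_algebra_of_invariants"
  unfolding zhu_algebra_of_invariants_def
proof (rule inv.zhu_algebra_is_algebra, rule inv.zhu_commute_of_generators)
  show "{q k l | k l. True} \<subseteq> Inv" using q_Inv by auto
  show "Inv \<subseteq> V" if "subspace V" "vac \<in> V" "inv.OW \<subseteq> V"
    "\<And>s v. s \<in> {q k l | k l. True} \<Longrightarrow> v \<in> V \<Longrightarrow> v \<in> Inv \<Longrightarrow> zhu_star invariants_grading s v \<in> V" for V
    by (rule Inv_generated) (use that in blast)+
qed (use q_star_commute[OF assms] in auto)

end

theorem theorem5p1: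
  fixes scale :: "complex \<Rightarrow> 'v::ab_group_add \<Rightarrow> 'v"
    and vac :: 'v and Y :: "'v \<Rightarrow> int \<Rightarrow> 'v \<Rightarrow> 'v"
    and n :: nat and \<alpha> :: "nat \<Rightarrow> 'v"
  assumes "n \<ge> 1"
    and "heisenberg_vertex_algebra scale vac Y n \<alpha>"
  shows "Module.algebra complex_ring
    (heisenberg_vertex_algebra.zhu_algebra_of_invariants scale vac Y n \<alpha>)"
proof -
  interpret heisenberg_vertex_algebra scale vac Y n \<alpha> by fact
  show ?thesis
    by (rule zhu_algebra_of_invariants_commutative) (use assms(1) in linarith)
qed

end
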